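(* There exist a universal constant $C$ and, for each $c\in(0,1]$, a constant $C(c)$ depending on $c$ alone, such that the following holds for every $n\ge2$ and $\sigma>0$. Suppose $\theta^*\in\mathbb{R}^n$ has $k\ge1$ jumps with signs $s_1,\dots,s_k$ and suppose $n_0,n_1,\dots,n_k$ denote the lengths of the constant pieces of $\theta^*$; put $s_0=s_{k+1}=0$. Let $Y\sim N_n(\theta^*,\sigma^2I_n)$ and let $\lambda^*$ be as defined in the context. Then for every $\lambda\ge\lambda^*$, $$R(\hat\theta^{(1)}_\lambda,\theta^* )\le C\sigma^2\left(\Delta_1(\theta^* )+\frac{(\lambda-\lambda^* )^2}{n}\sum_{i=0}^k\frac{I\{s_i\ne s_{i+1}\}}{n_i}\right).$$ Further, if $n_i\ge\frac{cn}{k+1}$ for every $0\le i\le k$ with $s_i\ne s_{i+1}$ (minimum length condition with constant $c$), then for every $\lambda\ge\lambda^*$, $$R(\hat\theta^{(1)}_\lambda,\theta^* )\le C(c)\sigma^2\left(\frac{k+1}{n}\log\frac{en}{k+1}+(\lambda-\lambda^* )^2\frac{k+1}{n^2}\sum_{i=0}^kI\{s_i\ne s_{i+1}\}\right).$$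
   Context: For $\theta\in\mathbb{R}^n$, $D\theta := (\theta_2-\theta_1,\dots,\theta_n-\theta_{n-1})$. $\|\cdot\|$ is the Euclidean norm, $\|\cdot\|_1$ the $\ell^1$ norm. Penalized estimator of order $r=1$: $\hat\theta^{(1)}_\lambda := \operatorname{argmin}_{\theta\in\mathbb{R}^n}\big(\frac12\|Y-\theta\|^2+\sigma\lambda\|D\theta\|_1\big)$. Risk: $R(\hat\theta,\theta^* ) := \frac1n\mathbb{E}_{\theta^*}\|\hat\theta-\theta^*\|^2$. Jumps: an index $2\le j\le n$ is a jump of $\theta$ if $\theta_{j-1}\ne\theta_j$; its sign is $+1$ if $\theta_{j-1}<\theta_j$ and $-1$ otherwise. If $2\le j_1<\dots<j_k\le n$ are the jumps of $\theta^*$, then $n_0=j_1-1$, $n_i=j_{i+1}-j_i$ ($1\le i\le k-1$), $n_k=n+1-j_k$. Let $n_{i*} := \min(n_i,\frac n{k+1})$, $\delta_1(\theta^* ) := \big(n_{0*}^{-1}+n_{k*}^{-1}+\sum_{i=1}^{k-1}n_{i*}^{-1}I\{s_i\ne s_{i+1}\}\big)^{1/2}$ and $$\Delta_1(\theta^* ) := \frac{k+1}{n}\log\frac{en}{k+1}+\frac{\delta_1^2(\theta^* )}{n}\cdot\frac{n}{k+1}\log\frac{en}{k+1}+\frac{\delta_1(\theta^* )}{\sqrt n}.$$ With $f(\theta) := \|D\theta\|_1$, subdifferential $\partial f(\theta^* )$ and $\operatorname{aff}$ denoting the affine hull, let $v_0 := \operatorname{argmin}_{v\in\operatorname{aff}(\partial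 f(\theta^* ))}\|v\|$ (which is non-zero), $\lambda_{\theta^*}(z) := \operatorname{argmin}_{\lambda\ge0}\inf_{v\in\partial f(\theta^* )}\|z-\lambda v\|$ for $z\in\mathbb{R}^n$ (uniquely defined), and $\lambda^* := \mathbb{E}\lambda_{\theta^*}(Z)+\frac2{\|v_0\|}$ where $Z\sim N_n(0,I_n)$. The paper assumes $n\ge2r$ throughout (here $r=1$). *)

theory Defs
  imports "HOL-Probability.Probability"
begin

(* The dimension n is quantified inside the theorem, after the constants, so R^n is not a type
   here: it is the set of functions on {1..n} (extended by undefined), which is also the space of
   the product measures over {1..n}. *)
definition Rn :: "nat \<Rightarrow> (nat \<Rightarrow> real) set" where
  "Rn n = ({1..n} \<rightarrow>\<^sub>E UNIV)"

abbreviation vnorm :: "nat \<Rightarrow> (nat \<Rightarrow> real) \<Rightarrow> real" where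
  "vnorm n x \<equiv> L2_set x {1..n}"

definition diff_op :: "(nat \<Rightarrow> real) \<Rightarrow> nat \<Rightarrow> real" where
  "diff_op \<theta> i = \<theta> (i + 1) - \<theta> i"

definition total_var :: "nat \<Rightarrow> (nat \<Rightarrow> real) \<Rightarrow> real" where
  "total_var n \<theta> = (\<Sum>i = 1..n - 1. \<bar>diff_op \<theta> i\<bar>)"

definition gauss :: "nat \<Rightarrow> (nat \<Rightarrow> real) \<Rightarrow> real \<Rightarrow> (nat \<Rightarrow> real) measure" where
  "gauss n \<mu> \<sigma> = PiM {1..n} (\<lambda>i. density lborel (normal_density (\<mu> i) \<sigma>))"

definition tv_estimator :: "nat \<Rightarrow> real \<Rightarrow> real \<Rightarrow> (nat \<Rightarrow> real) \<Rightarrow> (nat \<Rightarrow> real)" where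
  "tv_estimator n \<sigma> l y =
     arg_min (\<lambda>\<theta>. 1 / 2 * (vnorm n (\<lambda>i. y i - \<theta> i))\<^sup>2 + \<sigma> * l * total_var n \<theta>) (\<lambda>\<theta>. \<theta> \<in> Rn n)"

(* The expectation is a nonnegative integral, so that an upper bound on the risk includes its
   finiteness. *)
definition risk ::
  "nat \<Rightarrow> real \<Rightarrow> ((nat \<Rightarrow> real) \<Rightarrow> (nat \<Rightarrow> real)) \<Rightarrow> (nat \<Rightarrow> real) \<Rightarrow> ennreal" where
  "risk n \<sigma> est \<theta> =
     ennreal (1 / real n) * (\<integral>\<^sup>+ y. ennreal ((vnorm n (\<lambda>i. est y i - \<theta> i))\<^sup>2) \<partial>gauss n \<theta> \<sigma>)"

definition jumps :: "nat \<Rightarrow> (nat \<Rightarrow> real) \<Rightarrow> nat set" where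
  "jumps n \<theta> = {j \<in> {2..n}. \<theta> (j - 1) \<noteq> \<theta> j}"

definition num_jumps :: "nat \<Rightarrow> (nat \<Rightarrow> real) \<Rightarrow> nat" where
  "num_jumps n \<theta> = card (jumps n \<theta>)"

(* knot n \<theta> i is the i-th jump j_i for 1 \<le> i \<le> k, with j_0 = 1 and j_(k+1) = n + 1; then
   n_i = j_(i+1) - j_i also for the two boundary pieces i = 0 and i = k. *)
definition knot :: "nat \<Rightarrow> (nat \<Rightarrow> real) \<Rightarrow> nat \<Rightarrow> nat" where
  "knot n \<theta> i = (1 # sorted_list_of_set (jumps n \<theta>) @ [n + 1]) ! i"

definition piece_length :: "nat \<Rightarrow> (nat \<Rightarrow> real) \<Rightarrow> nat \<Rightarrow> nat" where
  "piece_length n \<theta> i = knot n \<theta> (i + 1) - knot n \<theta> i"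

definition jump_sign :: "nat \<Rightarrow> (nat \<Rightarrow> real) \<Rightarrow> nat \<Rightarrow> int" where
  "jump_sign n \<theta> i =
     (if 1 \<le> i \<and> i \<le> num_jumps n \<theta>
      then (if \<theta> (knot n \<theta> i - 1) < \<theta> (knot n \<theta> i) then 1 else - 1)
      else 0)"

definition trunc_length :: "nat \<Rightarrow> (nat \<Rightarrow> real) \<Rightarrow> nat \<Rightarrow> real" where
  "trunc_length n \<theta> i =
     min (real (piece_length n \<theta> i)) (real n / (real (num_jumps n \<theta>) + 1))"

definition delta1 :: "nat \<Rightarrow> (nat \<Rightarrow> real) \<Rightarrow> real" where
  "delta1 n \<theta> = (let k = num_jumps n \<theta>; s = jump_sign n \<theta>; m = trunc_length n \<theta> in
     sqrt (inverse (m 0) + inverse (m k) +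
           (\<Sum>i = 1..k - 1. inverse (m i) * of_bool (s i \<noteq> s (i + 1)))))"

definition Delta1 :: "nat \<Rightarrow> (nat \<Rightarrow> real) \<Rightarrow> real" where
  "Delta1 n \<theta> = (let k = real (num_jumps n \<theta>); L = ln (exp 1 * real n / (k + 1)) in
     (k + 1) / real n * L
     + (delta1 n \<theta>)\<^sup>2 / real n * (real n / (k + 1)) * L
     + delta1 n \<theta> / sqrt (real n))"

definition subdifferential ::
  "nat \<Rightarrow> ((nat \<Rightarrow> real) \<Rightarrow> real) \<Rightarrow> (nat \<Rightarrow> real) \<Rightarrow> (nat \<Rightarrow> real) set" where
  "subdifferential n f \<theta> =
     {v \<in> Rn n. \<forall>\<eta> \<in> Rn n. f \<eta> \<ge> f \<theta> + (\<Sum>i = 1..n. v i * (\<eta> i - \<theta> i))}"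

(* Relative version of the constant affine, which needs a type of class real_vector; the affine
   hull below is then formed with the generic hull operator, as in the library. *)
definition affine_in :: "nat \<Rightarrow> (nat \<Rightarrow> real) set \<Rightarrow> bool" where
  "affine_in n V \<longleftrightarrow> V \<subseteq> Rn n \<and>
     (\<forall>x\<in>V. \<forall>y\<in>V. \<forall>u v. u + v = 1 \<longrightarrow> (\<lambda>i\<in>{1..n}. u * x i + v * y i) \<in> V)"

definition min_subgradient :: "nat \<Rightarrow> (nat \<Rightarrow> real) \<Rightarrow> (nat \<Rightarrow> real)" where
  "min_subgradient n \<theta> =
     arg_min (vnorm n) (\<lambda>v. v \<in> affine_in n hull subdifferential n (total_var n) \<theta>)"

definition lambda_of :: "nat \<Rightarrow> (nat \<Rightarrow> real) \<Rightarrow> (nat \<Rightarrow> real) \<Rightarrow> real" where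
  "lambda_of n \<theta> z =
     arg_min (\<lambda>l. INF v \<in> subdifferential n (total_var n) \<theta>. vnorm n (\<lambda>i. z i - l * v i))
       (\<lambda>l. l \<ge> 0)"

definition lambda_star :: "nat \<Rightarrow> (nat \<Rightarrow> real) \<Rightarrow> real" where
  "lambda_star n \<theta> =
     (\<integral>z. lambda_of n \<theta> z \<partial>gauss n (\<lambda>_. 0) 1) + 2 / vnorm n (min_subgradient n \<theta>)"

end

theory Submission
  imports Defs
begin

text \<open>
  Write \<open>D\<close> for the subdifferential of the total variation at \<open>\<theta>\<close>, \<open>Z\<close> for a standard Gaussian
  vector, \<open>k\<close> for the number of jumps, \<open>N = n / (k + 1)\<close> and \<open>L = ln (e * N)\<close>. The proof has a
  deterministic, a concentration and a constructive part.

  \<^item> Deterministic. The optimality condition of the estimator and monotonicity of subgradients bound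
    the loss at \<open>Y = \<theta> + \<sigma> * Z\<close> by \<open>\<sigma>\<close> times the distance of \<open>Z\<close> to the dilated set \<open>l * D\<close>
    (\<open>tv_estimator_loss_le\<close>). So everything is about the mean of the squared distance
    \<open>dist_scaled l Z\<close>.

  \<^item> Concentration. \<open>D\<close> consists of the negated increments of the paths \<open>w\<close> from 0 to 0 with values in
    \<open>[-1, 1]\<close> that equal the jump sign at every jump. Interpolating the signs linearly gives a point
    \<open>vbar\<close> of \<open>D\<close> that is constant on the pieces of \<open>\<theta>\<close>; perturbing \<open>\<theta>\<close> by small multiples of it
    shows that \<open>v \<mapsto> \<langle>v, vbar\<rangle>\<close> is constant on \<open>D\<close>. Hence \<open>vbar\<close> is the point of least norm of the
    affine hull, the squared norm \<open>V\<^sup>2\<close> is at most \<open>4 * (\<Sum> I{s i \<noteq> s (i + 1)} / n i)\<close>, and the best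
    scale \<open>\<lambda>(z)\<close> satisfies \<open>\<lambda>(z) * V\<^sup>2 = \<langle>P z, vbar\<rangle>\<close> with \<open>P\<close> the projection to the cone over \<open>D\<close>.
    If \<open>l \<ge> \<lambda>(z)\<close>, then adding \<open>(l - \<lambda>(z)) * vbar\<close> to \<open>P z\<close> gives a point of \<open>l * D\<close>, so the
    distance to \<open>l * D\<close> exceeds the distance to the cone by at most \<open>(l - \<lambda>(z)) * V\<close>. The Gaussian
    Poincare inequality gives bounded variance to both \<open>V * \<lambda>(Z)\<close> and \<open>dist_scaled l Z\<close>. The first
    makes the favourable case \<open>\<lambda>(Z) \<le> l\<close> have probability bounded below as soon as
    \<open>l \<ge> E \<lambda>(Z) + 2 / V\<close>, and the second transfers a bound that holds in that case to the mean
    (\<open>expected_square_dist_le\<close>).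

  \<^item> Constructive. The distance to the cone is at most the distance to \<open>r * D\<close> for any fixed \<open>r\<close>, and
    the latter is bounded by exhibiting a subgradient. In terms of \<open>y = S + r * w\<close>, with \<open>S\<close> the
    partial sums of \<open>Z\<close>, one needs a path \<open>y\<close> in the tube of radius \<open>r\<close> around \<open>S\<close> which touches the
    upper or lower wall at the jumps according to their signs, and the squared distance is the sum of
    the squared increments of \<open>y\<close>. Such a path is a lattice combination of three explicit ones: an
    interpolation of \<open>S\<close> on blocks of length about \<open>N\<close>, and for every jump a wall-hugging envelope
    on either side of it, whose cost is logarithmic by Doob's maximal inequality, together with a linear
    ramp when the signs at the two ends of a piece differ. Minima and maxima of paths cost at most the
    sum of the costs. For \<open>r\<^sup>2 = 16 * N * L\<close> the total is at most a constant times
    \<open>(k + 1) * L + N * L * V\<^sup>2\<close> (\<open>expected_square_dist_at_tube_width\<close>).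

  Both claims follow from \<open>risk_bound\<close>: the sum over the sign changes of \<open>1 / n i\<close> is at most
  \<open>\<delta>\<^sub>1(\<theta>)\<^sup>2\<close>, and under the minimum length condition it is at most \<open>(k + 1) / (c * n)\<close> times the number
  of sign changes.
\<close>

section \<open>The Poincare inequality on the line\<close>

definition std_gauss :: "real measure" where
  "std_gauss = density lborel (\<lambda>x. ennreal (std_normal_density x))"

lemma prob_space_std_gauss: "prob_space std_gauss"
  unfolding std_gauss_def by (rule prob_space_normal_density) simp

lemma sets_std_gauss [simp, measurable_cong]: "sets std_gauss = sets borel"
  by (simp add: std_gauss_def)

lemma space_std_gauss [simp]: "space std_gauss = UNIV"
  by (simp add: std_gauss_def)

lemma integrable_std_gauss_iff:
  fixes f :: "real \<Rightarrow> real"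
  assumes [measurable]: "f \<in> borel_measurable borel"
  shows "integrable std_gauss f \<longleftrightarrow> integrable lborel (\<lambda>x. std_normal_density x * f x)"
  unfolding std_gauss_def by (subst integrable_density) auto

lemma integral_std_gauss:
  fixes f :: "real \<Rightarrow> real"
  assumes [measurable]: "f \<in> borel_measurable borel"
  shows "integral\<^sup>L std_gauss f = (\<integral>x. std_normal_density x * f x \<partial>lborel)"
  unfolding std_gauss_def by (subst integral_density) auto

lemma integrable_std_gauss_power [simp]: "integrable std_gauss (\<lambda>x. x ^ k)"
  by (subst integrable_std_gauss_iff) (auto intro: integrable_std_normal_moment)

lemma integral_std_gauss_square [simp]: "(\<integral>x. x\<^sup>2 \<partial>std_gauss) = 1"
  by (subst integral_std_gauss) (use integral_std_normal_moment_even[of 1] in auto)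

lemma DERIV_std_normal_density:
  "(std_normal_density has_real_derivative - x * std_normal_density x) (at x)"
  unfolding std_normal_density_def by (auto intro!: derivative_eq_intros simp: field_simps)

text \<open>
  With \<open>\<phi>\<close> the density, so that \<open>\<phi>' = - x * \<phi>\<close>, the function \<open>G = - u\<^sup>2 * \<phi> / x\<close> satisfies
  \<open>G' = \<phi> * ((u / x - u')\<^sup>2 - u'\<^sup>2 + u\<^sup>2) \<ge> \<phi> * (u\<^sup>2 - u'\<^sup>2)\<close> for \<open>x \<noteq> 0\<close>; it is continuous at 0 because
  \<open>u 0 = 0\<close>, is \<open>\<le> 0\<close> at the right end and \<open>\<ge> 0\<close> at the left end of the interval.
\<close>

lemma gauss_hardy_interval:
  fixes u u' :: "real \<Rightarrow> real"
  assumes du: "\<And>x. (u has_real_derivative u' x) (at x)" and u0: "u 0 = 0"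
    and cont: "continuous_on UNIV u'" and M: "M > 0"
  shows "integral {-M..M} (\<lambda>x. std_normal_density x * ((u x)\<^sup>2 - (u' x)\<^sup>2)) \<le> 0"
proof -
  let ?\<phi> = std_normal_density
  let ?h = "\<lambda>x. ?\<phi> x * ((u x)\<^sup>2 - (u' x)\<^sup>2)"
  define G where "G x = - (u x)\<^sup>2 * ?\<phi> x / x" for x
  define K where "K x = integral {-M..x} ?h" for x
  have contu: "continuous_on S u" for S
    using du by (meson DERIV_isCont continuous_at_imp_continuous_on)
  have cont\<phi>: "continuous_on S ?\<phi>" for S
    using DERIV_std_normal_density by (meson DERIV_isCont continuous_at_imp_continuous_on)
  have conth: "continuous_on S ?h" for S
    by (intro continuous_intros contu cont\<phi>) (use cont continuous_on_subset in blast)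
  have dK: "(K has_real_derivative ?h x) (at x)" if "-M < x" "x < M" for x
  proof -
    have "(K has_real_derivative ?h x) (at x within {-M..M})"
      unfolding K_def using integral_has_real_derivative[OF conth, of x "-M" M] that by simp
    then show ?thesis
      using that by (simp add: at_within_Icc_at)
  qed
  have contK: "continuous_on {-M..M} K"
    unfolding K_def by (rule indefinite_integral_continuous_1) (rule integrable_continuous_real[OF conth])
  have dG: "(G has_real_derivative ?\<phi> x * ((u x / x - u' x)\<^sup>2 - (u' x)\<^sup>2 + (u x)\<^sup>2)) (at x)"
    if "x \<noteq> 0" for x
    unfolding G_def
    by (rule derivative_eq_intros du DERIV_std_normal_density refl that)+
       (use that in \<open>simp add: field_simps power2_eq_square\<close>)
  have "G \<midarrow>0\<rightarrow> 0"
  proof -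
    have "((\<lambda>x. u x / x) \<longlongrightarrow> u' 0) (at 0)"
      using du[of 0] u0 by (simp add: has_field_derivative_iff)
    moreover have "(u \<longlongrightarrow> 0) (at 0)"
      using DERIV_isCont[OF du[of 0]] u0 by (simp add: isCont_def)
    moreover have "(?\<phi> \<longlongrightarrow> ?\<phi> 0) (at 0)"
      using DERIV_isCont[OF DERIV_std_normal_density[of 0]] by (simp add: isCont_def)
    ultimately have "((\<lambda>x. - (u x) * ?\<phi> x * (u x / x)) \<longlongrightarrow> - 0 * ?\<phi> 0 * u' 0) (at 0)"
      by (intro tendsto_intros)
    then show ?thesis
      by (simp add: G_def[abs_def] power2_eq_square mult_ac)
  qed
  then have G0: "isCont G 0"
    by (simp add: isCont_def G_def)
  have contG: "continuous_on S G" for S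
    by (intro continuous_at_imp_continuous_on ballI) (metis G0 dG DERIV_isCont)
  have ineq: "?h x \<le> ?\<phi> x * ((u x / x - u' x)\<^sup>2 - (u' x)\<^sup>2 + (u x)\<^sup>2)" for x
    by (intro mult_left_mono) auto
  have d: "\<exists>y. ((\<lambda>x. G x - K x) has_real_derivative y) (at x) \<and> 0 \<le> y" if "x \<noteq> 0" "-M < x" "x < M" for x
    using DERIV_diff[OF dG dK, of x] that ineq[of x] by (intro exI conjI) auto
  have step: "G a - K a \<le> G b - K b" if "a \<le> b" "- M \<le> a" "b \<le> M" "a \<ge> 0 \<or> b \<le> 0" for a b
  proof (rule DERIV_nonneg_imp_increasing_open[OF that(1)])
    show "\<exists>y. ((\<lambda>x. G x - K x) has_real_derivative y) (at x) \<and> 0 \<le> y" if "a < x" "x < b" for x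
      by (rule d) (use that \<open>- M \<le> a\<close> \<open>b \<le> M\<close> \<open>a \<ge> 0 \<or> b \<le> 0\<close> in linarith)+
    show "continuous_on {a..b} (\<lambda>x. G x - K x)"
      using that by (intro continuous_on_diff contG continuous_on_subset[OF contK]) simp
  qed
  have "G (-M) - K (-M) \<le> G 0 - K 0"
    using M by (intro step) simp_all
  also have "\<dots> \<le> G M - K M"
    using M by (intro step) simp_all
  finally have "K M \<le> G M - G (-M)"
    by (simp add: K_def)
  also have "\<dots> \<le> 0"
  proof -
    have "G M \<le> 0" "0 \<le> G (- M)"
      using M by (simp_all add: G_def divide_nonpos_pos)
    then show ?thesis by simp
  qed
  finally show ?thesis by (simp add: K_def)
qed

text \<open>
  The limit of the previous inequality over growing symmetric intervals.
\<close>

lemma gauss_hardy: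
  fixes u u' :: "real \<Rightarrow> real"
  assumes du: "\<And>x. (u has_real_derivative u' x) (at x)" and u0: "u 0 = 0"
    and cont: "continuous_on UNIV u'"
    and int: "integrable std_gauss (\<lambda>x. (u x)\<^sup>2)" "integrable std_gauss (\<lambda>x. (u' x)\<^sup>2)"
  shows "(\<integral>x. (u x)\<^sup>2 \<partial>std_gauss) \<le> (\<integral>x. (u' x)\<^sup>2 \<partial>std_gauss)"
proof -
  let ?h = "\<lambda>x. std_normal_density x * ((u x)\<^sup>2 - (u' x)\<^sup>2)"
  have contu: "continuous_on UNIV u"
    using du by (meson DERIV_isCont continuous_at_imp_continuous_on)
  have cont\<phi>: "continuous_on UNIV std_normal_density"
    using DERIV_std_normal_density by (meson DERIV_isCont continuous_at_imp_continuous_on)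
  have [measurable]: "u \<in> borel_measurable borel" "u' \<in> borel_measurable borel"
    using contu cont by (auto intro: borel_measurable_continuous_onI)
  have "integrable std_gauss (\<lambda>x. (u x)\<^sup>2 - (u' x)\<^sup>2)"
    using int by simp
  then have i: "integrable lborel ?h"
    by (subst (asm) integrable_std_gauss_iff) auto
  have lim: "(\<lambda>k. \<integral>x. indicator {- real (Suc k)..real (Suc k)} x *\<^sub>R ?h x \<partial>lborel) \<longlonglongrightarrow> (\<integral>x. ?h x \<partial>lborel)"
  proof (rule integral_dominated_convergence[where w="\<lambda>x. \<bar>?h x\<bar>"])
    show "AE x in lborel. (\<lambda>k. indicator {- real (Suc k)..real (Suc k)} x *\<^sub>R ?h x) \<longlonglongrightarrow> ?h x"
    proof (intro AE_I2)
      fix x :: real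
      obtain m :: nat where "\<bar>x\<bar> \<le> real m" using real_arch_simple by blast
      then have "eventually (\<lambda>k. indicator {- real (Suc k)..real (Suc k)} x *\<^sub>R ?h x = ?h x) sequentially"
        by (intro eventually_sequentiallyI[of m]) (auto simp: indicator_def abs_le_iff)
      then show "(\<lambda>k. indicator {- real (Suc k)..real (Suc k)} x *\<^sub>R ?h x) \<longlonglongrightarrow> ?h x"
        by (rule tendsto_eventually)
    qed
  qed (use i in \<open>auto simp: indicator_def\<close>)
  have le: "(\<integral>x. indicator {- real (Suc k)..real (Suc k)} x *\<^sub>R ?h x \<partial>lborel) \<le> 0" for k
  proof -
    have "set_integrable lborel {- real (Suc k)..real (Suc k)} ?h"
      unfolding set_integrable_def by (rule integrable_mult_indicator[OF _ i]) simp
    then have "(\<integral>x. indicator {- real (Suc k)..real (Suc k)} x *\<^sub>R ?h x \<partial>lborel) = integral {- real (Suc k)..real (Suc k)} ?h"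
      using set_borel_integral_eq_integral(2)[of "{- real (Suc k)..real (Suc k)}" ?h]
      by (simp add: set_lebesgue_integral_def)
    also have "\<dots> \<le> 0"
      by (rule gauss_hardy_interval[OF du u0 cont]) simp
    finally show ?thesis .
  qed
  have "(\<integral>x. ?h x \<partial>lborel) \<le> 0"
    using lim le by (meson LIMSEQ_le_const2)
  then have "(\<integral>x. (u x)\<^sup>2 - (u' x)\<^sup>2 \<partial>std_gauss) \<le> 0"
    by (subst integral_std_gauss) auto
  then show ?thesis
    using int by simp
qed

text \<open>
  The variance is at most the second moment about \<open>f 0\<close>, to which the Hardy inequality applies.
\<close>

lemma gauss_poincare_1d:
  fixes f f' :: "real \<Rightarrow> real"
  assumes df: "\<And>x. (f has_real_derivative f' x) (at x)"
    and cont: "continuous_on UNIV f'"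
    and int: "integrable std_gauss f" "integrable std_gauss (\<lambda>x. (f x)\<^sup>2)"
      "integrable std_gauss (\<lambda>x. (f' x)\<^sup>2)"
  shows "(\<integral>x. (f x)\<^sup>2 \<partial>std_gauss) - (\<integral>x. f x \<partial>std_gauss)\<^sup>2 \<le> (\<integral>x. (f' x)\<^sup>2 \<partial>std_gauss)"
proof -
  interpret prob_space std_gauss by (rule prob_space_std_gauss)
  let ?m = "\<integral>x. f x \<partial>std_gauss"
  have e: "(f x - f 0)\<^sup>2 = (f x)\<^sup>2 - 2 * f 0 * f x + (f 0)\<^sup>2" for x
    by (simp add: power2_eq_square algebra_simps)
  have "(\<integral>x. (f x - f 0)\<^sup>2 \<partial>std_gauss) = (\<integral>x. (f x)\<^sup>2 \<partial>std_gauss) - 2 * f 0 * ?m + (f 0)\<^sup>2"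
    unfolding e using int prob_space by simp
  moreover have "(\<integral>x. (f x - f 0)\<^sup>2 \<partial>std_gauss) \<le> (\<integral>x. (f' x)\<^sup>2 \<partial>std_gauss)"
  proof (rule gauss_hardy)
    show "((\<lambda>x. f x - f 0) has_real_derivative f' x) (at x)" for x
      using DERIV_diff[OF df[of x] DERIV_const[of "f 0"]] by simp
    show "integrable std_gauss (\<lambda>x. (f x - f 0)\<^sup>2)"
      unfolding e using int by simp
  qed (use cont int in auto)
  moreover have "(f 0 - ?m)\<^sup>2 \<ge> 0" by simp
  ultimately show ?thesis
    by (simp add: power2_eq_square algebra_simps)
qed

section \<open>Tensorisation of the variance\<close>

lemma integrable_mult_of_squares:
  fixes f g :: "'a \<Rightarrow> real"
  assumes [measurable]: "f \<in> borel_measurable M" "g \<in> borel_measurable M"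
    and int: "integrable M (\<lambda>x. (f x)\<^sup>2)" "integrable M (\<lambda>x. (g x)\<^sup>2)"
  shows "integrable M (\<lambda>x. f x * g x)"
proof (rule Bochner_Integration.integrable_bound[OF Bochner_Integration.integrable_add[OF int]])
  have "\<bar>a * b\<bar> \<le> a\<^sup>2 + b\<^sup>2" for a b :: real
  proof -
    have "0 \<le> (\<bar>a\<bar> - \<bar>b\<bar>)\<^sup>2" by simp
    then have "2 * (\<bar>a\<bar> * \<bar>b\<bar>) \<le> a\<^sup>2 + b\<^sup>2"
      by (simp add: power2_eq_square algebra_simps)
    moreover have "0 \<le> \<bar>a\<bar> * \<bar>b\<bar>" by simp
    ultimately show ?thesis unfolding abs_mult by linarith
  qed
  then show "AE x in M. norm (f x * g x) \<le> norm ((f x)\<^sup>2 + (g x)\<^sup>2)"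
    by (auto simp: abs_of_nonneg)
qed simp

context pair_prob_space
begin

lemma integrable_comp_fst:
  fixes a :: "'a \<Rightarrow> real"
  assumes "integrable M1 a"
  shows "integrable (M1 \<Otimes>\<^sub>M M2) (\<lambda>p. a (fst p))"
proof -
  have "distr (M1 \<Otimes>\<^sub>M M2) M1 fst = M1"
    by (rule M2.distr_pair_fst)
  then show ?thesis
    using assms integrable_distr_eq[of fst "M1 \<Otimes>\<^sub>M M2" M1 a] by simp
qed

lemma integrable_comp_snd:
  fixes b :: "'b \<Rightarrow> real"
  assumes "integrable M2 b"
  shows "integrable (M1 \<Otimes>\<^sub>M M2) (\<lambda>p. b (snd p))"
proof -
  interpret Q: pair_prob_space M2 M1 ..
  show ?thesis
    using Q.integrable_product_swap[OF Q.integrable_comp_fst[OF assms]] by (simp add: split_beta')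
qed

text \<open>
  For \<open>h\<close> on a product space with partial means \<open>F\<close>, \<open>G\<close> and mean \<open>m\<close>, the mean of
  \<open>(h - F - G + m)\<^sup>2\<close> equals \<open>\<integral>h\<^sup>2 - \<integral>F\<^sup>2 - \<integral>G\<^sup>2 + m\<^sup>2\<close>; its nonnegativity says that the variance is at
  most the sum of the two mean partial variances. The additive bound on \<open>h\<close> makes every section
  square integrable, so that no exceptional null sets enter the induction over coordinates.
\<close>

lemma efron_stein:
  fixes h :: "'a \<times> 'b \<Rightarrow> real"
  assumes h[measurable]: "h \<in> borel_measurable (M1 \<Otimes>\<^sub>M M2)"
    and a[measurable]: "a \<in> borel_measurable M1" and b[measurable]: "b \<in> borel_measurable M2"
    and a2: "integrable M1 (\<lambda>x. (a x)\<^sup>2)" and b2: "integrable M2 (\<lambda>y. (b y)\<^sup>2)"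
    and bound: "\<And>x y. x \<in> space M1 \<Longrightarrow> y \<in> space M2 \<Longrightarrow> \<bar>h (x, y)\<bar> \<le> a x + b y"
  defines "F \<equiv> \<lambda>x. \<integral>y. h (x, y) \<partial>M2" and "G \<equiv> \<lambda>y. \<integral>x. h (x, y) \<partial>M1"
  shows "integrable (M1 \<Otimes>\<^sub>M M2) (\<lambda>p. (h p)\<^sup>2)" "integrable (M1 \<Otimes>\<^sub>M M2) h"
    and "\<And>x. x \<in> space M1 \<Longrightarrow> integrable M2 (\<lambda>y. (h (x, y))\<^sup>2)"
    and "\<And>x. x \<in> space M1 \<Longrightarrow> integrable M2 (\<lambda>y. h (x, y))"
    and "\<And>y. y \<in> space M2 \<Longrightarrow> integrable M1 (\<lambda>x. (h (x, y))\<^sup>2)"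
    and "\<And>y. y \<in> space M2 \<Longrightarrow> integrable M1 (\<lambda>x. h (x, y))"
    and "integrable M1 (\<lambda>x. (\<integral>y. (h (x, y))\<^sup>2 \<partial>M2) - (F x)\<^sup>2)" 
    and "integrable M2 (\<lambda>y. (\<integral>x. (h (x, y))\<^sup>2 \<partial>M1) - (G y)\<^sup>2)"
    and "(\<integral>p. (h p)\<^sup>2 \<partial>(M1 \<Otimes>\<^sub>M M2)) - (\<integral>p. h p \<partial>(M1 \<Otimes>\<^sub>M M2))\<^sup>2
      \<le> (\<integral>x. (\<integral>y. (h (x, y))\<^sup>2 \<partial>M2) - (F x)\<^sup>2 \<partial>M1) + (\<integral>y. (\<integral>x. (h (x, y))\<^sup>2 \<partial>M1) - (G y)\<^sup>2 \<partial>M2)"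
proof -
  let ?P = "M1 \<Otimes>\<^sub>M M2"
  have F[measurable]: "F \<in> borel_measurable M1" and G[measurable]: "G \<in> borel_measurable M2"
    unfolding F_def G_def by measurable
  have sq: "(u + v)\<^sup>2 \<le> 2 * u\<^sup>2 + 2 * v\<^sup>2" for u v :: real
    using zero_le_power2[of "u - v"] by (simp add: power2_eq_square algebra_simps)
  have bound2: "(h (x, y))\<^sup>2 \<le> 2 * (a x)\<^sup>2 + 2 * (b y)\<^sup>2" if "x \<in> space M1" "y \<in> space M2" for x y
    using power_mono[OF bound[OF that], of 2] sq[of "a x" "b y"] by simp
  show h2: "integrable ?P (\<lambda>p. (h p)\<^sup>2)"
  proof (rule Bochner_Integration.integrable_bound)
    show "integrable ?P (\<lambda>p. 2 * (a (fst p))\<^sup>2 + 2 * (b (snd p))\<^sup>2)"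
      using integrable_comp_fst[OF a2] integrable_comp_snd[OF b2] by simp
    show "AE p in ?P. norm ((h p)\<^sup>2) \<le> norm (2 * (a (fst p))\<^sup>2 + 2 * (b (snd p))\<^sup>2)"
      using bound2 by (intro AE_I2) (auto simp: space_pair_measure)
  qed simp
  show h1: "integrable ?P h"
    by (rule square_integrable_imp_integrable[OF h h2])
  show s2: "integrable M2 (\<lambda>y. (h (x, y))\<^sup>2)" if x: "x \<in> space M1" for x
  proof (rule Bochner_Integration.integrable_bound)
    show "integrable M2 (\<lambda>y. 2 * (a x)\<^sup>2 + 2 * (b y)\<^sup>2)"
      using b2 by simp
    show "AE y in M2. norm ((h (x, y))\<^sup>2) \<le> norm (2 * (a x)\<^sup>2 + 2 * (b y)\<^sup>2)"
      using bound2[OF x] by (intro AE_I2) auto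
  qed (use x in measurable)
  show s2': "integrable M2 (\<lambda>y. h (x, y))" if x: "x \<in> space M1" for x
    by (rule M2.square_integrable_imp_integrable[OF _ s2[OF x]]) (use x in measurable)
  show s1: "integrable M1 (\<lambda>x. (h (x, y))\<^sup>2)" if y: "y \<in> space M2" for y
  proof (rule Bochner_Integration.integrable_bound)
    show "integrable M1 (\<lambda>x. 2 * (a x)\<^sup>2 + 2 * (b y)\<^sup>2)"
      using a2 by simp
    show "AE x in M1. norm ((h (x, y))\<^sup>2) \<le> norm (2 * (a x)\<^sup>2 + 2 * (b y)\<^sup>2)"
      using bound2[OF _ y] by (intro AE_I2) auto
  qed (use y in measurable)
  show s1': "integrable M1 (\<lambda>x. h (x, y))" if y: "y \<in> space M2" for y
    by (rule M1.square_integrable_imp_integrable[OF _ s1[OF y]]) (use y in measurable)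
  have b1: "integrable M2 b" and a1: "integrable M1 a"
    using M2.square_integrable_imp_integrable[OF b b2] M1.square_integrable_imp_integrable[OF a a2] .
  have F2: "integrable M1 (\<lambda>x. (F x)\<^sup>2)"
  proof (rule Bochner_Integration.integrable_bound)
    show "integrable M1 (\<lambda>x. 2 * (a x)\<^sup>2 + 2 * (\<integral>y. b y \<partial>M2)\<^sup>2)"
      using a2 by simp
    have "(F x)\<^sup>2 \<le> 2 * (a x)\<^sup>2 + 2 * (\<integral>y. b y \<partial>M2)\<^sup>2" if x: "x \<in> space M1" for x
    proof -
      have "\<bar>F x\<bar> \<le> (\<integral>y. \<bar>h (x, y)\<bar> \<partial>M2)"
        unfolding F_def by (rule integral_abs_bound)
      also have "\<dots> \<le> (\<integral>y. a x + b y \<partial>M2)"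
        using s2'[OF x] b1 bound[OF x] by (intro integral_mono) auto
      also have "\<dots> = a x + (\<integral>y. b y \<partial>M2)"
        using b1 by (simp add: M2.prob_space)
      finally have "\<bar>F x\<bar>\<^sup>2 \<le> (a x + (\<integral>y. b y \<partial>M2))\<^sup>2"
        by (rule power_mono) simp
      then show ?thesis using sq[of "a x" "\<integral>y. b y \<partial>M2"] by simp
    qed
    then show "AE x in M1. norm ((F x)\<^sup>2) \<le> norm (2 * (a x)\<^sup>2 + 2 * (\<integral>y. b y \<partial>M2)\<^sup>2)"
      by (intro AE_I2) auto
  qed simp
  have G2: "integrable M2 (\<lambda>x. (G x)\<^sup>2)"
  proof (rule Bochner_Integration.integrable_bound)
    show "integrable M2 (\<lambda>y. 2 * (\<integral>x. a x \<partial>M1)\<^sup>2 + 2 * (b y)\<^sup>2)"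
      using b2 by simp
    have "(G y)\<^sup>2 \<le> 2 * (\<integral>x. a x \<partial>M1)\<^sup>2 + 2 * (b y)\<^sup>2" if y: "y \<in> space M2" for y
    proof -
      have "\<bar>G y\<bar> \<le> (\<integral>x. \<bar>h (x, y)\<bar> \<partial>M1)"
        unfolding G_def by (rule integral_abs_bound)
      also have "\<dots> \<le> (\<integral>x. a x + b y \<partial>M1)"
        using s1'[OF y] a1 bound[OF _ y] by (intro integral_mono) auto
      also have "\<dots> = (\<integral>x. a x \<partial>M1) + b y"
        using a1 by (simp add: M1.prob_space)
      finally have "\<bar>G y\<bar>\<^sup>2 \<le> ((\<integral>x. a x \<partial>M1) + b y)\<^sup>2"
        by (rule power_mono) simp
      then show ?thesis using sq[of "\<integral>x. a x \<partial>M1" "b y"] by simp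
    qed
    then show "AE y in M2. norm ((G y)\<^sup>2) \<le> norm (2 * (\<integral>x. a x \<partial>M1)\<^sup>2 + 2 * (b y)\<^sup>2)"
      by (intro AE_I2) auto
  qed simp
  have ih1: "integrable M1 (\<lambda>x. \<integral>y. (h (x, y))\<^sup>2 \<partial>M2)"
    using integrable_fst'[OF h2] .
  have ih2: "integrable M2 (\<lambda>y. \<integral>x. (h (x, y))\<^sup>2 \<partial>M1)"
    using integrable_snd[of "\<lambda>x y. (h (x, y))\<^sup>2"] h2 by (simp add: split_beta')
  show "integrable M1 (\<lambda>x. (\<integral>y. (h (x, y))\<^sup>2 \<partial>M2) - (F x)\<^sup>2)" 
    and "integrable M2 (\<lambda>y. (\<integral>x. (h (x, y))\<^sup>2 \<partial>M1) - (G y)\<^sup>2)"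
    using ih1 F2 ih2 G2 by simp_all
  have e1: "(\<integral>x. (\<integral>y. (h (x, y))\<^sup>2 \<partial>M2) - (F x)\<^sup>2 \<partial>M1) = (\<integral>p. (h p)\<^sup>2 \<partial>?P) - (\<integral>x. (F x)\<^sup>2 \<partial>M1)"
    using ih1 F2 integral_fst'[OF h2] by simp
  have e2: "(\<integral>y. (\<integral>x. (h (x, y))\<^sup>2 \<partial>M1) - (G y)\<^sup>2 \<partial>M2) = (\<integral>p. (h p)\<^sup>2 \<partial>?P) - (\<integral>y. (G y)\<^sup>2 \<partial>M2)"
    using ih2 G2 integral_snd[of "\<lambda>x y. (h (x, y))\<^sup>2"] h2 by (simp add: split_beta')
  let ?m = "\<integral>p. h p \<partial>?P"
  have F1: "integrable M1 F" and G1: "integrable M2 G"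
    using M1.square_integrable_imp_integrable[OF F F2] M2.square_integrable_imp_integrable[OF G G2] .
  note [simp] = integrable_comp_fst[OF F2] integrable_comp_snd[OF G2] integrable_comp_fst[OF F1]
    integrable_comp_snd[OF G1] h1 h2
  have [simp]: "integrable ?P (\<lambda>p. h p * F (fst p))" "integrable ?P (\<lambda>p. h p * G (snd p))"
    "integrable ?P (\<lambda>p. F (fst p) * G (snd p))"
    by (auto intro!: integrable_mult_of_squares)
  have hF: "(\<integral>y. h (x, y) \<partial>M2) = F x" for x
    by (simp add: F_def)
  have hG: "(\<integral>x. h (x, y) \<partial>M1) = G y" for y
    by (simp add: G_def)
  have iF: "(\<integral>x. F x \<partial>M1) = ?m"
    unfolding F_def using integral_fst'[OF h1] .
  have iG: "(\<integral>y. G y \<partial>M2) = ?m"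
    unfolding G_def using integral_snd[of "\<lambda>x y. h (x, y)"] h1 by (simp add: split_beta')
  have i1: "(\<integral>p. F (fst p) \<partial>?P) = ?m"
    by (subst integral_fst'[symmetric]) (simp_all add: iF M2.prob_space)
  have i2: "(\<integral>p. G (snd p) \<partial>?P) = ?m"
    by (subst integral_fst'[symmetric]) (simp_all add: iG M1.prob_space)
  have i3: "(\<integral>p. (F (fst p))\<^sup>2 \<partial>?P) = (\<integral>x. (F x)\<^sup>2 \<partial>M1)"
    by (subst integral_fst'[symmetric]) (simp_all add: M2.prob_space)
  have i4: "(\<integral>p. (G (snd p))\<^sup>2 \<partial>?P) = (\<integral>y. (G y)\<^sup>2 \<partial>M2)"
    by (subst integral_fst'[symmetric]) (simp_all add: M1.prob_space)
  have i5: "(\<integral>p. h p * F (fst p) \<partial>?P) = (\<integral>x. (F x)\<^sup>2 \<partial>M1)"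
    by (subst integral_fst'[symmetric]) (simp_all add: hF power2_eq_square)
  have i6: "(\<integral>p. h p * G (snd p) \<partial>?P) = (\<integral>y. (G y)\<^sup>2 \<partial>M2)"
  proof -
    have "(\<integral>p. h p * G (snd p) \<partial>?P) = (\<integral>y. (\<integral>x. h (x, y) * G y \<partial>M1) \<partial>M2)"
      using integral_snd[of "\<lambda>x y. h (x, y) * G y"] by (simp add: split_beta')
    also have "\<dots> = (\<integral>y. (G y)\<^sup>2 \<partial>M2)"
      by (simp add: hG power2_eq_square)
    finally show ?thesis .
  qed
  have i7: "(\<integral>p. F (fst p) * G (snd p) \<partial>?P) = ?m\<^sup>2"
    by (subst integral_fst'[symmetric]) (simp_all add: iF iG power2_eq_square)
  have e: "(h p - F (fst p) - G (snd p) + ?m)\<^sup>2 = (h p)\<^sup>2 + (F (fst p))\<^sup>2 + (G (snd p))\<^sup>2 + ?m\<^sup>2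
     - 2 * (h p * F (fst p)) - 2 * (h p * G (snd p)) + 2 * ?m * h p + 2 * (F (fst p) * G (snd p))
     - 2 * ?m * F (fst p) - 2 * ?m * G (snd p)" for p
    by (simp add: power2_eq_square algebra_simps)
  have "0 \<le> (\<integral>p. (h p - F (fst p) - G (snd p) + ?m)\<^sup>2 \<partial>?P)"
    by simp
  also have "\<dots> = (\<integral>p. (h p)\<^sup>2 \<partial>?P) - (\<integral>x. (F x)\<^sup>2 \<partial>M1) - (\<integral>y. (G y)\<^sup>2 \<partial>M2) + ?m\<^sup>2"
    unfolding e by (simp add: i1 i2 i3 i4 i5 i6 i7 prob_space) (simp add: power2_eq_square)
  finally show "(\<integral>p. (h p)\<^sup>2 \<partial>?P) - ?m\<^sup>2
      \<le> (\<integral>x. (\<integral>y. (h (x, y))\<^sup>2 \<partial>M2) - (F x)\<^sup>2 \<partial>M1) + (\<integral>y. (\<integral>x. (h (x, y))\<^sup>2 \<partial>M1) - (G y)\<^sup>2 \<partial>M2)"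
    unfolding e1 e2 by simp
qed

end

section \<open>Standard Gaussian vectors\<close>

abbreviation gauss_vec :: "nat set \<Rightarrow> (nat \<Rightarrow> real) measure" where
  "gauss_vec I \<equiv> Pi\<^sub>M I (\<lambda>_. std_gauss)"

interpretation gv: product_sigma_finite "\<lambda>_::nat. std_gauss"
  by (rule product_sigma_finite.intro) (rule prob_space_imp_sigma_finite[OF prob_space_std_gauss])

lemma gauss_eq_gauss_vec: "gauss n (\<lambda>_. 0) 1 = gauss_vec {1..n}"
  by (simp add: gauss_def std_gauss_def)

lemma space_gauss_vec: "space (gauss_vec I) = I \<rightarrow>\<^sub>E UNIV"
  by (simp add: space_PiM)

lemma prob_space_gauss_vec: "prob_space (gauss_vec I)"
  by (rule prob_space_PiM) (rule prob_space_std_gauss)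

lemma has_integral_gauss_vec_component:
  fixes f :: "real \<Rightarrow> real"
  assumes i: "i \<in> I" and f: "integrable std_gauss f"
  shows "integrable (gauss_vec I) (\<lambda>x. f (x i))"
    and "(\<integral>x. f (x i) \<partial>gauss_vec I) = integral\<^sup>L std_gauss f"
proof -
  have d: "distr (gauss_vec I) std_gauss (\<lambda>x. x i) = std_gauss"
    by (rule distr_PiM_component) (use i prob_space_std_gauss in auto)
  have m: "(\<lambda>x. x i) \<in> measurable (gauss_vec I) std_gauss"
    using i by simp
  have fm: "f \<in> borel_measurable std_gauss"
    using f by auto
  show "integrable (gauss_vec I) (\<lambda>x. f (x i))"
    using integrable_distr_eq[OF m fm] d f by simp
  show "(\<integral>x. f (x i) \<partial>gauss_vec I) = integral\<^sup>L std_gauss f"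
    using integral_distr[OF m fm] d by simp
qed

lemma integrable_gauss_vec_square: "i \<in> I \<Longrightarrow> integrable (gauss_vec I) (\<lambda>x. (x i)\<^sup>2)"
  by (rule has_integral_gauss_vec_component(1)) simp_all

lemma integral_gauss_vec_square: "i \<in> I \<Longrightarrow> (\<integral>x. (x i)\<^sup>2 \<partial>gauss_vec I) = 1"
  using has_integral_gauss_vec_component(2)[of i I "\<lambda>x. x\<^sup>2"] by simp

text \<open>
  The source of all integrability facts below: every function that occurs grows at most quadratically.
\<close>

lemma integrable_gauss_vec_quadratic:
  fixes f :: "(nat \<Rightarrow> real) \<Rightarrow> real"
  assumes "f \<in> borel_measurable (gauss_vec I)"
    and "\<And>x. x \<in> space (gauss_vec I) \<Longrightarrow> \<bar>f x\<bar> \<le> A + B * (\<Sum>i\<in>I. (x i)\<^sup>2)"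
  shows "integrable (gauss_vec I) f"
proof (rule Bochner_Integration.integrable_bound)
  interpret prob_space "gauss_vec I" by (rule prob_space_gauss_vec)
  show "integrable (gauss_vec I) (\<lambda>x. A + B * (\<Sum>i\<in>I. (x i)\<^sup>2))"
    by (intro Bochner_Integration.integrable_add integrable_mult_right Bochner_Integration.integrable_sum
        integrable_gauss_vec_square) auto
  show "AE x in gauss_vec I. norm (f x) \<le> norm (A + B * (\<Sum>i\<in>I. (x i)\<^sup>2))"
    using assms(2) by (intro AE_I2) fastforce
qed fact

lemma distr_gauss_vec_insert:
  "distr (std_gauss \<Otimes>\<^sub>M gauss_vec I) (gauss_vec (insert i I)) (\<lambda>(t, x). x(i := t)) = gauss_vec (insert i I)"
  by (rule distr_pair_PiM_eq_PiM) (rule prob_space_std_gauss)+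

lemma square_sum_le:
  fixes f :: "'a \<Rightarrow> real"
  shows "(\<Sum>i\<in>I. f i)\<^sup>2 \<le> real (card I) * (\<Sum>i\<in>I. (f i)\<^sup>2)"
  using Cauchy_Schwarz_ineq_sum[of "\<lambda>_. 1" f I] by simp

lemma square_add_le: "(u + v)\<^sup>2 \<le> 2 * u\<^sup>2 + 2 * v\<^sup>2" for u v :: real
  using zero_le_power2[of "u - v"] by (simp add: power2_eq_square algebra_simps)

text \<open>
  Induction over the coordinates: the partial variance in the new coordinate is bounded by the
  inequality on the line, the other one by the induction hypothesis for the sections of \<open>f\<close>. The
  hypotheses (linear growth, bounded and continuous partial derivatives) pass to sections as they are,
  which is why both partial variances are taken of sections and not of partial means.
\<close>

theorem gauss_poincare:
  fixes f :: "(nat \<Rightarrow> real) \<Rightarrow> real" and g :: "nat \<Rightarrow> (nat \<Rightarrow> real) \<Rightarrow> real"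
  assumes "finite I"
    and "f \<in> borel_measurable (gauss_vec I)"
    and "\<And>j. j \<in> I \<Longrightarrow> g j \<in> borel_measurable (gauss_vec I)"
    and "B \<ge> 0" and "\<And>x. x \<in> space (gauss_vec I) \<Longrightarrow> \<bar>f x\<bar> \<le> A + B * (\<Sum>j\<in>I. \<bar>x j\<bar>)"
    and "\<And>j x. j \<in> I \<Longrightarrow> x \<in> space (gauss_vec I) \<Longrightarrow> \<bar>g j x\<bar> \<le> K"
    and "\<And>j x t. j \<in> I \<Longrightarrow> x \<in> space (gauss_vec I) \<Longrightarrow>
      ((\<lambda>t. f (x(j := t))) has_real_derivative g j (x(j := t))) (at t)"
    and "\<And>j x. j \<in> I \<Longrightarrow> x \<in> space (gauss_vec I) \<Longrightarrow> continuous_on UNIV (\<lambda>t. g j (x(j := t)))"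
  shows "(\<integral>x. (f x)\<^sup>2 \<partial>gauss_vec I) - (\<integral>x. f x \<partial>gauss_vec I)\<^sup>2
    \<le> (\<Sum>j\<in>I. \<integral>x. (g j x)\<^sup>2 \<partial>gauss_vec I)"
  using assms
proof (induction I arbitrary: f g A rule: finite_induct)
  case empty
  interpret prob_space "gauss_vec {}" by (rule prob_space_gauss_vec)
  have "(\<integral>x. (f x)\<^sup>2 \<partial>gauss_vec {}) = (\<integral>x. (f (\<lambda>_. undefined))\<^sup>2 \<partial>gauss_vec {})"
    by (rule Bochner_Integration.integral_cong) (auto simp: space_gauss_vec)
  moreover have "(\<integral>x. f x \<partial>gauss_vec {}) = (\<integral>x. f (\<lambda>_. undefined) \<partial>gauss_vec {})"
    by (rule Bochner_Integration.integral_cong) (auto simp: space_gauss_vec)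
  ultimately show ?case
    using prob_space by simp
next
  case (insert i I)
  let ?G = "gauss_vec I" and ?G' = "gauss_vec (insert i I)" and ?P = "std_gauss \<Otimes>\<^sub>M gauss_vec I"
  interpret V: prob_space "gauss_vec I" by (rule prob_space_gauss_vec)
  interpret V': prob_space "gauss_vec (insert i I)" by (rule prob_space_gauss_vec)
  interpret S: prob_space std_gauss by (rule prob_space_std_gauss)
  interpret P: pair_prob_space std_gauss "gauss_vec I" ..
  have f[measurable]: "f \<in> borel_measurable ?G'" by fact
  have g[measurable]: "g j \<in> borel_measurable ?G'" if "j \<in> insert i I" for j
    using insert.prems(2) that by blast
  have upd[measurable]: "(\<lambda>p. (snd p)(i := fst p)) \<in> measurable ?P ?G'"
    by (rule measurable_fun_upd[of _ I]) auto
  have updt[measurable]: "(\<lambda>x. x(i := t)) \<in> measurable ?G ?G'" for t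
    by (rule measurable_fun_upd[of _ I]) auto
  have updI: "x(i := t) \<in> space ?G'" if "x \<in> space ?G" for x t
    using that by (auto simp: space_gauss_vec PiE_iff extensional_def)
  have D: "distr ?P ?G' (\<lambda>p. (snd p)(i := fst p)) = ?G'"
    using distr_gauss_vec_insert[of I i] by (simp add: split_beta')
  have tr: "(\<integral>x. q x \<partial>?G') = (\<integral>p. q ((snd p)(i := fst p)) \<partial>?P)"
    if "q \<in> borel_measurable ?G'" for q :: "(nat \<Rightarrow> real) \<Rightarrow> real"
    using integral_distr[OF upd that] D by simp
  define h where "h = (\<lambda>p :: real \<times> (nat \<Rightarrow> real). f ((snd p)(i := fst p)))"
  have h[measurable]: "h \<in> borel_measurable ?P"
    unfolding h_def by measurable
  have m2[measurable]: "(\<lambda>x. A + B * (\<Sum>j\<in>I. \<bar>x j\<bar>)) \<in> borel_measurable ?G"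
    by measurable
  have i2: "integrable ?G (\<lambda>x. (A + B * (\<Sum>j\<in>I. \<bar>x j\<bar>))\<^sup>2)"
  proof (rule integrable_gauss_vec_quadratic)
    fix x
    have "(A + B * (\<Sum>j\<in>I. \<bar>x j\<bar>))\<^sup>2 \<le> 2 * A\<^sup>2 + 2 * (B\<^sup>2 * (\<Sum>j\<in>I. \<bar>x j\<bar>)\<^sup>2)"
      using square_add_le[of A "B * (\<Sum>j\<in>I. \<bar>x j\<bar>)"] by (simp add: power_mult_distrib)
    also have "\<dots> \<le> 2 * A\<^sup>2 + 2 * (B\<^sup>2 * (real (card I) * (\<Sum>j\<in>I. \<bar>x j\<bar>\<^sup>2)))"
      by (intro add_left_mono mult_left_mono square_sum_le) auto
    finally show "\<bar>(A + B * (\<Sum>j\<in>I. \<bar>x j\<bar>))\<^sup>2\<bar> \<le> 2 * A\<^sup>2 + (2 * B\<^sup>2 * real (card I)) * (\<Sum>j\<in>I. (x j)\<^sup>2)"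
      by (simp add: mult_ac)
  qed simp
  have m1: "(\<lambda>t. B * \<bar>t\<bar>) \<in> borel_measurable std_gauss"
    by simp
  have i1: "integrable std_gauss (\<lambda>t. (B * \<bar>t\<bar>)\<^sup>2)"
    by (simp add: power_mult_distrib)
  have bd: "\<bar>h (t, x)\<bar> \<le> B * \<bar>t\<bar> + (A + B * (\<Sum>j\<in>I. \<bar>x j\<bar>))" if "t \<in> space std_gauss" "x \<in> space ?G" for t x
  proof -
    have "(\<Sum>j\<in>I. \<bar>(x(i := t)) j\<bar>) = (\<Sum>j\<in>I. \<bar>x j\<bar>)"
      using insert.hyps by (intro sum.cong) auto
    then have s: "(\<Sum>j\<in>insert i I. \<bar>(x(i := t)) j\<bar>) = \<bar>t\<bar> + (\<Sum>j\<in>I. \<bar>x j\<bar>)"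
      using insert.hyps by simp
    then show ?thesis
      using insert.prems(4)[OF updI[OF that(2)], of t] unfolding s h_def fst_conv snd_conv distrib_left by linarith
  qed
  note ES0 = P.efron_stein[OF h m1 m2 i1 i2]
  have ES5: "integrable std_gauss (\<lambda>t. (h (t, x))\<^sup>2)" if "x \<in> space ?G" for x
    by (rule ES0(5)) (rule bd that; assumption)+
  have ES6: "integrable std_gauss (\<lambda>t. h (t, x))" if "x \<in> space ?G" for x
    by (rule ES0(6)) (rule bd that; assumption)+
  have ES7: "integrable std_gauss (\<lambda>t. (\<integral>x. (h (t, x))\<^sup>2 \<partial>?G) - (\<integral>x. h (t, x) \<partial>?G)\<^sup>2)"
    by (rule ES0(7)) (rule bd; assumption)
  have ES8: "integrable ?G (\<lambda>x. (\<integral>t. (h (t, x))\<^sup>2 \<partial>std_gauss) - (\<integral>t. h (t, x) \<partial>std_gauss)\<^sup>2)"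
    by (rule ES0(8)) (rule bd; assumption)
  have ES9: "(\<integral>p. (h p)\<^sup>2 \<partial>?P) - (\<integral>p. h p \<partial>?P)\<^sup>2
      \<le> (\<integral>t. (\<integral>x. (h (t, x))\<^sup>2 \<partial>?G) - (\<integral>x. h (t, x) \<partial>?G)\<^sup>2 \<partial>std_gauss)
        + (\<integral>x. (\<integral>t. (h (t, x))\<^sup>2 \<partial>std_gauss) - (\<integral>t. h (t, x) \<partial>std_gauss)\<^sup>2 \<partial>?G)"
    by (rule ES0(9)) (rule bd; assumption)
  have spI: "t \<in> space std_gauss" for t by simp
  have K2: "\<bar>(g j y)\<^sup>2\<bar> \<le> K\<^sup>2" if "j \<in> insert i I" "y \<in> space ?G'" for j y
    using power_mono[OF insert.prems(5)[OF that], of 2] by simp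
  have gint: "integrable ?P (\<lambda>p. (g j ((snd p)(i := fst p)))\<^sup>2)" if j: "j \<in> insert i I" for j
  proof (rule P.integrable_const_bound[where B="K\<^sup>2"])
    show "AE p in ?P. norm ((g j ((snd p)(i := fst p)))\<^sup>2) \<le> K\<^sup>2"
      by (intro AE_I2) (simp only: real_norm_def, rule K2[OF j updI], simp add: space_pair_measure mem_Times_iff)
  qed (use j in measurable)
  have gslice: "integrable ?G (\<lambda>x. (g j (x(i := t)))\<^sup>2)" if j: "j \<in> insert i I" for j t
  proof (rule V.integrable_const_bound[where B="K\<^sup>2"])
    show "AE x in ?G. norm ((g j (x(i := t)))\<^sup>2) \<le> K\<^sup>2"
      by (intro AE_I2) (simp only: real_norm_def, rule K2[OF j updI])
  qed (use j in measurable)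
  have A: "(\<integral>x. (\<integral>t. (h (t, x))\<^sup>2 \<partial>std_gauss) - (\<integral>t. h (t, x) \<partial>std_gauss)\<^sup>2 \<partial>?G)
    \<le> (\<integral>x. (g i x)\<^sup>2 \<partial>?G')"
  proof -
    have "(\<integral>x. (\<integral>t. (h (t, x))\<^sup>2 \<partial>std_gauss) - (\<integral>t. h (t, x) \<partial>std_gauss)\<^sup>2 \<partial>?G)
      \<le> (\<integral>x. (\<integral>t. (g i (x(i := t)))\<^sup>2 \<partial>std_gauss) \<partial>?G)"
    proof (rule integral_mono[OF ES8])
      show "integrable ?G (\<lambda>x. \<integral>t. (g i (x(i := t)))\<^sup>2 \<partial>std_gauss)"
        using P.integrable_snd[of "\<lambda>t x. (g i (x(i := t)))\<^sup>2"] gint[of i] by (simp add: split_beta')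
    next
      fix x assume x: "x \<in> space ?G"
      have gi: "integrable std_gauss (\<lambda>t. (g i (x(i := t)))\<^sup>2)"
      proof (rule S.integrable_const_bound[where B="K\<^sup>2"])
        show "AE t in std_gauss. norm ((g i (x(i := t)))\<^sup>2) \<le> K\<^sup>2"
          by (intro AE_I2) (simp only: real_norm_def, rule K2[OF _ updI[OF x]], simp)
        have "(\<lambda>t. x(i := t)) \<in> measurable std_gauss ?G'"
          using x insert.hyps by (intro measurable_component_update) auto
        then show "(\<lambda>t. (g i (x(i := t)))\<^sup>2) \<in> borel_measurable std_gauss"
          using g[of i] by (intro borel_measurable_power measurable_compose[of "\<lambda>t. x(i := t)" _ _ "g i"]) auto
      qed
      have e: "(x(i := undefined))(i := t) = x(i := t)" for t by simp
      show "(\<integral>t. (h (t, x))\<^sup>2 \<partial>std_gauss) - (\<integral>t. h (t, x) \<partial>std_gauss)\<^sup>2 \<le> (\<integral>t. (g i (x(i := t)))\<^sup>2 \<partial>std_gauss)"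
      proof (rule gauss_poincare_1d)
        show "((\<lambda>t. h (t, x)) has_real_derivative g i (x(i := t))) (at t)" for t
          using insert.prems(6)[OF insertI1 updI[OF x], of t t] by (simp only: h_def fst_conv snd_conv fun_upd_upd)
        show "continuous_on UNIV (\<lambda>t. g i (x(i := t)))"
          using insert.prems(7)[OF insertI1 updI[OF x]] by (simp only: fun_upd_upd)
      qed (rule ES6[OF x] ES5[OF x] gi)+
    qed
    also have "\<dots> = (\<integral>p. (g i ((snd p)(i := fst p)))\<^sup>2 \<partial>?P)"
      using P.integral_snd[of "\<lambda>t x. (g i (x(i := t)))\<^sup>2"] gint[of i] by (simp add: split_beta')
    also have "\<dots> = (\<integral>x. (g i x)\<^sup>2 \<partial>?G')"
      by (rule tr[symmetric]) simp
    finally show ?thesis .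
  qed
  have B: "(\<integral>t. (\<integral>x. (h (t, x))\<^sup>2 \<partial>?G) - (\<integral>x. h (t, x) \<partial>?G)\<^sup>2 \<partial>std_gauss)
    \<le> (\<Sum>j\<in>I. \<integral>x. (g j x)\<^sup>2 \<partial>?G')"
  proof -
    have gi: "integrable std_gauss (\<lambda>t. \<integral>x. (g j (x(i := t)))\<^sup>2 \<partial>?G)" if "j \<in> I" for j
      using P.integrable_fst'[OF gint[of j]] that by simp
    have "(\<integral>t. (\<integral>x. (h (t, x))\<^sup>2 \<partial>?G) - (\<integral>x. h (t, x) \<partial>?G)\<^sup>2 \<partial>std_gauss)
      \<le> (\<integral>t. (\<Sum>j\<in>I. \<integral>x. (g j (x(i := t)))\<^sup>2 \<partial>?G) \<partial>std_gauss)"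
    proof (rule integral_mono[OF ES7])
      show "integrable std_gauss (\<lambda>t. \<Sum>j\<in>I. \<integral>x. (g j (x(i := t)))\<^sup>2 \<partial>?G)"
        using gi by (rule Bochner_Integration.integrable_sum)
    next
      fix t :: real
      have tw: "x(j := s, i := t) = x(i := t, j := s)" if "j \<in> I" for x :: "nat \<Rightarrow> real" and j s
        using that insert.hyps by (intro fun_upd_twist) auto
      show "(\<integral>x. (h (t, x))\<^sup>2 \<partial>?G) - (\<integral>x. h (t, x) \<partial>?G)\<^sup>2 \<le> (\<Sum>j\<in>I. \<integral>x. (g j (x(i := t)))\<^sup>2 \<partial>?G)"
        unfolding h_def fst_conv snd_conv
      proof (rule insert.IH[where A="A + B * \<bar>t\<bar>"])
        show "(\<lambda>x. f (x(i := t))) \<in> borel_measurable ?G" by measurable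
        show "(\<lambda>x. g j (x(i := t))) \<in> borel_measurable ?G" if "j \<in> I" for j
          using measurable_compose[OF updt g[OF insertI2[OF that]]] .
        show "\<bar>f (x(i := t))\<bar> \<le> A + B * \<bar>t\<bar> + B * (\<Sum>j\<in>I. \<bar>x j\<bar>)" if "x \<in> space ?G" for x
          using bd[OF spI that, of t]
          by (simp add: h_def)
        show "\<bar>g j (x(i := t))\<bar> \<le> K" if "j \<in> I" "x \<in> space ?G" for j x
          using insert.prems(5)[OF insertI2[OF that(1)] updI[OF that(2)]] .
        show "((\<lambda>s. f (x(j := s, i := t))) has_real_derivative g j (x(j := s, i := t))) (at s)"
          if "j \<in> I" "x \<in> space ?G" for j x s
          using insert.prems(6)[OF insertI2[OF that(1)] updI[OF that(2)]] that by (simp only: tw)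
        show "continuous_on UNIV (\<lambda>s. g j (x(j := s, i := t)))"
          if "j \<in> I" "x \<in> space ?G" for j x
          using insert.prems(7)[OF insertI2[OF that(1)] updI[OF that(2)]] that by (simp only: tw)
      qed fact
    qed
    also have "\<dots> = (\<Sum>j\<in>I. \<integral>t. (\<integral>x. (g j (x(i := t)))\<^sup>2 \<partial>?G) \<partial>std_gauss)"
      using gi by (rule Bochner_Integration.integral_sum)
    also have "\<dots> = (\<Sum>j\<in>I. \<integral>x. (g j x)\<^sup>2 \<partial>?G')"
    proof (rule sum.cong[OF refl])
      fix j assume j: "j \<in> I"
      have "(\<integral>t. (\<integral>x. (g j (x(i := t)))\<^sup>2 \<partial>?G) \<partial>std_gauss) = (\<integral>p. (g j ((snd p)(i := fst p)))\<^sup>2 \<partial>?P)"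
        using P.integral_fst'[OF gint[of j]] j by simp
      also have "\<dots> = (\<integral>x. (g j x)\<^sup>2 \<partial>?G')"
        by (rule tr[symmetric]) (rule borel_measurable_power, rule g, rule insertI2[OF j])
      finally show "(\<integral>t. (\<integral>x. (g j (x(i := t)))\<^sup>2 \<partial>?G) \<partial>std_gauss) = (\<integral>x. (g j x)\<^sup>2 \<partial>?G')" .
    qed
    finally show ?thesis .
  qed
  have "(\<integral>x. (f x)\<^sup>2 \<partial>?G') = (\<integral>p. (h p)\<^sup>2 \<partial>?P)" "(\<integral>x. f x \<partial>?G') = (\<integral>p. h p \<partial>?P)"
    unfolding h_def by (rule tr, measurable)+
  then show ?case
    using ES9 A B insert.hyps by simp
qed

text \<open>
  Used for location and scale changes and for sign flips of single coordinates.
\<close>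

lemma distr_gauss_vec_coordinatewise:
  assumes fin: "finite I" and \<phi>: "\<And>i. i \<in> I \<Longrightarrow> \<phi> i \<in> measurable std_gauss (N i)"
    and N: "\<And>i. prob_space (N i)" and d: "\<And>i. i \<in> I \<Longrightarrow> distr std_gauss (N i) (\<phi> i) = N i"
  shows "distr (gauss_vec I) (PiM I N) (\<lambda>z. \<lambda>i\<in>I. \<phi> i (z i)) = PiM I N"
proof -
  interpret N: product_sigma_finite N
    by (rule product_sigma_finite.intro) (rule prob_space_imp_sigma_finite[OF N])
  have m: "(\<lambda>z. \<lambda>i\<in>I. \<phi> i (z i)) \<in> measurable (gauss_vec I) (PiM I N)"
    by (intro measurable_restrict measurable_compose[OF _ \<phi>]) auto
  show ?thesis
  proof (rule N.PiM_eqI[OF fin])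
    fix A assume A: "\<And>i. i \<in> I \<Longrightarrow> A i \<in> sets (N i)"
    have v: "\<phi> i -` A i \<inter> space std_gauss \<in> sets std_gauss" if "i \<in> I" for i
      using measurable_sets[OF \<phi> A, OF that that] .
    have "(\<lambda>z. \<lambda>i\<in>I. \<phi> i (z i)) -` Pi\<^sub>E I A \<inter> space (gauss_vec I) = Pi\<^sub>E I (\<lambda>i. \<phi> i -` A i \<inter> space std_gauss)"
      by (auto simp: space_gauss_vec PiE_iff restrict_def)
    then have "emeasure (distr (gauss_vec I) (PiM I N) (\<lambda>z. \<lambda>i\<in>I. \<phi> i (z i))) (Pi\<^sub>E I A)
      = emeasure (gauss_vec I) (Pi\<^sub>E I (\<lambda>i. \<phi> i -` A i \<inter> space std_gauss))"
      using A fin by (subst emeasure_distr[OF m]) (auto intro: sets_PiM_I_finite)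
    also have "\<dots> = (\<Prod>i\<in>I. emeasure std_gauss (\<phi> i -` A i \<inter> space std_gauss))"
      using fin v by (intro gv.emeasure_PiM) auto
    also have "\<dots> = (\<Prod>i\<in>I. emeasure (N i) (A i))"
    proof (rule prod.cong[OF refl])
      fix i assume i: "i \<in> I"
      show "emeasure std_gauss (\<phi> i -` A i \<inter> space std_gauss) = emeasure (N i) (A i)"
        using emeasure_distr[OF \<phi>[OF i] A[OF i]] d[OF i] by simp
    qed
    finally show "emeasure (distr (gauss_vec I) (PiM I N) (\<lambda>z. \<lambda>i\<in>I. \<phi> i (z i))) (Pi\<^sub>E I A) = (\<Prod>i\<in>I. emeasure (N i) (A i))" .
  qed simp
qed

lemma distr_std_gauss_affine:
  assumes "\<alpha> \<noteq> 0"
  shows "distr std_gauss lborel (\<lambda>x. \<beta> + \<alpha> * x) = density lborel (\<lambda>x. ennreal (normal_density \<beta> \<bar>\<alpha>\<bar> x))"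
proof -
  interpret prob_space std_gauss by (rule prob_space_std_gauss)
  have "distributed std_gauss lborel (\<lambda>x. x) std_normal_density"
    unfolding distributed_def std_gauss_def by (auto simp: distr_id2)
  from normal_density_affine[OF this _ assms, of \<beta>] show ?thesis
    by (simp add: distributed_def)
qed

lemma gauss_eq_distr:
  assumes \<sigma>: "\<sigma> > 0"
  shows "gauss n \<mu> \<sigma> = distr (gauss_vec {1..n}) (gauss n \<mu> \<sigma>) (\<lambda>z. \<lambda>i\<in>{1..n}. \<mu> i + \<sigma> * z i)"
    and "(\<lambda>z. \<lambda>i\<in>{1..n}. \<mu> i + \<sigma> * z i) \<in> measurable (gauss_vec {1..n}) (gauss n \<mu> \<sigma>)"
proof -
  let ?N = "\<lambda>i. density lborel (\<lambda>x. ennreal (normal_density (\<mu> i) \<sigma> x))"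
  have d: "distr std_gauss (?N i) (\<lambda>x. \<mu> i + \<sigma> * x) = ?N i" for i
    using distr_std_gauss_affine[of \<sigma> "\<mu> i"] \<sigma>
    by (subst distr_cong[OF refl, of _ lborel]) auto
  show "gauss n \<mu> \<sigma> = distr (gauss_vec {1..n}) (gauss n \<mu> \<sigma>) (\<lambda>z. \<lambda>i\<in>{1..n}. \<mu> i + \<sigma> * z i)"
    unfolding gauss_def
    by (rule distr_gauss_vec_coordinatewise[where \<phi>="\<lambda>i x. \<mu> i + \<sigma> * x", symmetric])
       (use d \<sigma> in \<open>auto intro!: prob_space_normal_density\<close>)
  show "(\<lambda>z. \<lambda>i\<in>{1..n}. \<mu> i + \<sigma> * z i) \<in> measurable (gauss_vec {1..n}) (gauss n \<mu> \<sigma>)"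
    unfolding gauss_def by (intro measurable_restrict) simp
qed

lemma integral_gauss_vec_flip:
  fixes q :: "(nat \<Rightarrow> real) \<Rightarrow> real"
  assumes fin: "finite I" and i: "i \<in> I" and q: "q \<in> borel_measurable (gauss_vec I)"
  shows "(\<integral>z. q z \<partial>gauss_vec I) = (\<integral>z. q (z(i := - z i)) \<partial>gauss_vec I)"
proof -
  define \<phi> :: "nat \<Rightarrow> real \<Rightarrow> real" where "\<phi> j x = (if j = i then - x else x)" for j x
  have \<phi>m: "\<phi> j \<in> measurable std_gauss std_gauss" for j
    unfolding \<phi>_def[abs_def] by (cases "j = i") auto
  have "distr std_gauss lborel (\<lambda>x. - x) = std_gauss"
    using distr_std_gauss_affine[of "-1" 0] by (simp add: std_gauss_def)
  then have "distr std_gauss std_gauss (\<phi> j) = std_gauss" for j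
    unfolding \<phi>_def[abs_def]
    by (cases "j = i") (auto simp: distr_id2 cong: distr_cong)
  then have D: "distr (gauss_vec I) (gauss_vec I) (\<lambda>z. \<lambda>j\<in>I. \<phi> j (z j)) = gauss_vec I"
    using \<phi>m by (intro distr_gauss_vec_coordinatewise fin prob_space_std_gauss)
  have m: "(\<lambda>z. \<lambda>j\<in>I. \<phi> j (z j)) \<in> measurable (gauss_vec I) (gauss_vec I)"
    by (intro measurable_restrict measurable_compose[OF _ \<phi>m]) auto
  have "(\<integral>z. q z \<partial>gauss_vec I) = (\<integral>z. q (\<lambda>j\<in>I. \<phi> j (z j)) \<partial>gauss_vec I)"
    using integral_distr[OF m q] D by simp
  also have "\<dots> = (\<integral>z. q (z(i := - z i)) \<partial>gauss_vec I)"
    using i by (intro Bochner_Integration.integral_cong refl arg_cong[of _ _ q])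
      (auto simp: space_gauss_vec \<phi>_def PiE_iff extensional_def fun_eq_iff)
  finally show ?thesis .
qed

text \<open>
  Flipping the sign of coordinate \<open>i\<close> preserves the measure and changes the sign of the integrand.
\<close>

lemma integral_gauss_vec_mult_component_eq_0:
  fixes q :: "(nat \<Rightarrow> real) \<Rightarrow> real"
  assumes fin: "finite I" and i: "i \<in> I" and [measurable]: "q \<in> borel_measurable (gauss_vec I)"
    and indep: "\<And>z t. q (z(i := t)) = q z"
  shows "(\<integral>z. q z * z i \<partial>gauss_vec I) = 0"
proof -
  have "(\<lambda>z. q z * z i) \<in> borel_measurable (gauss_vec I)"
    using i by measurable
  from integral_gauss_vec_flip[OF fin i this] show ?thesis
    by (simp add: indep)
qed

lemma std_gauss_mgf: "(\<integral>\<^sup>+x. ennreal (exp (c * x)) \<partial>std_gauss) = ennreal (exp (c\<^sup>2 / 2))"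
proof -
  have e: "std_normal_density x * exp (c * x) = exp (c\<^sup>2 / 2) * normal_density c 1 x" for x
  proof -
    have "exp (- x\<^sup>2 / 2) * exp (c * x) = exp (c\<^sup>2 / 2) * exp (- (x - c)\<^sup>2 / 2)"
      by (simp add: exp_add[symmetric] power2_eq_square field_simps)
    then show ?thesis
      by (simp add: normal_density_def)
  qed
  have n: "(\<integral>\<^sup>+x. ennreal (normal_density c 1 x) \<partial>lborel) = 1"
    by (subst nn_integral_eq_integral) auto
  have "(\<integral>\<^sup>+x. ennreal (exp (c * x)) \<partial>std_gauss)
    = (\<integral>\<^sup>+x. ennreal (exp (c\<^sup>2 / 2)) * ennreal (normal_density c 1 x) \<partial>lborel)"
    unfolding std_gauss_def
    by (subst nn_integral_density) (auto simp: e ennreal_mult[symmetric])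
  also have "\<dots> = ennreal (exp (c\<^sup>2 / 2))"
    by (subst nn_integral_cmult) (auto simp: n)
  finally show ?thesis .
qed

lemma gauss_vec_mgf:
  assumes "finite I"
  shows "(\<integral>\<^sup>+z. ennreal (exp (\<Sum>i\<in>I. c i * z i)) \<partial>gauss_vec I) = ennreal (exp ((\<Sum>i\<in>I. (c i)\<^sup>2) / 2))"
proof -
  have "(\<integral>\<^sup>+z. ennreal (exp (\<Sum>i\<in>I. c i * z i)) \<partial>gauss_vec I)
    = (\<integral>\<^sup>+z. (\<Prod>i\<in>I. ennreal (exp (c i * z i))) \<partial>gauss_vec I)"
    by (simp add: exp_sum[OF assms] prod_ennreal)
  also have "\<dots> = (\<Prod>i\<in>I. \<integral>\<^sup>+x. ennreal (exp (c i * x)) \<partial>std_gauss)"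
    by (rule gv.product_nn_integral_prod[OF assms]) simp
  also have "\<dots> = ennreal (exp ((\<Sum>i\<in>I. (c i)\<^sup>2) / 2))"
    by (simp add: std_gauss_mgf prod_ennreal exp_sum[OF assms, symmetric] sum_divide_distrib)
  finally show ?thesis .
qed

text \<open>
  A function that is Lipschitz for the seminorm of the coordinates in \<open>I\<close> is continuous for the
  product topology, hence Borel on the full function space, and it depends on the coordinates in \<open>I\<close>
  only, so it factors through the measurable extension by 0.
\<close>

lemma lipschitz_measurable_gauss_vec:
  fixes f :: "(nat \<Rightarrow> real) \<Rightarrow> real"
  assumes lip: "\<And>x y. \<bar>f x - f y\<bar> \<le> K * L2_set (\<lambda>i. x i - y i) I" and fin: "finite I"
  shows "f \<in> borel_measurable (gauss_vec I)"
proof -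
  have "continuous_on UNIV f"
    unfolding continuous_on_def
  proof (intro ballI)
    fix x :: "nat \<Rightarrow> real"
    have c: "((\<lambda>y. y i) \<longlongrightarrow> x i) (at x)" for i :: nat
      using continuous_on_product_coordinates[of i, where 'b=real] by (simp add: continuous_on_def)
    have "((\<lambda>y. K * L2_set (\<lambda>i. y i - x i) I) \<longlongrightarrow> K * L2_set (\<lambda>i. x i - x i) I) (at x)"
      unfolding L2_set_def by (intro tendsto_intros c)
    then have "((\<lambda>y. K * L2_set (\<lambda>i. y i - x i) I) \<longlongrightarrow> 0) (at x)"
      by (simp add: L2_set_def)
    then have "((\<lambda>y. f y - f x) \<longlongrightarrow> 0) (at x)"
      by (rule Lim_null_comparison[rotated]) (simp add: lip)
    then show "(f \<longlongrightarrow> f x) (at x within UNIV)"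
      using LIM_zero_iff by auto
  qed
  then have b: "f \<in> borel_measurable borel"
    by (rule borel_measurable_continuous_onI)
  let ?e = "\<lambda>x i. if i \<in> I then x i else (0::real)"
  have "(\<lambda>x. ?e x i) \<in> borel_measurable (gauss_vec I)" for i
    by (cases "i \<in> I") auto
  then have "?e \<in> measurable (gauss_vec I) (Pi\<^sub>M UNIV (\<lambda>_. borel))"
    by (intro measurable_PiM_single') (auto simp: space_PiM)
  then have "?e \<in> measurable (gauss_vec I) borel"
    by (simp cong: measurable_cong_sets add: sets_PiM_equal_borel)
  then have "(\<lambda>x. f (?e x)) \<in> borel_measurable (gauss_vec I)"
    by (rule measurable_compose[OF _ b])
  moreover have "f (?e x) = f x" for x
  proof -
    have "L2_set (\<lambda>i. ?e x i - x i) I = 0"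
      by (simp add: L2_set_def)
    then show ?thesis using lip[of "?e x" x] by simp
  qed
  ultimately show ?thesis by simp
qed

section \<open>Random walks and logarithmic envelopes\<close>

fun run_max :: "(nat \<Rightarrow> real) \<Rightarrow> nat \<Rightarrow> real" where
  "run_max X 0 = X 0"
| "run_max X (Suc b) = max (run_max X b) (X (Suc b))"

lemma run_max_ge: "l \<le> b \<Longrightarrow> X l \<le> run_max X b"
  by (induction b) (auto simp: le_Suc_eq max.coboundedI1)

lemma run_max_le: "(\<And>l. l \<le> b \<Longrightarrow> X l \<le> c) \<Longrightarrow> run_max X b \<le> c"
  by (induction b) auto

text \<open>
  The right-hand side minus the left-hand side changes by 0 while the maximum is unchanged, and by the
  square of the jump of the maximum when a new maximum is reached.
\<close>

lemma doob_pathwise: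
  assumes "X 0 = 0"
  shows "(run_max X b)\<^sup>2 \<le> 2 * run_max X b * X b - 2 * (\<Sum>l<b. run_max X l * (X (Suc l) - X l))"
proof (induction b)
  case 0
  then show ?case using assms by simp
next
  case (Suc b)
  let ?M = "run_max X b" and ?x = "X (Suc b)"
  have "(max ?M ?x)\<^sup>2 - ?M\<^sup>2 \<le> 2 * (max ?M ?x - ?M) * ?x"
    using zero_le_power2[of "?x - ?M"] by (auto simp: max_def power2_eq_square algebra_simps)
  then show ?case
    using Suc by (simp add: algebra_simps)
qed

text \<open>
  The function \<open>e\<close> enumerates the coordinates in the order in which they are summed, so that walks
  to the right and to the left of a jump are treated alike.
\<close>

definition walk :: "(nat \<Rightarrow> nat) \<Rightarrow> (nat \<Rightarrow> real) \<Rightarrow> nat \<Rightarrow> real" where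
  "walk e z l = (\<Sum>i<l. z (e i))"

lemma walk_0 [simp]: "walk e z 0 = 0"
  by (simp add: walk_def)

lemma walk_Suc: "walk e z (Suc l) = walk e z l + z (e l)"
  by (simp add: walk_def)

lemma walk_measurable:
  "e ` {..<l} \<subseteq> I \<Longrightarrow> (\<lambda>z. walk e z l) \<in> borel_measurable (gauss_vec I)"
  unfolding walk_def by (intro borel_measurable_sum measurable_component_singleton) auto

lemma run_max_measurable:
  "(\<And>l. l \<le> b \<Longrightarrow> (\<lambda>z. X z l) \<in> borel_measurable M) \<Longrightarrow> (\<lambda>z. run_max (X z) b) \<in> borel_measurable M"
  for X :: "'a \<Rightarrow> nat \<Rightarrow> real"
  by (induction b) auto

lemma sum_square_inj_le:
  fixes z :: "nat \<Rightarrow> real"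
  assumes "finite I" "inj_on e {..<b}" "e ` {..<b} \<subseteq> I"
  shows "(\<Sum>i<b. (z (e i))\<^sup>2) \<le> (\<Sum>i\<in>I. (z i)\<^sup>2)"
proof -
  have "(\<Sum>i<b. (z (e i))\<^sup>2) = (\<Sum>i\<in>e ` {..<b}. (z i)\<^sup>2)"
    using assms(2) by (simp add: sum.reindex)
  also have "\<dots> \<le> (\<Sum>i\<in>I. (z i)\<^sup>2)"
    using assms by (intro sum_mono2) auto
  finally show ?thesis .
qed

lemma walk_abs_le: "l \<le> b \<Longrightarrow> \<bar>walk e z l\<bar> \<le> (\<Sum>i<b. \<bar>z (e i)\<bar>)"
  unfolding walk_def by (rule order_trans[OF sum_abs]) (auto intro!: sum_mono2)

lemma walk_square_le:
  fixes z :: "nat \<Rightarrow> real"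
  assumes "finite I" "inj_on e {..<b}" "e ` {..<b} \<subseteq> I"
  shows "(\<Sum>i<b. \<bar>z (e i)\<bar>)\<^sup>2 \<le> real b * (\<Sum>i\<in>I. (z i)\<^sup>2)"
proof -
  have "(\<Sum>i<b. \<bar>z (e i)\<bar>)\<^sup>2 \<le> real b * (\<Sum>i<b. (z (e i))\<^sup>2)"
    using square_sum_le[of "\<lambda>i. \<bar>z (e i)\<bar>" "{..<b}"] by simp
  also have "\<dots> \<le> real b * (\<Sum>i\<in>I. (z i)\<^sup>2)"
    using sum_square_inj_le[OF assms] by (intro mult_left_mono) auto
  finally show ?thesis .
qed

lemma integrable_walk_square:
  assumes "finite I" "inj_on e {..<b}" "e ` {..<b} \<subseteq> I"
  shows "integrable (gauss_vec I) (\<lambda>z. (walk e z b)\<^sup>2)"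
proof (rule integrable_gauss_vec_quadratic[where A=0 and B="real b"])
  show "(\<lambda>z. (walk e z b)\<^sup>2) \<in> borel_measurable (gauss_vec I)"
    using walk_measurable[of e b I] assms by auto
  show "\<bar>(walk e z b)\<^sup>2\<bar> \<le> 0 + real b * (\<Sum>i\<in>I. (z i)\<^sup>2)" for z
    using power_mono[OF walk_abs_le[of b b e z], of 2] walk_square_le[OF assms, of z] by simp
qed

lemma integral_walk_square:
  assumes "finite I" "inj_on e {..<b}" "e ` {..<b} \<subseteq> I"
  shows "(\<integral>z. (walk e z b)\<^sup>2 \<partial>gauss_vec I) = real b"
  using assms
proof (induction b)
  case 0
  then show ?case by simp
next
  case (Suc b)
  have eb: "e b \<in> I" and inj: "inj_on e {..<b}" and eI: "e ` {..<b} \<subseteq> I"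
    using Suc.prems by (auto simp: inj_on_def)
  have w[measurable]: "(\<lambda>z. walk e z b) \<in> borel_measurable (gauss_vec I)"
    using walk_measurable[OF eI] .
  have c[measurable]: "(\<lambda>z. z (e b)) \<in> borel_measurable (gauss_vec I)"
    using eb by simp
  note i1 = integrable_walk_square[OF Suc.prems(1) inj eI]
  note i2 = integrable_gauss_vec_square[OF eb]
  have i3: "integrable (gauss_vec I) (\<lambda>z. walk e z b * z (e b))"
    by (rule integrable_mult_of_squares[OF w c i1 i2])
  have ne: "e i \<noteq> e b" if "i < b" for i
    using inj_onD[OF Suc.prems(2), of i b] that by auto
  have "walk e (z(e b := t)) b = walk e z b" for z t
    unfolding walk_def using ne by (intro sum.cong) auto
  then have z: "(\<integral>z. walk e z b * z (e b) \<partial>gauss_vec I) = 0"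
    by (intro integral_gauss_vec_mult_component_eq_0 eb w Suc.prems(1))
  have "(walk e z (Suc b))\<^sup>2 = (walk e z b)\<^sup>2 + 2 * (walk e z b * z (e b)) + (z (e b))\<^sup>2" for z
    by (simp add: walk_Suc power2_eq_square algebra_simps)
  then have "(\<integral>z. (walk e z (Suc b))\<^sup>2 \<partial>gauss_vec I)
    = (\<integral>z. (walk e z b)\<^sup>2 \<partial>gauss_vec I) + 2 * (\<integral>z. walk e z b * z (e b) \<partial>gauss_vec I)
      + (\<integral>z. (z (e b))\<^sup>2 \<partial>gauss_vec I)"
    using i1 i2 i3 by simp
  then show ?case
    using Suc.IH[OF Suc.prems(1) inj eI] z integral_gauss_vec_square[OF eb] by simp
qed

text \<open>
  In the pathwise inequality the stochastic sum has mean 0, because the running maximum at time \<open>l\<close> does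
  not depend on the coordinate \<open>e l\<close>; then \<open>2 * M * X \<le> M\<^sup>2 / 2 + 2 * X\<^sup>2\<close>. The sign \<open>c\<close> covers the
  walk and its negative.
\<close>

lemma doob_gauss:
  assumes fin: "finite I" and inj: "inj_on e {..<b}" and eI: "e ` {..<b} \<subseteq> I"
    and c: "c\<^sup>2 = 1"
  defines "M \<equiv> \<lambda>z. run_max (\<lambda>l. c * walk e z l)"
  shows "integrable (gauss_vec I) (\<lambda>z. (M z b)\<^sup>2)"
    and "(\<integral>z. (M z b)\<^sup>2 \<partial>gauss_vec I) \<le> 4 * real b"
proof -
  have wm[measurable]: "(\<lambda>z. walk e z l) \<in> borel_measurable (gauss_vec I)" if "l \<le> b" for l
    using that eI by (intro walk_measurable) auto
  have Mm[measurable]: "(\<lambda>z. M z l) \<in> borel_measurable (gauss_vec I)" if "l \<le> b" for l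
    unfolding M_def using that by (intro run_max_measurable borel_measurable_times wm) auto
  have c1: "\<bar>c\<bar> = 1"
    using c by (auto simp: power2_eq_1_iff)
  have M0: "0 \<le> M z l" for z l
    unfolding M_def using run_max_ge[of 0 l "\<lambda>l. c * walk e z l"] by simp
  have Mle: "M z l \<le> (\<Sum>i<b. \<bar>z (e i)\<bar>)" if "l \<le> b" for z l
    unfolding M_def
  proof (rule run_max_le)
    fix k assume "k \<le> l"
    then have "\<bar>c * walk e z k\<bar> \<le> (\<Sum>i<b. \<bar>z (e i)\<bar>)"
      using walk_abs_le[of k b e z] that c1 by (simp add: abs_mult)
    then show "c * walk e z k \<le> (\<Sum>i<b. \<bar>z (e i)\<bar>)" by linarith
  qed
  have iM: "integrable (gauss_vec I) (\<lambda>z. (M z l)\<^sup>2)" if l: "l \<le> b" for l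
  proof (rule integrable_gauss_vec_quadratic[where A=0 and B="real b"])
    show "\<bar>(M z l)\<^sup>2\<bar> \<le> 0 + real b * (\<Sum>i\<in>I. (z i)\<^sup>2)" for z
      using power_mono[OF Mle[OF l, of z] M0, of 2] walk_square_le[OF fin inj eI, of z] by simp
  qed (use l in measurable)
  then show "integrable (gauss_vec I) (\<lambda>z. (M z b)\<^sup>2)" by simp
  have iMz: "integrable (gauss_vec I) (\<lambda>z. M z l * z (e l))" if "l < b" for l
    using that eI by (intro integrable_mult_of_squares iM integrable_gauss_vec_square) auto
  have Mz: "(\<integral>z. M z l * z (e l) \<partial>gauss_vec I) = 0" if l: "l < b" for l
  proof (rule integral_gauss_vec_mult_component_eq_0[OF fin])
    show "e l \<in> I" using l eI by auto
    show "(\<lambda>z. M z l) \<in> borel_measurable (gauss_vec I)" using l by simp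
    fix z t
    have ne: "e i \<noteq> e l" if "i < l" for i
      using inj_onD[OF inj, of i l] that l by auto
    have "walk e (z(e l := t)) k = walk e z k" if "k \<le> l" for k
      unfolding walk_def using ne that by (intro sum.cong) auto
    then have "run_max (\<lambda>k. c * walk e (z(e l := t)) k) k = run_max (\<lambda>k. c * walk e z k) k" if "k \<le> l" for k
      using that by (induction k) auto
    then show "M (z(e l := t)) l = M z l"
      unfolding M_def by simp
  qed
  note iw = integrable_walk_square[OF fin inj eI]
  have "(M z b)\<^sup>2 \<le> 4 * (walk e z b)\<^sup>2 - (4 * c) * (\<Sum>l<b. M z l * z (e l))" for z
  proof -
    have "(M z b)\<^sup>2 \<le> 2 * M z b * (c * walk e z b) - 2 * (\<Sum>l<b. M z l * (c * walk e z (Suc l) - c * walk e z l))"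
      unfolding M_def by (rule doob_pathwise) simp
    also have "(\<Sum>l<b. M z l * (c * walk e z (Suc l) - c * walk e z l)) = c * (\<Sum>l<b. M z l * z (e l))"
      by (simp add: walk_Suc sum_distrib_left algebra_simps)
    finally have 1: "(M z b)\<^sup>2 \<le> 2 * M z b * (c * walk e z b) - 2 * (c * (\<Sum>l<b. M z l * z (e l)))" .
    have "0 \<le> (M z b - 2 * (c * walk e z b))\<^sup>2" by simp
    also have "\<dots> = (M z b)\<^sup>2 - 4 * (M z b * (c * walk e z b)) + 4 * (c\<^sup>2 * (walk e z b)\<^sup>2)"
      by (simp add: power2_eq_square algebra_simps)
    finally have "4 * (M z b * (c * walk e z b)) \<le> (M z b)\<^sup>2 + 4 * (walk e z b)\<^sup>2"
      using c by simp
    with 1 show ?thesis by (simp add: algebra_simps)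
  qed
  then have "(\<integral>z. (M z b)\<^sup>2 \<partial>gauss_vec I)
    \<le> (\<integral>z. 4 * (walk e z b)\<^sup>2 - (4 * c) * (\<Sum>l<b. M z l * z (e l)) \<partial>gauss_vec I)"
    by (intro integral_mono Bochner_Integration.integrable_diff integrable_mult_right
        Bochner_Integration.integrable_sum iM iw iMz) auto
  also have "\<dots> = 4 * (\<integral>z. (walk e z b)\<^sup>2 \<partial>gauss_vec I) - (4 * c) * (\<Sum>l<b. \<integral>z. M z l * z (e l) \<partial>gauss_vec I)"
  proof -
    have iS: "integrable (gauss_vec I) (\<lambda>z. \<Sum>l<b. M z l * z (e l))"
      by (intro Bochner_Integration.integrable_sum iMz) simp
    have "(\<integral>z. (\<Sum>l<b. M z l * z (e l)) \<partial>gauss_vec I) = (\<Sum>l<b. \<integral>z. M z l * z (e l) \<partial>gauss_vec I)"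
      by (intro Bochner_Integration.integral_sum iMz) simp
    then show ?thesis
      by (subst Bochner_Integration.integral_diff) (use iw iS in simp_all)
  qed
  also have "\<dots> = 4 * real b"
    using integral_walk_square[OF fin inj eI] Mz by simp
  finally show "(\<integral>z. (M z b)\<^sup>2 \<partial>gauss_vec I) \<le> 4 * real b" .
qed

definition run_abs :: "(nat \<Rightarrow> real) \<Rightarrow> nat \<Rightarrow> real" where
  "run_abs X b = max (run_max X b) (run_max (\<lambda>l. - X l) b)"

lemma run_abs_ge: "l \<le> b \<Longrightarrow> \<bar>X l\<bar> \<le> run_abs X b"
  unfolding run_abs_def using run_max_ge[of l b X] run_max_ge[of l b "\<lambda>l. - X l"] by auto

lemma run_abs_nonneg: "0 \<le> run_abs X b"
  using run_abs_ge[of 0 b X] by (meson abs_ge_zero order_trans le0)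

lemma run_abs_measurable:
  assumes "e ` {..<b} \<subseteq> I"
  shows "(\<lambda>z. run_abs (walk e z) b) \<in> borel_measurable (gauss_vec I)"
proof -
  have "(\<lambda>z. walk e z l) \<in> borel_measurable (gauss_vec I)" if "l \<le> b" for l
    using that assms by (intro walk_measurable) auto
  then show ?thesis
    unfolding run_abs_def by (intro borel_measurable_max run_max_measurable borel_measurable_uminus)
qed

lemma nn_integral_run_abs_square_le:
  assumes fin: "finite I" and inj: "inj_on e {..<b}" and eI: "e ` {..<b} \<subseteq> I"
  shows "(\<integral>\<^sup>+z. ennreal ((run_abs (walk e z) b)\<^sup>2) \<partial>gauss_vec I) \<le> ennreal (8 * real b)"
proof -
  let ?M = "\<lambda>c z. run_max (\<lambda>l. c * walk e z l) b"
  note d1 = doob_gauss[OF fin inj eI, of 1]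
  note d2 = doob_gauss[OF fin inj eI, of "-1"]
  have M0: "0 \<le> ?M c z" for z c
    using run_max_ge[of 0 b "\<lambda>l. c * walk e z l"] by simp
  have "(run_abs (walk e z) b)\<^sup>2 \<le> (?M 1 z)\<^sup>2 + (?M (-1) z)\<^sup>2" for z
    unfolding run_abs_def by (auto simp: max_def)
  then have "(\<integral>\<^sup>+z. ennreal ((run_abs (walk e z) b)\<^sup>2) \<partial>gauss_vec I)
    \<le> (\<integral>\<^sup>+z. ennreal ((?M 1 z)\<^sup>2 + (?M (-1) z)\<^sup>2) \<partial>gauss_vec I)"
    by (intro nn_integral_mono ennreal_leI)
  also have "\<dots> = ennreal (\<integral>z. (?M 1 z)\<^sup>2 + (?M (-1) z)\<^sup>2 \<partial>gauss_vec I)"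
    using d1(1) d2(1) by (intro nn_integral_eq_integral) auto
  also have "\<dots> \<le> ennreal (8 * real b)"
    using d1 d2 by (intro ennreal_leI) auto
  finally show ?thesis .
qed

text \<open>
  A random nondecreasing majorant of \<open>\<bar>X\<bar>\<close> that starts at 0 and has small increments: the \<open>i\<close>-th
  one is of the order \<open>1 / sqrt i\<close>, because the maximum over the first \<open>2 * i\<close> steps is of the order
  \<open>sqrt i\<close>.
\<close>

definition envelope :: "(nat \<Rightarrow> real) \<Rightarrow> nat \<Rightarrow> nat \<Rightarrow> real" where
  "envelope X m j = (\<Sum>i=1..j. 2 * run_abs X (min (2 * i) m) / real i)"

lemma envelope_0 [simp]: "envelope X m 0 = 0"
  by (simp add: envelope_def)

lemma envelope_Suc: "envelope X m (Suc j) = envelope X m j + 2 * run_abs X (min (2 * Suc j) m) / real (Suc j)"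
  by (simp add: envelope_def)

text \<open>
  The increments with \<open>j / 2 \<le> i \<le> j\<close> suffice: there are at least \<open>j / 2\<close> of them, and each is at least
  \<open>2 * \<bar>X j\<bar> / j\<close>, since the maximum over \<open>2 * i \<ge> j\<close> steps sees \<open>X j\<close>.
\<close>

lemma envelope_ge:
  assumes "j \<le> m" "X 0 = 0"
  shows "\<bar>X j\<bar> \<le> envelope X m j"
proof (cases "j = 0")
  case False
  let ?A = "{(j + 1) div 2..j}"
  have card: "real j / 2 \<le> real (card ?A)"
    by (simp add: real_of_nat_div field_simps flip: of_nat_mult)
  have "\<bar>X j\<bar> = (real j / 2) * (2 * \<bar>X j\<bar> / real j)"
    using False by simp
  also have "\<dots> \<le> real (card ?A) * (2 * \<bar>X j\<bar> / real j)"
    using card by (intro mult_right_mono) auto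
  also have "\<dots> = (\<Sum>i\<in>?A. 2 * \<bar>X j\<bar> / real j)"
    by simp
  also have "\<dots> \<le> (\<Sum>i\<in>?A. 2 * run_abs X (min (2 * i) m) / real i)"
  proof (rule sum_mono)
    fix i assume i: "i \<in> ?A"
    then have "\<bar>X j\<bar> \<le> run_abs X (min (2 * i) m)"
      using assms by (intro run_abs_ge) auto
    moreover have "0 < i" using i False by auto
    ultimately show "2 * \<bar>X j\<bar> / real j \<le> 2 * run_abs X (min (2 * i) m) / real i"
      using i by (intro frac_le) auto
  qed
  also have "\<dots> \<le> envelope X m j"
    unfolding envelope_def
    using False by (intro sum_mono2) (auto intro!: divide_nonneg_nonneg mult_nonneg_nonneg run_abs_nonneg)
  finally show ?thesis .
qed (use assms in simp)

definition envelope_cost :: "(nat \<Rightarrow> real) \<Rightarrow> nat \<Rightarrow> real" where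
  "envelope_cost X m = (\<Sum>j<m. (envelope X m (Suc j) - envelope X m j)\<^sup>2)"

lemma envelope_cost_nonneg: "0 \<le> envelope_cost X m"
  by (simp add: envelope_cost_def sum_nonneg)

lemma sum_inverse_le_ln: "m \<ge> 1 \<Longrightarrow> (\<Sum>j<m. 1 / real (Suc j)) \<le> 1 + ln (real m)"
proof (induction m rule: nat_induct_at_least)
  case base
  then show ?case by simp
next
  case (Suc m)
  have "1 / real (Suc m) \<le> ln (real (Suc m)) - ln (real m)"
  proof -
    have "ln (real m / real (Suc m)) \<le> real m / real (Suc m) - 1"
      using Suc by (intro ln_le_minus_one) auto
    moreover have "real m / real (Suc m) - 1 = - (1 / real (Suc m))"
      by (simp add: field_simps)
    moreover have "ln (real m / real (Suc m)) = ln (real m) - ln (real (Suc m))"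
      using Suc by (intro ln_divide_pos) auto
    ultimately show ?thesis by linarith
  qed
  then show ?case using Suc by (simp del: of_nat_Suc)
qed

lemma envelope_cost_measurable:
  assumes "e ` {..<m} \<subseteq> I"
  shows "(\<lambda>z. envelope_cost (walk e z) m) \<in> borel_measurable (gauss_vec I)"
proof -
  have "(\<lambda>z. run_abs (walk e z) (min (2 * Suc j) m)) \<in> borel_measurable (gauss_vec I)" for j
    using assms by (intro run_abs_measurable) auto
  then show ?thesis
    unfolding envelope_cost_def envelope_Suc by simp
qed

text \<open>
  The \<open>i\<close>-th squared increment has mean at most \<open>4 * 16 * i / i\<^sup>2\<close>, and the harmonic sum is logarithmic.
\<close>

lemma nn_integral_envelope_cost_le:
  assumes fin: "finite I" and inj: "inj_on e {..<m}" and eI: "e ` {..<m} \<subseteq> I" and m: "m \<ge> 1"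
  shows "(\<integral>\<^sup>+z. ennreal (envelope_cost (walk e z) m) \<partial>gauss_vec I) \<le> ennreal (64 * (1 + ln (real m)))"
proof -
  let ?b = "\<lambda>j. min (2 * Suc j) m"
  let ?R = "\<lambda>j z. run_abs (walk e z) (?b j)"
  have [measurable]: "?R j \<in> borel_measurable (gauss_vec I)" for j
    using eI by (intro run_abs_measurable) auto
  have cost: "envelope_cost (walk e z) m = (\<Sum>j<m. 4 / (real (Suc j))\<^sup>2 * (?R j z)\<^sup>2)" for z
    unfolding envelope_cost_def envelope_Suc by (simp add: power_divide power_mult_distrib del: of_nat_Suc)
  have e: "ennreal (4 / (real (Suc j))\<^sup>2) * ennreal ((?R j z)\<^sup>2)
    = ennreal (4 / (real (Suc j))\<^sup>2 * (?R j z)\<^sup>2)" for j z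
    by (rule ennreal_mult[symmetric]) simp_all
  have "(\<integral>\<^sup>+z. ennreal (envelope_cost (walk e z) m) \<partial>gauss_vec I)
    = (\<integral>\<^sup>+z. (\<Sum>j<m. ennreal (4 / (real (Suc j))\<^sup>2) * ennreal ((?R j z)\<^sup>2)) \<partial>gauss_vec I)"
    unfolding cost
    by (intro nn_integral_cong) (simp only: e, rule sum_ennreal[symmetric], simp del: of_nat_Suc)
  also have "\<dots> = (\<Sum>j<m. \<integral>\<^sup>+z. ennreal (4 / (real (Suc j))\<^sup>2) * ennreal ((?R j z)\<^sup>2) \<partial>gauss_vec I)"
    by (rule nn_integral_sum) measurable
  also have "\<dots> = (\<Sum>j<m. ennreal (4 / (real (Suc j))\<^sup>2) * (\<integral>\<^sup>+z. ennreal ((?R j z)\<^sup>2) \<partial>gauss_vec I))"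
    by (intro sum.cong refl nn_integral_cmult) measurable
  also have "\<dots> \<le> (\<Sum>j<m. ennreal (4 / (real (Suc j))\<^sup>2) * ennreal (16 * real (Suc j)))"
  proof (intro sum_mono mult_left_mono)
    fix j assume "j \<in> {..<m}"
    have "inj_on e {..<?b j}"
      using inj by (rule inj_on_subset) auto
    then have "(\<integral>\<^sup>+z. ennreal ((?R j z)\<^sup>2) \<partial>gauss_vec I) \<le> ennreal (8 * real (?b j))"
      using eI by (intro nn_integral_run_abs_square_le fin) auto
    also have "\<dots> \<le> ennreal (16 * real (Suc j))"
      by (intro ennreal_leI) (simp add: min_def)
    finally show "(\<integral>\<^sup>+z. ennreal ((?R j z)\<^sup>2) \<partial>gauss_vec I) \<le> ennreal (16 * real (Suc j))" .
  qed simp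
  also have "\<dots> = ennreal (64 * (\<Sum>j<m. 1 / real (Suc j)))"
  proof -
    have "ennreal (4 / (real (Suc j))\<^sup>2) * ennreal (16 * real (Suc j)) = ennreal (64 * (1 / real (Suc j)))" for j
      by (subst ennreal_mult[symmetric]) (simp_all add: power2_eq_square del: of_nat_Suc)
    then show ?thesis
      by (simp add: sum_ennreal sum_distrib_left del: of_nat_Suc)
  qed
  also have "\<dots> \<le> ennreal (64 * (1 + ln (real m)))"
    using sum_inverse_le_ln[OF m] by (intro ennreal_leI) simp
  finally show ?thesis .
qed

section \<open>Blocks on which the walk stays in a tube\<close>

text \<open>
  The exponent is a linear form in the Gaussian vector with coefficient vector of squared norm at most
  \<open>1 + 2 * s + s\<^sup>2 * b\<close>; the term \<open>2 * s\<close> accounts for the case that the coordinate \<open>e i0\<close> belongs to the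
  walk.
\<close>

lemma walk_mgf:
  assumes fin: "finite I" and inj: "inj_on e {..<b}" and eI: "e ` {..<b} \<subseteq> I"
    and i: "i0 < b" and j: "j \<le> b" and s: "s \<ge> 0" and \<epsilon>: "\<epsilon>1\<^sup>2 = 1" "\<epsilon>2\<^sup>2 = 1"
  shows "(\<integral>\<^sup>+z. ennreal (exp (\<epsilon>1 * z (e i0) + \<epsilon>2 * s * walk e z j)) \<partial>gauss_vec I)
    \<le> ennreal (exp ((1 + 2 * s + s\<^sup>2 * real b) / 2))"
proof -
  define A where "A i = (of_bool (i = e i0) :: real)" for i
  define B where "B i = (of_bool (i \<in> e ` {..<j}) :: real)" for i
  define c where "c i = \<epsilon>1 * A i + \<epsilon>2 * s * B i" for i
  have inj': "inj_on e {..<j}"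
    using inj by (rule inj_on_subset) (use j in auto)
  have ei: "e i0 \<in> I" and ej: "e ` {..<j} \<subseteq> I"
    using i j eI by auto
  have sA: "(\<Sum>k\<in>I. A k * y k) = y (e i0)" for y
    unfolding A_def using fin ei by (simp add: of_bool_def if_distrib if_distribR cong: if_cong)
  have sB: "(\<Sum>k\<in>I. B k * y k) = (\<Sum>i<j. y (e i))" for y
  proof -
    have "(\<Sum>k\<in>I. B k * y k) = (\<Sum>k\<in>e ` {..<j}. y k)"
      unfolding B_def using fin ej by (intro sum.mono_neutral_cong_right) auto
    then show ?thesis using inj' by (simp add: sum.reindex)
  qed
  have lin: "\<epsilon>1 * z (e i0) + \<epsilon>2 * s * walk e z j = (\<Sum>k\<in>I. c k * z k)" for z
  proof -
    have "(\<Sum>k\<in>I. c k * z k) = \<epsilon>1 * (\<Sum>k\<in>I. A k * z k) + \<epsilon>2 * s * (\<Sum>k\<in>I. B k * z k)"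
      by (simp add: c_def sum_distrib_left sum.distrib distrib_right mult.assoc)
    then show ?thesis by (simp add: sA sB walk_def)
  qed
  have e12: "\<epsilon>1 * \<epsilon>2 \<le> 1"
    using \<epsilon> by (auto simp: power2_eq_1_iff)
  have "(c k)\<^sup>2 \<le> A k * (1 + 2 * s) + B k * s\<^sup>2" for k
  proof -
    have "(c k)\<^sup>2 = \<epsilon>1\<^sup>2 * A k + 2 * (\<epsilon>1 * \<epsilon>2) * (s * A k * B k) + \<epsilon>2\<^sup>2 * (B k * s\<^sup>2)"
      by (simp add: c_def A_def B_def power2_eq_square algebra_simps)
    also have "\<dots> = A k + 2 * (\<epsilon>1 * \<epsilon>2) * (s * A k * B k) + B k * s\<^sup>2"
      using \<epsilon> by simp
    also have "2 * (\<epsilon>1 * \<epsilon>2) * (s * A k * B k) \<le> 2 * (s * A k)"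
    proof -
      have "(\<epsilon>1 * \<epsilon>2) * (s * A k * B k) \<le> 1 * (s * A k * B k)"
        using e12 s by (intro mult_right_mono) (auto simp: A_def B_def)
      also have "\<dots> \<le> s * A k"
        using s by (auto simp: A_def B_def)
      finally show ?thesis by simp
    qed
    finally show ?thesis by (simp add: algebra_simps)
  qed
  then have "(\<Sum>k\<in>I. (c k)\<^sup>2) \<le> (\<Sum>k\<in>I. A k * (1 + 2 * s) + B k * s\<^sup>2)"
    by (rule sum_mono)
  also have "\<dots> = 1 + 2 * s + s\<^sup>2 * real j"
    using sA[of "\<lambda>_. 1 + 2 * s"] sB[of "\<lambda>_. s\<^sup>2"] by (simp add: sum.distrib)
  also have "\<dots> \<le> 1 + 2 * s + s\<^sup>2 * real b"
    using j by (simp add: mult_left_mono)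
  finally have c2: "(\<Sum>k\<in>I. (c k)\<^sup>2) / 2 \<le> (1 + 2 * s + s\<^sup>2 * real b) / 2" by simp
  show ?thesis
    unfolding lin gauss_vec_mgf[OF fin] using c2 by (intro ennreal_leI) simp
qed

lemma run_abs_gtD:
  assumes "run_abs X b > c"
  shows "\<exists>j\<le>b. \<bar>X j\<bar> > c"
proof (rule ccontr)
  assume "\<not> (\<exists>j\<le>b. \<bar>X j\<bar> > c)"
  then have "\<bar>X j\<bar> \<le> c" if "j \<le> b" for j
    using that by force
  then have "run_max X b \<le> c" "run_max (\<lambda>l. - X l) b \<le> c"
    by (intro run_max_le; fastforce simp: abs_le_iff)+
  then show False using assms by (simp add: run_abs_def)
qed

text \<open>
  The cost of a path over one block: if the walk stays within \<open>r / 2\<close>, then its chord stays within the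
  tube of radius \<open>r\<close> and has the second value as cost; otherwise the path follows the walk itself.
\<close>

definition block_cost :: "real \<Rightarrow> (nat \<Rightarrow> nat) \<Rightarrow> nat \<Rightarrow> (nat \<Rightarrow> real) \<Rightarrow> real" where
  "block_cost r e b z = (if run_abs (walk e z) b > r / 2 then (\<Sum>i<b. (z (e i))\<^sup>2) else (walk e z b)\<^sup>2 / real b)"

lemma block_cost_nonneg: "0 \<le> block_cost r e b z"
  by (simp add: block_cost_def sum_nonneg)

lemma block_cost_measurable:
  assumes eI: "e ` {..<b} \<subseteq> I"
  shows "block_cost r e b \<in> borel_measurable (gauss_vec I)"
proof -
  have [measurable]: "(\<lambda>z. run_abs (walk e z) b) \<in> borel_measurable (gauss_vec I)"
    "(\<lambda>z. walk e z b) \<in> borel_measurable (gauss_vec I)"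
    using eI by (auto intro: run_abs_measurable walk_measurable)
  have [measurable]: "(\<lambda>z. \<Sum>i<b. (z (e i))\<^sup>2) \<in> borel_measurable (gauss_vec I)"
    using eI by (intro borel_measurable_sum borel_measurable_power measurable_component_singleton) auto
  show ?thesis
    unfolding block_cost_def[abs_def] by measurable
qed

lemma square_le_exp: "x\<^sup>2 \<le> 2 * (exp x + exp (- x))" for x :: real
proof -
  have "1 + \<bar>x\<bar> + \<bar>x\<bar>\<^sup>2 / 2 \<le> exp \<bar>x\<bar>"
    by (rule exp_lower_Taylor_quadratic) simp
  then have "x\<^sup>2 \<le> 2 * exp \<bar>x\<bar>" by simp
  also have "exp \<bar>x\<bar> \<le> exp x + exp (- x)"
    by (cases "x \<ge> 0") auto
  finally show ?thesis by simp
qed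

text \<open>
  The chord costs 1 on average. For the exceptional event, the indicator of \<open>\<bar>walk j\<bar> > r / 2\<close> is
  bounded by exponentials of the walk and \<open>z\<^sup>2\<close> by exponentials of \<open>z\<close>; with \<open>r\<^sup>2 = 16 * N * L\<close> and
  \<open>s = r / (2 * N)\<close> each of the \<open>4 * b\<^sup>2\<close> products contributes at most \<open>4 / b\<^sup>2\<close>, which is what the
  logarithmic factor in the tube width is for.
\<close>

lemma nn_integral_block_cost_le:
  fixes N :: real
  assumes fin: "finite I" and inj: "inj_on e {..<b}" and eI: "e ` {..<b} \<subseteq> I"
    and b: "1 \<le> b" "real b \<le> N"
  shows "(\<integral>\<^sup>+z. ennreal (block_cost (4 * sqrt (N * (1 + ln N))) e b z) \<partial>gauss_vec I) \<le> ennreal 17"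
proof -
  define L where "L = 1 + ln N"
  define r where "r = 4 * sqrt (N * L)"
  \<comment> \<open>Minimises the exponent \<open>- s * r / 2 + s\<^sup>2 * N / 2\<close> of the tail bound.\<close>
  define s where "s = r / (2 * N)"
  define \<kappa> where "\<kappa> = exp (- s * r / 2)"
  define \<tau> where "\<tau> = exp ((1 + 2 * s + s\<^sup>2 * real b) / 2)"
  have N1: "N \<ge> 1" using b by linarith
  have L1: "L \<ge> 1" "L \<le> N"
    using N1 ln_le_minus_one[of N] by (auto simp: L_def)
  have r0: "r > 0" using N1 L1 by (simp add: r_def)
  have s0: "s \<ge> 0" using r0 N1 by (simp add: s_def)
  have r2: "r\<^sup>2 = 16 * (N * L)"
    using N1 L1 by (simp add: r_def power_mult_distrib)
  have s2: "s\<^sup>2 = 4 * L / N"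
    using N1 r2 by (simp add: s_def power_divide power_mult_distrib) (simp add: power2_eq_square)
  have "s\<^sup>2 \<le> 2\<^sup>2" using L1 N1 by (simp add: s2 divide_le_eq)
  then have s_le: "s \<le> 2" by (rule power2_le_imp_le) simp
  have sr: "s * r = 8 * L"
    using N1 r2 by (simp add: s_def power2_eq_square)
  have \<kappa>\<tau>: "\<kappa> * \<tau> \<le> 2 / (real b * real b)"
  proof -
    have "s\<^sup>2 * real b \<le> 4 * L"
    proof -
      have "s\<^sup>2 * real b \<le> s\<^sup>2 * N" using b by (intro mult_left_mono) auto
      then show ?thesis using N1 by (simp add: s2)
    qed
    then have "- s * r / 2 + (1 + 2 * s + s\<^sup>2 * real b) / 2 \<le> 1 / 2 - 2 * ln N"
      using sr s_le by (simp add: L_def field_simps)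
    then have "\<kappa> * \<tau> \<le> exp (1 / 2 - 2 * ln N)"
      by (simp add: \<kappa>_def \<tau>_def flip: exp_add)
    also have "\<dots> = exp (1 / 2) / (N * N)"
      using N1 by (simp add: exp_diff exp_double power2_eq_square)
    also have "\<dots> \<le> 2 / (N * N)"
      using N1 exp_half_le2 by (intro divide_right_mono) auto
    also have "\<dots> \<le> 2 / (real b * real b)"
      using b by (intro divide_left_mono mult_mono) auto
    finally show ?thesis .
  qed
  let ?T = "\<lambda>i j \<epsilon>1 \<epsilon>2 z. exp (\<epsilon>1 * z (e i) + \<epsilon>2 * s * walk e z j)"
  let ?S = "{- 1, 1 :: real}"
  have bound: "block_cost r e b z
    \<le> (walk e z b)\<^sup>2 / real b + 2 * \<kappa> * (\<Sum>i<b. \<Sum>j\<in>{1..b}. \<Sum>\<epsilon>1\<in>?S. \<Sum>\<epsilon>2\<in>?S. ?T i j \<epsilon>1 \<epsilon>2 z)" for z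
  proof (cases "run_abs (walk e z) b > r / 2")
    case True
    then obtain j where j: "j \<le> b" "\<bar>walk e z j\<bar> > r / 2"
      using run_abs_gtD by blast
    then have j0: "j \<in> {1..b}" using r0 by (cases j) auto
    have "s * (r / 2) \<le> s * \<bar>walk e z j\<bar>"
      using j s0 by (intro mult_left_mono) auto
    then have "1 \<le> \<kappa> * exp (s * \<bar>walk e z j\<bar>)"
      by (simp add: \<kappa>_def flip: exp_add)
    also have "exp (s * \<bar>walk e z j\<bar>) \<le> exp (s * walk e z j) + exp (- s * walk e z j)"
      by (cases "walk e z j \<ge> 0") auto
    finally have one: "1 \<le> \<kappa> * (exp (s * walk e z j) + exp (- s * walk e z j))"
      by (simp add: \<kappa>_def)
    have t: "(z (e i))\<^sup>2 \<le> 2 * \<kappa> * (\<Sum>j\<in>{1..b}. \<Sum>\<epsilon>1\<in>?S. \<Sum>\<epsilon>2\<in>?S. ?T i j \<epsilon>1 \<epsilon>2 z)" for i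
    proof -
      have "(z (e i))\<^sup>2 * 1 \<le> 2 * (exp (z (e i)) + exp (- z (e i))) * (\<kappa> * (exp (s * walk e z j) + exp (- s * walk e z j)))"
        using one square_le_exp by (intro mult_mono) auto
      also have "\<dots> = 2 * \<kappa> * (\<Sum>\<epsilon>1\<in>?S. \<Sum>\<epsilon>2\<in>?S. ?T i j \<epsilon>1 \<epsilon>2 z)"
        by (simp add: exp_add exp_diff exp_minus algebra_simps divide_inverse)
      also have "\<dots> \<le> 2 * \<kappa> * (\<Sum>j\<in>{1..b}. \<Sum>\<epsilon>1\<in>?S. \<Sum>\<epsilon>2\<in>?S. ?T i j \<epsilon>1 \<epsilon>2 z)"
        using j0 by (intro mult_left_mono member_le_sum) (auto simp: \<kappa>_def intro!: add_nonneg_nonneg)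
      finally show ?thesis by simp
    qed
    have "block_cost r e b z = (\<Sum>i<b. (z (e i))\<^sup>2)"
      using True by (simp add: block_cost_def)
    also have "\<dots> \<le> (\<Sum>i<b. 2 * \<kappa> * (\<Sum>j\<in>{1..b}. \<Sum>\<epsilon>1\<in>?S. \<Sum>\<epsilon>2\<in>?S. ?T i j \<epsilon>1 \<epsilon>2 z))"
      by (intro sum_mono t)
    also have "\<dots> = 2 * \<kappa> * (\<Sum>i<b. \<Sum>j\<in>{1..b}. \<Sum>\<epsilon>1\<in>?S. \<Sum>\<epsilon>2\<in>?S. ?T i j \<epsilon>1 \<epsilon>2 z)"
      by (rule sum_distrib_left[symmetric])
    finally show ?thesis by (simp add: add_increasing)
  next
    case False
    have "0 \<le> 2 * \<kappa> * (\<Sum>i<b. \<Sum>j\<in>{1..b}. \<Sum>\<epsilon>1\<in>?S. \<Sum>\<epsilon>2\<in>?S. ?T i j \<epsilon>1 \<epsilon>2 z)"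
      unfolding \<kappa>_def by (intro mult_nonneg_nonneg sum_nonneg) auto
    then show ?thesis using False by (simp add: block_cost_def)
  qed
  have wm[measurable]: "(\<lambda>z. walk e z j) \<in> borel_measurable (gauss_vec I)" if "j \<le> b" for j
    using that eI by (intro walk_measurable) auto
  have Tm: "(\<lambda>z. ennreal (?T i j \<epsilon>1 \<epsilon>2 z)) \<in> borel_measurable (gauss_vec I)"
    if "i < b" "j \<le> b" for i j \<epsilon>1 \<epsilon>2
  proof -
    have "e i \<in> I" using that eI by auto
    then show ?thesis using wm[OF that(2)] by simp
  qed
  have w: "(\<integral>\<^sup>+z. ennreal ((walk e z b)\<^sup>2 / real b) \<partial>gauss_vec I) = 1"
    using integrable_walk_square[OF fin inj eI] integral_walk_square[OF fin inj eI] b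
    by (subst nn_integral_eq_integral) auto
  let ?Q = "\<lambda>z. \<Sum>i<b. \<Sum>j\<in>{1..b}. \<Sum>\<epsilon>1\<in>?S. \<Sum>\<epsilon>2\<in>?S. ennreal (?T i j \<epsilon>1 \<epsilon>2 z)"
  have "(\<integral>\<^sup>+z. ennreal (block_cost r e b z) \<partial>gauss_vec I)
    \<le> (\<integral>\<^sup>+z. ennreal ((walk e z b)\<^sup>2 / real b) + ennreal (2 * \<kappa>) * ?Q z \<partial>gauss_vec I)"
  proof (rule nn_integral_mono)
    fix z
    have q: "?Q z = ennreal (\<Sum>i<b. \<Sum>j\<in>{1..b}. \<Sum>\<epsilon>1\<in>?S. \<Sum>\<epsilon>2\<in>?S. ?T i j \<epsilon>1 \<epsilon>2 z)"
      by (simp only: sum_ennreal sum_nonneg exp_ge_zero)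
    have "ennreal ((walk e z b)\<^sup>2 / real b) + ennreal (2 * \<kappa>) * ?Q z
      = ennreal ((walk e z b)\<^sup>2 / real b + 2 * \<kappa> * (\<Sum>i<b. \<Sum>j\<in>{1..b}. \<Sum>\<epsilon>1\<in>?S. \<Sum>\<epsilon>2\<in>?S. ?T i j \<epsilon>1 \<epsilon>2 z))"
      unfolding q
      by (subst ennreal_mult[symmetric], simp add: \<kappa>_def, intro sum_nonneg, simp, subst ennreal_plus)
         (auto simp: \<kappa>_def intro!: mult_nonneg_nonneg sum_nonneg)
    then show "ennreal (block_cost r e b z) \<le> ennreal ((walk e z b)\<^sup>2 / real b) + ennreal (2 * \<kappa>) * ?Q z"
      using ennreal_leI[OF bound[of z]] by simp
  qed
  also have "\<dots> = 1 + ennreal (2 * \<kappa>) * (\<integral>\<^sup>+z. ?Q z \<partial>gauss_vec I)"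
  proof -
    have "?Q \<in> borel_measurable (gauss_vec I)"
      by (intro borel_measurable_sum Tm) auto
    then show ?thesis
      using wm[of b] by (subst nn_integral_add) (auto simp: w nn_integral_cmult)
  qed
  also have "(\<integral>\<^sup>+z. ?Q z \<partial>gauss_vec I)
    = (\<Sum>i<b. \<Sum>j\<in>{1..b}. \<Sum>\<epsilon>1\<in>?S. \<Sum>\<epsilon>2\<in>?S. \<integral>\<^sup>+z. ennreal (?T i j \<epsilon>1 \<epsilon>2 z) \<partial>gauss_vec I)"
  proof -
    let ?I = "\<lambda>f. \<integral>\<^sup>+z. f z \<partial>gauss_vec I"
    let ?t = "\<lambda>i j \<epsilon>1 \<epsilon>2 z. ennreal (?T i j \<epsilon>1 \<epsilon>2 z)"
    have 1: "?I (\<lambda>z. \<Sum>\<epsilon>2\<in>?S. ?t i j \<epsilon>1 \<epsilon>2 z) = (\<Sum>\<epsilon>2\<in>?S. ?I (?t i j \<epsilon>1 \<epsilon>2))"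
      if "i < b" "j \<in> {1..b}" for i j \<epsilon>1
      by (rule nn_integral_sum, rule Tm) (use that in auto)
    have 2: "?I (\<lambda>z. \<Sum>\<epsilon>1\<in>?S. \<Sum>\<epsilon>2\<in>?S. ?t i j \<epsilon>1 \<epsilon>2 z) = (\<Sum>\<epsilon>1\<in>?S. \<Sum>\<epsilon>2\<in>?S. ?I (?t i j \<epsilon>1 \<epsilon>2))"
      if "i < b" "j \<in> {1..b}" for i j
    proof (subst nn_integral_sum)
      show "(\<lambda>z. \<Sum>\<epsilon>2\<in>?S. ?t i j \<epsilon>1 \<epsilon>2 z) \<in> borel_measurable (gauss_vec I)" for \<epsilon>1
        by (intro borel_measurable_sum Tm) (use that in auto)
    qed (intro sum.cong refl 1 that)
    have 3: "?I (\<lambda>z. \<Sum>j\<in>{1..b}. \<Sum>\<epsilon>1\<in>?S. \<Sum>\<epsilon>2\<in>?S. ?t i j \<epsilon>1 \<epsilon>2 z)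
      = (\<Sum>j\<in>{1..b}. \<Sum>\<epsilon>1\<in>?S. \<Sum>\<epsilon>2\<in>?S. ?I (?t i j \<epsilon>1 \<epsilon>2))"
      if i: "i < b" for i
    proof (subst nn_integral_sum)
      show "(\<lambda>z. \<Sum>\<epsilon>1\<in>?S. \<Sum>\<epsilon>2\<in>?S. ?t i j \<epsilon>1 \<epsilon>2 z) \<in> borel_measurable (gauss_vec I)" if "j \<in> {1..b}" for j
        by (intro borel_measurable_sum Tm i) (use that in auto)
    qed (intro sum.cong refl 2 i)
    show ?thesis
    proof (subst nn_integral_sum)
      show "(\<lambda>z. \<Sum>j\<in>{1..b}. \<Sum>\<epsilon>1\<in>?S. \<Sum>\<epsilon>2\<in>?S. ?t i j \<epsilon>1 \<epsilon>2 z) \<in> borel_measurable (gauss_vec I)"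
        if "i \<in> {..<b}" for i
        by (intro borel_measurable_sum Tm) (use that in auto)
    qed (intro sum.cong refl 3, simp)
  qed
  also have "\<dots> \<le> (\<Sum>i<b. \<Sum>j\<in>{1..b}. \<Sum>\<epsilon>1\<in>?S. \<Sum>\<epsilon>2\<in>?S. ennreal \<tau>)"
    unfolding \<tau>_def by (intro sum_mono walk_mgf[OF fin inj eI] s0) auto
  also have "\<dots> = ennreal (4 * (real b * real b) * \<tau>)"
    by (simp add: \<tau>_def ennreal_mult mult_ac flip: ennreal_of_nat_eq_real_of_nat)
  also have "1 + ennreal (2 * \<kappa>) * ennreal (4 * (real b * real b) * \<tau>) = ennreal (1 + 8 * (real b * real b) * (\<kappa> * \<tau>))"
    by (subst ennreal_mult[symmetric]) (auto simp: \<kappa>_def \<tau>_def ennreal_plus[symmetric] ennreal_1[symmetric] mult_ac simp del: ennreal_plus ennreal_1)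
  also have "\<dots> \<le> ennreal 17"
  proof (rule ennreal_leI)
    have "8 * (real b * real b) * (\<kappa> * \<tau>) \<le> 8 * (real b * real b) * (2 / (real b * real b))"
      by (intro mult_left_mono \<kappa>\<tau>) auto
    also have "\<dots> = 16" using b by simp
    finally show "1 + 8 * (real b * real b) * (\<kappa> * \<tau>) \<le> 17" by simp
  qed
  finally show ?thesis
    by (simp add: r_def L_def add_left_mono mult_left_mono)
qed

section \<open>Paths in a tube around the partial sums\<close>

definition psum :: "(nat \<Rightarrow> real) \<Rightarrow> nat \<Rightarrow> real" where
  "psum z j = (\<Sum>i=1..j. z i)"

lemma psum_0 [simp]: "psum z 0 = 0"
  by (simp add: psum_def)

lemma psum_Suc [simp]: "psum z (Suc j) = psum z j + z (Suc j)"
  by (simp add: psum_def)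

definition right_of :: "nat \<Rightarrow> nat \<Rightarrow> nat" where
  "right_of t i = t + Suc i"

definition left_of :: "nat \<Rightarrow> nat \<Rightarrow> nat" where
  "left_of t i = t - i"

lemma walk_forward: "walk (right_of t) z l = psum z (t + l) - psum z t"
  by (induction l) (auto simp: walk_Suc right_of_def)

lemma walk_backward: "l \<le> t \<Longrightarrow> walk (left_of t) z l = psum z t - psum z (t - l)"
proof (induction l)
  case (Suc l)
  then have "t - l = Suc (t - Suc l)" by simp
  then have "psum z (t - l) = psum z (t - Suc l) + z (t - l)" by simp
  then show ?case using Suc by (simp add: walk_Suc left_of_def)
qed simp

definition step_cost :: "nat \<Rightarrow> nat \<Rightarrow> (nat \<Rightarrow> real) \<Rightarrow> real" where
  "step_cost a b y = (\<Sum>i\<in>{a<..b}. (y i - y (i - 1))\<^sup>2)"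

lemma step_cost_shift: "step_cost t (t + m) y = (\<Sum>l<m. (y (t + Suc l) - y (t + l))\<^sup>2)"
proof -
  have "step_cost t (t + m) y = (\<Sum>i\<in>(\<lambda>l. t + Suc l) ` {..<m}. (y i - y (i - 1))\<^sup>2)"
    unfolding step_cost_def
  proof (rule sum.cong[OF _ refl])
    show "{t<..t + m} = (\<lambda>l. t + Suc l) ` {..<m}"
    proof (intro equalityI subsetI)
      fix i assume "i \<in> {t<..t + m}"
      then have "i = t + Suc (i - t - 1)" "i - t - 1 < m" by auto
      then show "i \<in> (\<lambda>l. t + Suc l) ` {..<m}" by blast
    qed auto
  qed
  then show ?thesis
    by (simp add: sum.reindex inj_on_def)
qed

lemma sum_split_at_knots:
  fixes f :: "nat \<Rightarrow> real"
  assumes "\<And>p. p < K \<Longrightarrow> T p \<le> T (Suc p)" "T 0 = 0"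
  shows "(\<Sum>i\<in>{0<..T K}. f i) = (\<Sum>p<K. \<Sum>i\<in>{T p<..T (Suc p)}. f i)"
  using assms(1)
proof (induction K)
  case 0
  then show ?case using assms(2) by simp
next
  case (Suc K)
  have "{0<..T (Suc K)} = {0<..T K} \<union> {T K<..T (Suc K)}" "{0<..T K} \<inter> {T K<..T (Suc K)} = {}"
    using Suc.prems[of K] by auto
  then show ?case
    using Suc by (simp add: sum.union_disjoint)
qed

text \<open>
  Segments which agree at their common end points are restrictions of one path. Repeated knots are
  permitted, provided that the prescribed values agree there.
\<close>

lemma glue_paths:
  fixes y :: "nat \<Rightarrow> nat \<Rightarrow> real"
  assumes mono: "\<And>p. p < K \<Longrightarrow> T p \<le> T (Suc p)"
    and ends: "\<And>p. p < K \<Longrightarrow> y p (T p) = e p" "\<And>p. p < K \<Longrightarrow> y p (T (Suc p)) = e (Suc p)"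
    and e: "\<And>p q. p \<le> K \<Longrightarrow> q \<le> K \<Longrightarrow> T p = T q \<Longrightarrow> e p = e q"
  shows "\<exists>w. \<forall>p<K. \<forall>j. T p \<le> j \<and> j \<le> T (Suc p) \<longrightarrow> w j = y p j"
proof -
  define w where "w j = y (SOME p. p < K \<and> T p \<le> j \<and> j \<le> T (Suc p)) j" for j
  have mono': "T p \<le> T q" if "p \<le> q" "q \<le> K" for p q
    using that by (induction q rule: dec_induct) (auto intro: order_trans[OF _ mono])
  have cons: "y p j = y q j" if "p < q" "q < K" "T p \<le> j" "j \<le> T (Suc p)" "T q \<le> j" for p q j
  proof -
    have "T (Suc p) \<le> T q" using that by (intro mono') auto
    then have j: "j = T (Suc p)" "j = T q" using that by auto
    have "y p j = e (Suc p)" unfolding j(1) using that by (intro ends(2)) auto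
    also have "\<dots> = e q" using that j by (intro e) auto
    also have "\<dots> = y q j" unfolding j(2) using that by (intro ends(1)[symmetric]) auto
    finally show ?thesis .
  qed
  have "w j = y p j" if "p < K" "T p \<le> j" "j \<le> T (Suc p)" for p j
  proof -
    let ?P = "\<lambda>p. p < K \<and> T p \<le> j \<and> j \<le> T (Suc p)"
    have some: "?P (SOME p. ?P p)" by (rule someI[of ?P p]) (use that in simp)
    have eq: "y a j = y b j" if "?P a" "?P b" for a b
    proof (cases a b rule: linorder_cases)
      case less
      then show ?thesis using that by (intro cons) auto
    next
      case greater
      then have "y b j = y a j" using that by (intro cons) auto
      then show ?thesis by (rule sym)
    qed simp
    show ?thesis unfolding w_def by (rule eq[OF some]) (use that in simp)
  qed
  then show ?thesis by blast
qed

lemma step_cost_glue: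
  assumes mono: "\<And>p. p < K \<Longrightarrow> T p \<le> T (Suc p)" and T0: "T 0 = 0"
    and w: "\<And>p j. p < K \<Longrightarrow> T p \<le> j \<Longrightarrow> j \<le> T (Suc p) \<Longrightarrow> w j = y p j"
  shows "step_cost 0 (T K) w = (\<Sum>p<K. step_cost (T p) (T (Suc p)) (y p))"
proof -
  have "step_cost 0 (T K) w = (\<Sum>p<K. step_cost (T p) (T (Suc p)) w)"
    unfolding step_cost_def by (rule sum_split_at_knots[OF mono T0])
  also have "\<dots> = (\<Sum>p<K. step_cost (T p) (T (Suc p)) (y p))"
    unfolding step_cost_def using w by (intro sum.cong refl) (auto intro!: sum.cong)
  finally show ?thesis .
qed

text \<open>
  Blocks of length \<open>B\<close>, truncated at \<open>n\<close>; a last block may be empty.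
\<close>

definition block_end :: "nat \<Rightarrow> nat \<Rightarrow> nat \<Rightarrow> nat" where
  "block_end n B q = min (q * B) n"

definition tube_cost :: "real \<Rightarrow> nat \<Rightarrow> nat \<Rightarrow> (nat \<Rightarrow> real) \<Rightarrow> real" where
  "tube_cost r n B z = (\<Sum>q<n div B + 1.
     block_cost r (right_of (block_end n B q)) (block_end n B (Suc q) - block_end n B q) z)"

lemma block_path:
  assumes "t \<le> t'" and r: "r \<ge> 0"
  shows "\<exists>y. y t = psum z t \<and> y t' = psum z t' \<and> (\<forall>j. t \<le> j \<and> j \<le> t' \<longrightarrow> \<bar>y j - psum z j\<bar> \<le> r)
    \<and> step_cost t t' y \<le> block_cost r (right_of t) (t' - t) z"
proof -
  obtain b where t': "t' = t + b" using assms(1) le_Suc_ex by blast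
  let ?e = "right_of t"
  show ?thesis
  proof (cases "run_abs (walk ?e z) b > r / 2")
    case True
    have "step_cost t t' (psum z) = (\<Sum>i<b. (z (?e i))\<^sup>2)"
      unfolding t' step_cost_shift by (simp add: right_of_def)
    then show ?thesis
      using True r by (intro exI[of _ "psum z"]) (auto simp: block_cost_def t')
  next
    case False
    show ?thesis
    proof (cases "b = 0")
      case True
      then show ?thesis
        using r by (intro exI[of _ "psum z"]) (auto simp: t' step_cost_def block_cost_nonneg)
    next
      case b0: False
      define W where "W = walk ?e z"
      define y where "y j = psum z t + W b * (real j - real t) / real b" for j
      have wf: "W l = psum z (t + l) - psum z t" for l
        unfolding W_def by (rule walk_forward)
      have wb: "W b = psum z t' - psum z t"
        unfolding t' by (rule wf)
      have w: "\<bar>W l\<bar> \<le> r / 2" if "l \<le> b" for l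
        using run_abs_ge[OF that, of W] False by (simp add: W_def)
      have "\<bar>y j - psum z j\<bar> \<le> r" if "t \<le> j" "j \<le> t'" for j
      proof -
        obtain l where l: "j = t + l" using \<open>t \<le> j\<close> le_Suc_ex by blast
        then have lb: "l \<le> b" using that t' by simp
        have "y j - psum z j = W b * (real l / real b) - W l"
          unfolding y_def l wf[of l] by simp
        also have "\<bar>\<dots>\<bar> \<le> \<bar>W b * (real l / real b)\<bar> + \<bar>W l\<bar>"
          by (rule abs_triangle_ineq4)
        also have "\<bar>W b * (real l / real b)\<bar> \<le> \<bar>W b\<bar> * 1"
          unfolding abs_mult using lb b0 by (intro mult_left_mono) auto
        finally show ?thesis using w[OF lb] w[of b] by simp
      qed
      moreover have "step_cost t t' y = (W b)\<^sup>2 / real b"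
      proof -
        have "y (t + Suc l) - y (t + l) = W b / real b" for l
          using b0 by (simp add: y_def field_simps)
        then show ?thesis
          unfolding t' step_cost_shift using b0 by (simp add: power_divide power2_eq_square)
      qed
      moreover have "y t = psum z t" "y t' = psum z t'"
        using b0 by (auto simp: y_def wb) (auto simp: t')
      ultimately show ?thesis
        using False by (intro exI[of _ y]) (auto simp: block_cost_def t' W_def)
    qed
  qed
qed

text \<open>
  Concatenation of the block paths; they all meet the partial sums at the block ends.
\<close>

lemma tube_path:
  assumes B: "B \<ge> 1" and r: "r \<ge> 0"
  shows "\<exists>y. y 0 = 0 \<and> y n = psum z n \<and> (\<forall>j\<le>n. \<bar>y j - psum z j\<bar> \<le> r) \<and> step_cost 0 n y \<le> tube_cost r n B z"
proof -
  let ?T = "block_end n B" and ?K = "n div B + 1"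
  have mono: "?T p \<le> ?T (Suc p)" for p
    by (auto simp: block_end_def)
  have T0: "?T 0 = 0" by (simp add: block_end_def)
  have TK: "?T ?K = n"
    unfolding block_end_def using B dividend_less_div_times[of B n] by (simp add: min_def)
  obtain Y where Y: "\<And>p. Y p (?T p) = psum z (?T p)" "\<And>p. Y p (?T (Suc p)) = psum z (?T (Suc p))"
    "\<And>p j. ?T p \<le> j \<Longrightarrow> j \<le> ?T (Suc p) \<Longrightarrow> \<bar>Y p j - psum z j\<bar> \<le> r"
    "\<And>p. step_cost (?T p) (?T (Suc p)) (Y p) \<le> block_cost r (right_of (?T p)) (?T (Suc p) - ?T p) z"
    using block_path[OF mono r, of _ z] by metis
  obtain w where w: "\<And>p j. p < ?K \<Longrightarrow> ?T p \<le> j \<Longrightarrow> j \<le> ?T (Suc p) \<Longrightarrow> w j = Y p j"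
    using glue_paths[of ?K ?T Y "\<lambda>p. psum z (?T p)", OF mono Y(1,2)] by auto
  have "step_cost 0 n w = (\<Sum>p<?K. step_cost (?T p) (?T (Suc p)) (Y p))"
    using step_cost_glue[of ?K ?T w Y, OF mono T0 w] TK by simp
  also have "\<dots> \<le> tube_cost r n B z"
    unfolding tube_cost_def by (intro sum_mono Y(4))
  finally have cost: "step_cost 0 n w \<le> tube_cost r n B z" .
  have "w 0 = 0"
    using w[of 0 0] Y(1)[of 0] mono[of 0] T0 by auto
  moreover have "w n = psum z n"
    using w[of "n div B" n] Y(2)[of "n div B"] mono[of "n div B"] TK by auto
  moreover have "\<bar>w j - psum z j\<bar> \<le> r" if "j \<le> n" for j
  proof -
    let ?q = "j div B"
    have "?T ?q \<le> j" "j \<le> ?T (Suc ?q)"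
      using that B dividend_less_div_times[of B j] by (auto simp: block_end_def min_def intro: order_trans[OF div_times_less_eq_dividend])
    moreover have "?q < ?K" using that by (simp add: div_le_mono less_Suc_eq_le)
    ultimately show ?thesis using w Y(3) by metis
  qed
  ultimately show ?thesis using cost by blast
qed

text \<open>
  Pushes the path value \<open>a\<close> up to \<open>b\<close> near a jump of sign 1, and down to \<open>b\<close> near a jump of sign -1.
\<close>

definition sgn_join :: "real \<Rightarrow> real \<Rightarrow> real \<Rightarrow> real" where
  "sgn_join s a b = (if s = 1 then max a b else if s = - 1 then min a b else a)"

text \<open>
  The increment of a maximum lies between the increments of the two paths. This is what makes the costs
  of paths subadditive under lattice operations.
\<close>

lemma square_diff_max_le: "(max a b - max a' b')\<^sup>2 \<le> (a - a')\<^sup>2 + (b - b')\<^sup>2" for a b a' b' :: real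
proof -
  have "\<bar>max a b - max a' b'\<bar> \<le> \<bar>a - a'\<bar> \<or> \<bar>max a b - max a' b'\<bar> \<le> \<bar>b - b'\<bar>"
    by linarith
  then have "(max a b - max a' b')\<^sup>2 \<le> (a - a')\<^sup>2 \<or> (max a b - max a' b')\<^sup>2 \<le> (b - b')\<^sup>2"
    by (simp add: abs_le_square_iff)
  then show ?thesis using zero_le_power2[of "a - a'"] zero_le_power2[of "b - b'"] by linarith
qed

lemma square_diff_min_le: "(min a b - min a' b')\<^sup>2 \<le> (a - a')\<^sup>2 + (b - b')\<^sup>2" for a b a' b' :: real
proof -
  have "\<bar>min a b - min a' b'\<bar> \<le> \<bar>a - a'\<bar> \<or> \<bar>min a b - min a' b'\<bar> \<le> \<bar>b - b'\<bar>"
    by linarith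
  then have "(min a b - min a' b')\<^sup>2 \<le> (a - a')\<^sup>2 \<or> (min a b - min a' b')\<^sup>2 \<le> (b - b')\<^sup>2"
    by (simp add: abs_le_square_iff)
  then show ?thesis using zero_le_power2[of "a - a'"] zero_le_power2[of "b - b'"] by linarith
qed

lemma square_diff_sgn_join_le:
  "(sgn_join s a b - sgn_join s a' b')\<^sup>2 \<le> (a - a')\<^sup>2 + of_bool (s \<noteq> 0) * (b - b')\<^sup>2"
  unfolding sgn_join_def using square_diff_max_le[of a b a' b'] square_diff_min_le[of a b a' b'] by auto

text \<open>
  On the piece from \<open>t\<close> to \<open>t'\<close> with signs \<open>s\<close>, \<open>s'\<close> at its ends, \<open>mid\<close> is joined with two paths: \<open>L\<close>
  starts at the wall on the side of \<open>s\<close> at \<open>t\<close> and leaves it along an envelope, which keeps it inside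
  that wall, and \<open>R\<close> does the same backwards from \<open>t'\<close>. If \<open>s \<noteq> s'\<close>, then both are tilted by a linear ramp,
  so that \<open>L\<close> has left the way free at \<open>t'\<close> and \<open>R\<close> at \<open>t\<close>. The other wall is never violated because
  \<open>mid\<close> stays in the tube. Sign 0 stands for an end of the signal, where \<open>mid\<close> is on the partial sums.
\<close>

lemma piece_path:
  fixes s s' r :: real
  assumes tt: "t < t'" and s: "s \<in> {- 1, 0, 1}" "s' \<in> {- 1, 0, 1}" and r: "r \<ge> 0"
    and mid: "\<And>j. t \<le> j \<Longrightarrow> j \<le> t' \<Longrightarrow> \<bar>mid j - psum z j\<bar> \<le> r"
    and s0: "s = 0 \<Longrightarrow> mid t = psum z t" and s'0: "s' = 0 \<Longrightarrow> mid t' = psum z t'"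
  shows "\<exists>y. y t = psum z t + r * s \<and> y t' = psum z t' + r * s'
    \<and> (\<forall>j. t \<le> j \<and> j \<le> t' \<longrightarrow> \<bar>y j - psum z j\<bar> \<le> r)
    \<and> step_cost t t' y \<le> step_cost t t' mid
        + 2 * envelope_cost (walk (right_of t) z) (t' - t)
        + 2 * envelope_cost (walk (left_of t') z) (t' - t)
        + 4 * r\<^sup>2 * (s - s')\<^sup>2 / real (t' - t)"
proof -
  define m where "m = t' - t"
  have m0: "m > 0" and t': "t' = t + m" using tt by (auto simp: m_def)
  define h where "h l = envelope (walk (right_of t) z) m l" for l
  define h' where "h' l = envelope (walk (left_of t') z) m l" for l
  let ?S = "psum z"
  have h: "\<bar>?S (t + l) - ?S t\<bar> \<le> h l" if "l \<le> m" for l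
    using envelope_ge[OF that, of "walk (right_of t) z"] by (simp only: h_def walk_forward[symmetric] walk_0)
  have h': "\<bar>?S t' - ?S (t' - l)\<bar> \<le> h' l" if "l \<le> m" for l
    using envelope_ge[OF that, of "walk (left_of t') z"] walk_backward[of l t' z] that t'
    by (simp add: h'_def)
  define \<rho> where "\<rho> j = r * ((real j - real t) / real m)" for j
  define \<rho>' where "\<rho>' j = r * ((real t' - real j) / real m)" for j
  define L where "L j = ?S t + s * r - s * h (j - t) - (s - s') * \<rho> j" for j
  define R where "R j = ?S t' + s' * r - s' * h' (t' - j) - (s' - s) * \<rho>' j" for j
  define x where "x j = sgn_join s (mid j) (L j)" for j
  define y where "y j = sgn_join s' (x j) (R j)" for j
  have h0: "h 0 = 0" "h' 0 = 0" by (simp_all add: h_def h'_def)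
  have frac: "0 \<le> \<rho> j" "0 \<le> \<rho>' j"
    if "t \<le> j" "j \<le> t'" for j
    using that r by (auto simp: \<rho>_def \<rho>'_def intro!: mult_nonneg_nonneg divide_nonneg_nonneg)
  have hj: "\<bar>?S j - ?S t\<bar> \<le> h (j - t)" "\<bar>?S t' - ?S j\<bar> \<le> h' (t' - j)" if "t \<le> j" "j \<le> t'" for j
    using h[of "j - t"] h'[of "t' - j"] that t' by auto
  have Lb: "s = 1 \<Longrightarrow> L j \<le> ?S j + r" "s = - 1 \<Longrightarrow> ?S j - r \<le> L j" if "t \<le> j" "j \<le> t'" for j
    using hj[OF that] frac(1)[OF that] s(2) by (auto simp: L_def)
  have Rb: "s' = 1 \<Longrightarrow> R j \<le> ?S j + r" "s' = - 1 \<Longrightarrow> ?S j - r \<le> R j" if "t \<le> j" "j \<le> t'" for j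
    using hj[OF that] frac(2)[OF that] s(1) by (auto simp: R_def)
  have xt: "\<bar>x j - ?S j\<bar> \<le> r" if "t \<le> j" "j \<le> t'" for j
    using mid[OF that] Lb[OF that] unfolding x_def sgn_join_def by (auto simp: abs_le_iff)
  have yt: "\<bar>y j - ?S j\<bar> \<le> r" if "t \<le> j" "j \<le> t'" for j
    using xt[OF that] Rb[OF that] unfolding y_def sgn_join_def by (auto simp: abs_le_iff)
  have Lt: "L t = ?S t + s * r" by (simp add: L_def \<rho>_def h0)
  have Rt': "R t' = ?S t' + s' * r" by (simp add: R_def \<rho>'_def h0)
  have Lt': "L t' = ?S t - s * h m + s' * r"
    using m0 by (simp add: L_def \<rho>_def t' algebra_simps)
  have Rt: "R t = ?S t' - s' * h' m + s * r"
    using m0 by (simp add: R_def \<rho>'_def t' algebra_simps)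
  have hm: "\<bar>?S t' - ?S t\<bar> \<le> h m" "\<bar>?S t' - ?S t\<bar> \<le> h' m"
    using hj[of t'] hj[of t] tt by (auto simp: m_def)
  have x_t: "x t = ?S t + s * r"
    using s(1) mid[of t] tt s0 by (auto simp: x_def sgn_join_def Lt abs_le_iff)
  have y_t: "y t = ?S t + s * r"
    using s(2) x_t hm(2) by (auto simp: y_def sgn_join_def Rt abs_le_iff)
  have y_t': "y t' = ?S t' + s' * r"
  proof (cases "s' = 0")
    case True
    then show ?thesis
      using s'0 s(1) hm(1) by (auto simp: y_def x_def sgn_join_def Lt' abs_le_iff)
  next
    case False
    then show ?thesis
      using xt[of t'] s(2) tt by (auto simp: y_def sgn_join_def Rt' abs_le_iff)
  qed
  have ss: "s\<^sup>2 \<le> 1" "s'\<^sup>2 \<le> 1" using s by auto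
  have cost: "(y (t + Suc l) - y (t + l))\<^sup>2 \<le> (mid (t + Suc l) - mid (t + l))\<^sup>2
      + 2 * (h (Suc l) - h l)\<^sup>2 + 2 * (h' (m - l) - h' (m - Suc l))\<^sup>2
      + 4 * (r\<^sup>2 * (s - s')\<^sup>2 / (real m)\<^sup>2)" if l: "l < m" for l
  proof -
    have dL: "L (t + Suc l) - L (t + l) = - (s * (h (Suc l) - h l)) + - (r * (s - s') / real m)"
      using m0 by (simp add: L_def \<rho>_def field_simps)
    have dR: "R (t + Suc l) - R (t + l) = s' * (h' (m - l) - h' (m - Suc l)) + r * (s' - s) / real m"
      using m0 by (simp add: R_def \<rho>'_def t' field_simps)
    have "(L (t + Suc l) - L (t + l))\<^sup>2 \<le> 2 * (s\<^sup>2 * (h (Suc l) - h l)\<^sup>2) + 2 * (r\<^sup>2 * (s - s')\<^sup>2 / (real m)\<^sup>2)"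
      unfolding dL using square_add_le[of "- (s * (h (Suc l) - h l))" "- (r * (s - s') / real m)"]
      by (simp add: power_mult_distrib power_divide)
    also have "s\<^sup>2 * (h (Suc l) - h l)\<^sup>2 \<le> 1 * (h (Suc l) - h l)\<^sup>2"
      using ss by (intro mult_right_mono) auto
    finally have 1: "(L (t + Suc l) - L (t + l))\<^sup>2 \<le> 2 * (h (Suc l) - h l)\<^sup>2 + 2 * (r\<^sup>2 * (s - s')\<^sup>2 / (real m)\<^sup>2)"
      by simp
    have "(R (t + Suc l) - R (t + l))\<^sup>2 \<le> 2 * (s'\<^sup>2 * (h' (m - l) - h' (m - Suc l))\<^sup>2) + 2 * (r\<^sup>2 * (s' - s)\<^sup>2 / (real m)\<^sup>2)"
      unfolding dR using square_add_le[of "s' * (h' (m - l) - h' (m - Suc l))" "r * (s' - s) / real m"]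
      by (simp add: power_mult_distrib power_divide)
    also have "s'\<^sup>2 * (h' (m - l) - h' (m - Suc l))\<^sup>2 \<le> 1 * (h' (m - l) - h' (m - Suc l))\<^sup>2"
      using ss by (intro mult_right_mono) auto
    finally have 2: "(R (t + Suc l) - R (t + l))\<^sup>2 \<le> 2 * (h' (m - l) - h' (m - Suc l))\<^sup>2 + 2 * (r\<^sup>2 * (s - s')\<^sup>2 / (real m)\<^sup>2)"
      by (simp add: power2_commute[of s' s])
    have b: "of_bool c * q\<^sup>2 \<le> q\<^sup>2" for c and q :: real by auto
    have "(y (t + Suc l) - y (t + l))\<^sup>2 \<le> (x (t + Suc l) - x (t + l))\<^sup>2 + (R (t + Suc l) - R (t + l))\<^sup>2"
      unfolding y_def by (rule order_trans[OF square_diff_sgn_join_le]) (intro add_left_mono b)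
    also have "(x (t + Suc l) - x (t + l))\<^sup>2 \<le> (mid (t + Suc l) - mid (t + l))\<^sup>2 + (L (t + Suc l) - L (t + l))\<^sup>2"
      unfolding x_def by (rule order_trans[OF square_diff_sgn_join_le]) (intro add_left_mono b)
    finally show ?thesis using 1 2 by linarith
  qed
  have rev: "(\<Sum>l<m. (h' (m - l) - h' (m - Suc l))\<^sup>2) = envelope_cost (walk (left_of t') z) m"
  proof -
    have "(\<Sum>l<m. (h' (m - l) - h' (m - Suc l))\<^sup>2) = (\<Sum>l<m. (h' (Suc (m - Suc l)) - h' (m - Suc l))\<^sup>2)"
      by (intro sum.cong refl) (simp add: Suc_diff_Suc)
    also have "\<dots> = (\<Sum>l<m. (h' (Suc l) - h' l)\<^sup>2)"
      by (rule sum.nat_diff_reindex)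
    finally show ?thesis by (simp add: envelope_cost_def h'_def)
  qed
  have "step_cost t t' y \<le> (\<Sum>l<m. (mid (t + Suc l) - mid (t + l))\<^sup>2
      + 2 * (h (Suc l) - h l)\<^sup>2 + 2 * (h' (m - l) - h' (m - Suc l))\<^sup>2
      + 4 * (r\<^sup>2 * (s - s')\<^sup>2 / (real m)\<^sup>2))"
    unfolding t' step_cost_shift using cost[unfolded t'] by (intro sum_mono) auto
  also have "\<dots> = step_cost t t' mid + 2 * envelope_cost (walk (right_of t) z) m
      + 2 * envelope_cost (walk (left_of t') z) m + 4 * r\<^sup>2 * (s - s')\<^sup>2 / real m"
  proof -
    have fwd: "(\<Sum>l<m. (h (Suc l) - h l)\<^sup>2) = envelope_cost (walk (right_of t) z) m"
      by (simp add: envelope_cost_def h_def)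
    have e: "4 * (real m * (r\<^sup>2 * (s - s')\<^sup>2 / (real m)\<^sup>2)) = 4 * r\<^sup>2 * (s - s')\<^sup>2 / real m"
      using m0 by (simp add: power2_eq_square)
    show ?thesis
      unfolding sum.distrib sum_distrib_left[symmetric] fwd rev sum_constant card_lessThan
      unfolding t' step_cost_shift by (simp only: e)
  qed
  finally show ?thesis
    using y_t y_t' yt by (intro exI[of _ y]) (auto simp: m_def mult.commute)
qed

section \<open>Metric projections and their Gaussian fluctuations\<close>

definition ip :: "nat set \<Rightarrow> (nat \<Rightarrow> real) \<Rightarrow> (nat \<Rightarrow> real) \<Rightarrow> real" where
  "ip I x y = (\<Sum>i\<in>I. x i * y i)"

lemma L2_set_square: "(L2_set x I)\<^sup>2 = ip I x x"
  by (simp add: L2_set_def ip_def sum_nonneg power2_eq_square)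

lemma L2_set_square_sum: "(L2_set x I)\<^sup>2 = (\<Sum>i\<in>I. (x i)\<^sup>2)"
  by (simp add: L2_set_def sum_nonneg)

lemma ip_self_nonneg: "0 \<le> ip I x x"
  by (simp add: ip_def sum_nonneg)

lemma ip_commute: "ip I x y = ip I y x"
  by (simp add: ip_def mult.commute)

lemma ip_diff_left: "ip I (\<lambda>i. x i - y i) w = ip I x w - ip I y w"
  by (simp add: ip_def left_diff_distrib sum_subtractf)

lemma ip_diff_right: "ip I w (\<lambda>i. x i - y i) = ip I w x - ip I w y"
  by (simp add: ip_def right_diff_distrib sum_subtractf)

lemma ip_add_left: "ip I (\<lambda>i. x i + y i) w = ip I x w + ip I y w"
  by (simp add: ip_def distrib_right sum.distrib)

lemma ip_add_right: "ip I w (\<lambda>i. x i + y i) = ip I w x + ip I w y"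
  by (simp add: ip_def distrib_left sum.distrib)

lemma ip_scale_left: "ip I (\<lambda>i. c * x i) w = c * ip I x w"
  by (simp add: ip_def sum_distrib_left mult.assoc)

lemma ip_scale_right: "ip I w (\<lambda>i. c * x i) = c * ip I w x"
  by (simp add: ip_def sum_distrib_left mult_ac)

lemmas ip_simps = ip_diff_left ip_diff_right ip_add_left ip_add_right ip_scale_left ip_scale_right

lemma ip_cong: "(\<And>i. i \<in> I \<Longrightarrow> x i = x' i) \<Longrightarrow> (\<And>i. i \<in> I \<Longrightarrow> y i = y' i) \<Longrightarrow> ip I x y = ip I x' y'"
  by (simp add: ip_def)

lemma ip_le: "ip I x y \<le> L2_set x I * L2_set y I"
proof -
  have "ip I x y \<le> (\<Sum>i\<in>I. \<bar>x i\<bar> * \<bar>y i\<bar>)"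
    unfolding ip_def by (intro sum_mono) (metis abs_ge_self abs_mult)
  also have "\<dots> \<le> L2_set x I * L2_set y I"
    by (rule L2_set_mult_ineq)
  finally show ?thesis .
qed

lemma abs_ip_le: "\<bar>ip I x y\<bar> \<le> L2_set x I * L2_set y I"
proof -
  have "- ip I x y \<le> L2_set x I * L2_set y I"
    using ip_le[of I "\<lambda>i. (- 1) * x i" y] unfolding ip_scale_left by (simp add: L2_set_def)
  then show ?thesis using ip_le[of I x y] by (simp add: abs_le_iff)
qed

lemma L2_set_diff_triangle: "L2_set x I \<le> L2_set (\<lambda>i. x i - y i) I + L2_set y I"
  using L2_set_triangle_ineq[of "\<lambda>i. x i - y i" y I] by simp

lemma L2_set_minus_commute: "L2_set (\<lambda>i. x i - y i) I = L2_set (\<lambda>i. y i - x i) I"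
  by (simp add: L2_set_def power2_commute)

lemma abs_L2_set_diff: "\<bar>L2_set x I - L2_set y I\<bar> \<le> L2_set (\<lambda>i. x i - y i) I"
  using L2_set_diff_triangle[of x I y] L2_set_diff_triangle[of y I x] L2_set_minus_commute[of x y I]
  by (simp add: abs_le_iff)

lemma abs_le_L2_set: "finite I \<Longrightarrow> i \<in> I \<Longrightarrow> \<bar>x i\<bar> \<le> L2_set x I"
  using member_le_L2_set[of I i "\<lambda>i. \<bar>x i\<bar>"] by (simp add: L2_set_def)

lemma ip_fun_upd_diff:
  fixes x :: "nat \<Rightarrow> real"
  assumes "finite I" "j \<in> I"
  shows "ip I (\<lambda>i. (x(j := s)) i - (x(j := t)) i) w = (s - t) * w j"
proof -
  have "ip I (\<lambda>i. (x(j := s)) i - (x(j := t)) i) w = (\<Sum>i\<in>I. if i = j then (s - t) * w j else 0)"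
    unfolding ip_def by (intro sum.cong) auto
  then show ?thesis using assms by simp
qed

lemma L2_set_fun_upd_diff:
  fixes x :: "nat \<Rightarrow> real"
  assumes "finite I" "j \<in> I"
  shows "L2_set (\<lambda>i. (x(j := s)) i - (x(j := t)) i) I = \<bar>s - t\<bar>"
proof -
  have "(L2_set (\<lambda>i. (x(j := s)) i - (x(j := t)) i) I)\<^sup>2 = (s - t)\<^sup>2"
    unfolding L2_set_square ip_fun_upd_diff[OF assms] by (simp add: power2_eq_square)
  then show ?thesis
    by (metis L2_set_nonneg abs_ge_zero power2_abs power2_eq_imp_eq)
qed

text \<open>
  Projections are only known to satisfy two-sided quadratic bounds; these suffice for differentiability.
\<close>

lemma DERIV_of_quadratic_bound:
  fixes F :: "real \<Rightarrow> real"
  assumes "\<And>s. \<bar>F s - F t - (s - t) * D\<bar> \<le> K * (s - t)\<^sup>2"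
  shows "(F has_real_derivative D) (at t)"
  unfolding has_field_derivative_iff
proof (rule LIM_zero_cancel, rule Lim_null_comparison)
  show "((\<lambda>s. K * \<bar>s - t\<bar>) \<longlongrightarrow> 0) (at t)"
    by (rule tendsto_eq_intros refl | simp)+
  have "\<bar>(F s - F t) / (s - t) - D\<bar> \<le> K * \<bar>s - t\<bar>" if "s \<noteq> t" for s
  proof -
    have "(F s - F t) / (s - t) - D = (F s - F t - (s - t) * D) / (s - t)"
      using that by (simp add: field_simps)
    also have "\<bar>\<dots>\<bar> \<le> K * (s - t)\<^sup>2 / \<bar>s - t\<bar>"
      unfolding abs_divide using assms by (intro divide_right_mono) auto
    also have "\<dots> = K * \<bar>s - t\<bar>"
    proof -
      have e: "K * (s - t)\<^sup>2 = (K * \<bar>s - t\<bar>) * \<bar>s - t\<bar>" by (simp add: power2_eq_square)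
      show ?thesis unfolding e using that by (intro nonzero_mult_div_cancel_right) simp
    qed
    finally show ?thesis .
  qed
  then show "\<forall>\<^sub>F s in at t. norm ((F s - F t) / (s - t) - D) \<le> K * \<bar>s - t\<bar>"
    by (auto simp: eventually_at_filter)
qed

lemma continuous_of_lipschitz_bound:
  fixes F :: "real \<Rightarrow> real"
  assumes "\<And>s t. \<bar>F s - F t\<bar> \<le> K * \<bar>s - t\<bar>"
  shows "continuous_on UNIV F"
proof -
  have "K \<ge> 0" using assms[of 1 0] by simp
  then have "K-lipschitz_on UNIV F"
    using assms by (intro lipschitz_onI) (auto simp: dist_real_def)
  then show ?thesis by (rule lipschitz_on_continuous_on)
qed

text \<open>
  The form in which the Poincare inequality is used: a function whose gradient has norm at most 1.
\<close>

lemma gauss_variance_le_1: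
  fixes f :: "(nat \<Rightarrow> real) \<Rightarrow> real" and g :: "nat \<Rightarrow> (nat \<Rightarrow> real) \<Rightarrow> real"
  assumes fin: "finite I"
    and f: "f \<in> borel_measurable (gauss_vec I)"
    and g: "\<And>j. j \<in> I \<Longrightarrow> g j \<in> borel_measurable (gauss_vec I)"
    and growth: "\<And>x. \<bar>f x\<bar> \<le> A + L2_set x I"
    and g1: "\<And>x. (\<Sum>j\<in>I. (g j x)\<^sup>2) \<le> 1"
    and df: "\<And>j x t. j \<in> I \<Longrightarrow> ((\<lambda>t. f (x(j := t))) has_real_derivative g j (x(j := t))) (at t)"
    and cg: "\<And>j x. j \<in> I \<Longrightarrow> continuous_on UNIV (\<lambda>t. g j (x(j := t)))"
  shows "integrable (gauss_vec I) f" "integrable (gauss_vec I) (\<lambda>x. (f x)\<^sup>2)"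
    and "(\<integral>x. (f x)\<^sup>2 \<partial>gauss_vec I) - (\<integral>x. f x \<partial>gauss_vec I)\<^sup>2 \<le> 1"
proof -
  interpret prob_space "gauss_vec I" by (rule prob_space_gauss_vec)
  show f2: "integrable (gauss_vec I) (\<lambda>x. (f x)\<^sup>2)"
  proof (rule integrable_gauss_vec_quadratic)
    fix x
    have "(f x)\<^sup>2 \<le> (A + L2_set x I)\<^sup>2"
      using power_mono[OF growth[of x], of 2] by simp
    also have "\<dots> \<le> 2 * A\<^sup>2 + 2 * (L2_set x I)\<^sup>2" by (rule square_add_le)
    finally show "\<bar>(f x)\<^sup>2\<bar> \<le> 2 * A\<^sup>2 + 2 * (\<Sum>i\<in>I. (x i)\<^sup>2)"
      by (simp add: L2_set_square_sum)
  qed (use f in simp)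
  show "integrable (gauss_vec I) f"
    by (rule square_integrable_imp_integrable[OF f f2])
  have gb: "(g j x)\<^sup>2 \<le> 1" if "j \<in> I" for j x
    by (rule order_trans[OF member_le_sum[of j I "\<lambda>j. (g j x)\<^sup>2"] g1]) (use that fin in auto)
  have gi: "integrable (gauss_vec I) (\<lambda>x. (g j x)\<^sup>2)" if j: "j \<in> I" for j
  proof (rule integrable_const_bound[where B=1])
    show "AE x in gauss_vec I. norm ((g j x)\<^sup>2) \<le> 1"
      using gb[OF j] by simp
    show "(\<lambda>x. (g j x)\<^sup>2) \<in> borel_measurable (gauss_vec I)"
      using g[OF j] by simp
  qed
  have "(\<integral>x. (f x)\<^sup>2 \<partial>gauss_vec I) - (\<integral>x. f x \<partial>gauss_vec I)\<^sup>2 \<le> (\<Sum>j\<in>I. \<integral>x. (g j x)\<^sup>2 \<partial>gauss_vec I)"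
  proof (rule gauss_poincare[where A=A and B=1 and K=1])
    show "\<bar>f x\<bar> \<le> A + 1 * (\<Sum>j\<in>I. \<bar>x j\<bar>)" for x
      using growth[of x] L2_set_le_sum_abs[of x I] by simp
    show "\<bar>g j x\<bar> \<le> 1" if "j \<in> I" for j x
      using gb[OF that, of x] by (simp add: abs_square_le_1)
  qed (use fin f g df cg in auto)
  also have "\<dots> = (\<integral>x. (\<Sum>j\<in>I. (g j x)\<^sup>2) \<partial>gauss_vec I)"
    by (rule Bochner_Integration.integral_sum[symmetric]) (rule gi)
  also have "\<dots> \<le> (\<integral>x. 1 \<partial>gauss_vec I)"
    by (intro integral_mono Bochner_Integration.integrable_sum gi g1) auto
  also have "\<dots> = 1" by (simp add: prob_space)
  finally show "(\<integral>x. (f x)\<^sup>2 \<partial>gauss_vec I) - (\<integral>x. f x \<partial>gauss_vec I)\<^sup>2 \<le> 1" .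
qed

text \<open>
  Vectors are functions on the naturals of which only the coordinates in \<open>I\<close> matter. Accordingly
  \<open>A\<close> is convex only up to the other coordinates.
\<close>

locale convex_projection =
  fixes I :: "nat set" and A :: "(nat \<Rightarrow> real) set" and P :: "(nat \<Rightarrow> real) \<Rightarrow> nat \<Rightarrow> real"
  assumes fin: "finite I"
    and convex: "a \<in> A \<Longrightarrow> b \<in> A \<Longrightarrow> 0 \<le> u \<Longrightarrow> u \<le> 1 \<Longrightarrow> \<exists>c\<in>A. \<forall>i\<in>I. c i = a i + u * (b i - a i)"
    and P_in: "P z \<in> A"
    and P_min: "a \<in> A \<Longrightarrow> L2_set (\<lambda>i. z i - P z i) I \<le> L2_set (\<lambda>i. z i - a i) I"
begin

definition energy :: "(nat \<Rightarrow> real) \<Rightarrow> real" where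
  "energy z = (L2_set (\<lambda>i. z i - P z i) I)\<^sup>2 / 2"

lemma P_min_ip: "a \<in> A \<Longrightarrow> ip I (\<lambda>i. z i - P z i) (\<lambda>i. z i - P z i) \<le> ip I (\<lambda>i. z i - a i) (\<lambda>i. z i - a i)"
  using power_mono[OF P_min[of a z], of 2] by (simp add: L2_set_square)

lemma variational:
  assumes a: "a \<in> A"
  shows "ip I (\<lambda>i. z i - P z i) (\<lambda>i. a i - P z i) \<le> 0"
proof (rule ccontr)
  let ?v = "\<lambda>i. a i - P z i" and ?r = "\<lambda>i. z i - P z i"
  let ?g = "ip I ?r ?v" and ?q = "ip I ?v ?v"
  assume "\<not> ?g \<le> 0"
  then have g: "?g > 0" by simp
  have key: "2 * ?g \<le> u * ?q" if u: "0 < u" "u \<le> 1" for u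
  proof -
    obtain c where c: "c \<in> A" "\<forall>i\<in>I. c i = P z i + u * ?v i"
      using convex[OF P_in a, of u z] u by auto
    have "ip I ?r ?r \<le> ip I (\<lambda>i. z i - c i) (\<lambda>i. z i - c i)"
      by (rule P_min_ip[OF c(1)])
    also have "\<dots> = ip I (\<lambda>i. ?r i - u * ?v i) (\<lambda>i. ?r i - u * ?v i)"
      using c(2) by (intro ip_cong) auto
    also have "\<dots> = ip I ?r ?r - 2 * u * ?g + u * (u * ?q)"
      using ip_commute[of I ?v ?r]
      unfolding ip_diff_left[of I ?r "\<lambda>i. u * ?v i"] ip_diff_right[of I _ ?r "\<lambda>i. u * ?v i"]
        ip_scale_left[of I u ?v] ip_scale_right[of I _ u ?v]
      by (simp add: algebra_simps)
    finally have "u * (2 * ?g) \<le> u * (u * ?q)" by simp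
    then show ?thesis using u by simp
  qed
  have "?q \<ge> 0" by (rule ip_self_nonneg)
  then have "0 < ?g / (?q + ?g)" "?g / (?q + ?g) \<le> 1" using g by auto
  from key[OF this] have "2 * ?g \<le> ?g * (?q / (?q + ?g))" by simp
  also have "\<dots> \<le> ?g * 1"
    using g \<open>?q \<ge> 0\<close> by (intro mult_left_mono) auto
  finally show False using g by simp
qed

lemma firmly_nonexpansive:
  "ip I (\<lambda>i. P x i - P y i) (\<lambda>i. P x i - P y i) \<le> ip I (\<lambda>i. x i - y i) (\<lambda>i. P x i - P y i)"
  using variational[OF P_in, of x y] variational[OF P_in, of y x]
    ip_commute[of I "P x" "P y"] ip_commute[of I x "P x"] ip_commute[of I x "P y"]
    ip_commute[of I y "P x"] ip_commute[of I y "P y"]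
  by (simp add: ip_simps algebra_simps)

lemma nonexpansive: "L2_set (\<lambda>i. P x i - P y i) I \<le> L2_set (\<lambda>i. x i - y i) I"
proof -
  let ?p = "L2_set (\<lambda>i. P x i - P y i) I" and ?d = "L2_set (\<lambda>i. x i - y i) I"
  have "?p * ?p \<le> ?d * ?p"
    using firmly_nonexpansive[of x y] ip_le[of I "\<lambda>i. x i - y i" "\<lambda>i. P x i - P y i"]
    by (simp add: L2_set_square[symmetric] power2_eq_square)
  then show ?thesis
    using L2_set_nonneg[of "\<lambda>i. P x i - P y i" I] by (cases "?p = 0") auto
qed

lemma ip_nonexpansive: "ip I (\<lambda>i. x i - y i) (\<lambda>i. P x i - P y i) \<le> ip I (\<lambda>i. x i - y i) (\<lambda>i. x i - y i)"
proof -
  have "ip I (\<lambda>i. x i - y i) (\<lambda>i. P x i - P y i)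
    \<le> L2_set (\<lambda>i. x i - y i) I * L2_set (\<lambda>i. P x i - P y i) I" by (rule ip_le)
  also have "\<dots> \<le> L2_set (\<lambda>i. x i - y i) I * L2_set (\<lambda>i. x i - y i) I"
    by (intro mult_left_mono nonexpansive) simp
  finally show ?thesis by (simp add: L2_set_square[symmetric] power2_eq_square)
qed

lemma residual_nonexpansive:
  "L2_set (\<lambda>i. (x i - P x i) - (y i - P y i)) I \<le> L2_set (\<lambda>i. x i - y i) I"
proof (rule power2_le_imp_le)
  let ?d = "\<lambda>i. x i - y i" and ?p = "\<lambda>i. P x i - P y i"
  have "(L2_set (\<lambda>i. (x i - P x i) - (y i - P y i)) I)\<^sup>2 = ip I (\<lambda>i. ?d i - ?p i) (\<lambda>i. ?d i - ?p i)"
    unfolding L2_set_square by (intro ip_cong) auto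
  also have "\<dots> = ip I ?d ?d - 2 * ip I ?d ?p + ip I ?p ?p"
    using ip_commute[of I ?p ?d] unfolding ip_diff_left[of I ?d ?p] ip_diff_right[of I _ ?d ?p] by simp
  also have "\<dots> \<le> ip I ?d ?d"
    using firmly_nonexpansive[of x y] ip_self_nonneg[of I ?p] by linarith
  finally show "(L2_set (\<lambda>i. (x i - P x i) - (y i - P y i)) I)\<^sup>2 \<le> (L2_set ?d I)\<^sup>2"
    by (simp add: L2_set_square)
qed simp

text \<open>
  Half the squared distance has gradient \<open>x - P x\<close>, with a quadratic error bound: the upper estimate
  compares \<open>y\<close> with the point \<open>P x\<close> of \<open>A\<close>, the lower one \<open>x\<close> with \<open>P y\<close>, and firm nonexpansiveness
  relates the gradients at the two points.
\<close>

lemma energy_expansion: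
  "\<bar>energy y - energy x - ip I (\<lambda>i. y i - x i) (\<lambda>i. x i - P x i)\<bar> \<le> ip I (\<lambda>i. y i - x i) (\<lambda>i. y i - x i) / 2"
proof -
  let ?d = "\<lambda>i. y i - x i" and ?rx = "\<lambda>i. x i - P x i" and ?ry = "\<lambda>i. y i - P y i"
  have "2 * energy y \<le> ip I (\<lambda>i. y i - P x i) (\<lambda>i. y i - P x i)"
    using P_min_ip[OF P_in, of y x] by (simp add: energy_def L2_set_square)
  also have "\<dots> = ip I (\<lambda>i. ?d i + ?rx i) (\<lambda>i. ?d i + ?rx i)"
    by (intro ip_cong) auto
  also have "\<dots> = ip I ?d ?d + 2 * ip I ?d ?rx + ip I ?rx ?rx"
    using ip_commute[of I ?rx ?d] unfolding ip_add_left[of I ?d ?rx] ip_add_right[of I _ ?d ?rx] by simp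
  finally have 1: "2 * energy y \<le> ip I ?d ?d + 2 * ip I ?d ?rx + 2 * energy x"
    by (simp add: energy_def L2_set_square)
  have "2 * energy x \<le> ip I (\<lambda>i. x i - P y i) (\<lambda>i. x i - P y i)"
    using P_min_ip[OF P_in, of x y] by (simp add: energy_def L2_set_square)
  also have "\<dots> = ip I (\<lambda>i. ?ry i - ?d i) (\<lambda>i. ?ry i - ?d i)"
    by (intro ip_cong) auto
  also have "\<dots> = ip I ?ry ?ry - 2 * ip I ?d ?ry + ip I ?d ?d"
    using ip_commute[of I ?ry ?d] unfolding ip_diff_left[of I ?ry ?d] ip_diff_right[of I _ ?ry ?d] by simp
  finally have 2: "2 * energy x \<le> 2 * energy y - 2 * ip I ?d ?ry + ip I ?d ?d"
    by (simp add: energy_def L2_set_square)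
  have "ip I ?d ?ry - ip I ?d ?rx = ip I ?d ?d - ip I ?d (\<lambda>i. P y i - P x i)"
    by (simp add: ip_simps)
  with ip_nonexpansive[of y x] have "ip I ?d ?rx \<le> ip I ?d ?ry" by simp
  with 1 2 show ?thesis unfolding abs_le_iff by linarith
qed

lemma energy_coordinate_deriv:
  assumes j: "j \<in> I"
  shows "((\<lambda>t. energy (x(j := t))) has_real_derivative (x(j := t)) j - P (x(j := t)) j) (at t)"
proof (rule DERIV_of_quadratic_bound[where K="1 / 2"])
  fix s
  show "\<bar>energy (x(j := s)) - energy (x(j := t)) - (s - t) * ((x(j := t)) j - P (x(j := t)) j)\<bar> \<le> 1 / 2 * (s - t)\<^sup>2"
    using energy_expansion[of "x(j := s)" "x(j := t)"]
    unfolding ip_fun_upd_diff[OF fin j] by (simp add: power2_eq_square)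
qed

lemma P_coord_lipschitz: "j \<in> I \<Longrightarrow> \<bar>P x j - P y j\<bar> \<le> 1 * L2_set (\<lambda>i. x i - y i) I"
  using abs_le_L2_set[OF fin, of j "\<lambda>i. P x i - P y i"] nonexpansive[of x y] by simp

lemma residual_coord_lipschitz: "j \<in> I \<Longrightarrow> \<bar>(x j - P x j) - (y j - P y j)\<bar> \<le> 1 * L2_set (\<lambda>i. x i - y i) I"
  using abs_le_L2_set[OF fin, of j "\<lambda>i. (x i - P x i) - (y i - P y i)"] residual_nonexpansive[of x y] by simp

lemma distance_lipschitz:
  "\<bar>L2_set (\<lambda>i. x i - P x i) I - L2_set (\<lambda>i. y i - P y i) I\<bar> \<le> 1 * L2_set (\<lambda>i. x i - y i) I"
  using abs_L2_set_diff[of "\<lambda>i. x i - P x i" I "\<lambda>i. y i - P y i"] residual_nonexpansive[of x y] by simp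

lemma distance_measurable: "(\<lambda>z. L2_set (\<lambda>i. z i - P z i) I) \<in> borel_measurable (gauss_vec I)"
  by (rule lipschitz_measurable_gauss_vec[OF distance_lipschitz fin])

lemma residual_coord_measurable: "j \<in> I \<Longrightarrow> (\<lambda>z. z j - P z j) \<in> borel_measurable (gauss_vec I)"
  by (rule lipschitz_measurable_gauss_vec[OF residual_coord_lipschitz fin])

lemma energy_measurable: "energy \<in> borel_measurable (gauss_vec I)"
  unfolding energy_def[abs_def] using distance_measurable by simp

text \<open>
  A smooth version of the distance \<open>d\<close> to \<open>A\<close>, namely \<open>sqrt (1 + d\<^sup>2)\<close>; \<open>d\<close> itself is not
  differentiable on the boundary of \<open>A\<close>.
\<close>

definition soft_dist :: "(nat \<Rightarrow> real) \<Rightarrow> real" where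
  "soft_dist z = sqrt (1 + 2 * energy z)"

lemma energy_nonneg: "0 \<le> energy z"
  by (simp add: energy_def)

lemma soft_dist_square: "(soft_dist z)\<^sup>2 = 1 + (L2_set (\<lambda>i. z i - P z i) I)\<^sup>2"
  using energy_nonneg[of z] by (simp add: soft_dist_def) (simp add: energy_def)

lemma soft_dist_ge_1: "1 \<le> soft_dist z"
  using energy_nonneg[of z] by (simp add: soft_dist_def)

lemma soft_dist_le: "soft_dist z \<le> 1 + L2_set (\<lambda>i. z i - P z i) I"
  unfolding soft_dist_def
  by (rule real_le_lsqrt) (auto simp: energy_def power2_eq_square algebra_simps add_nonneg_nonneg)

lemma soft_dist_variance:
  shows "integrable (gauss_vec I) soft_dist" "integrable (gauss_vec I) (\<lambda>x. (soft_dist x)\<^sup>2)"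
    and "(\<integral>x. (soft_dist x)\<^sup>2 \<partial>gauss_vec I) - (\<integral>x. soft_dist x \<partial>gauss_vec I)\<^sup>2 \<le> 1"
proof -
  define g where "g j x = (x j - P x j) / soft_dist x" for j x
  have f: "soft_dist \<in> borel_measurable (gauss_vec I)"
    unfolding soft_dist_def[abs_def] using energy_measurable by measurable
  have g: "g j \<in> borel_measurable (gauss_vec I)" if "j \<in> I" for j
    unfolding g_def[abs_def] using residual_coord_measurable[OF that] f by measurable
  have growth: "\<bar>soft_dist x\<bar> \<le> (1 + L2_set (\<lambda>i. 0 - P (\<lambda>_. 0) i) I) + L2_set x I" for x
    using soft_dist_le[of x] soft_dist_ge_1[of x] distance_lipschitz[of x "\<lambda>_. 0"] by simp
  have g1: "(\<Sum>j\<in>I. (g j x)\<^sup>2) \<le> 1" for x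
  proof -
    have "(\<Sum>j\<in>I. (g j x)\<^sup>2) = (L2_set (\<lambda>i. x i - P x i) I)\<^sup>2 / (soft_dist x)\<^sup>2"
      by (simp add: g_def power_divide sum_divide_distrib[symmetric] L2_set_square_sum)
    also have "\<dots> \<le> 1"
    proof -
      have "0 < (soft_dist x)\<^sup>2" using soft_dist_ge_1[of x] by simp
      then show ?thesis using soft_dist_square[of x] by (simp add: divide_le_eq_1)
    qed
    finally show ?thesis .
  qed
  have df: "((\<lambda>t. soft_dist (x(j := t))) has_real_derivative g j (x(j := t))) (at t)" if j: "j \<in> I" for j x t
  proof -
    have pos: "0 < 1 + 2 * energy (x(j := t))" using energy_nonneg[of "x(j := t)"] by linarith
    have "((\<lambda>t. 1 + 2 * energy (x(j := t))) has_real_derivative 2 * ((x(j := t)) j - P (x(j := t)) j)) (at t)"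
      by (rule derivative_eq_intros energy_coordinate_deriv[OF j] refl | simp)+
    then have d: "((\<lambda>t. sqrt (1 + 2 * energy (x(j := t)))) has_real_derivative
        (inverse (sqrt (1 + 2 * energy (x(j := t)))) / 2) * (2 * ((x(j := t)) j - P (x(j := t)) j))) (at t)"
      by (rule DERIV_chain2[where f=sqrt and g="\<lambda>t. 1 + 2 * energy (x(j := t))", OF DERIV_real_sqrt[OF pos]])
    have e: "(inverse a / 2) * (2 * b) = b / a" for a b :: real
      by (simp add: inverse_eq_divide)
    show ?thesis
      unfolding g_def soft_dist_def using d unfolding e .
  qed
  have cs: "continuous_on UNIV (\<lambda>t. soft_dist (x(j := t)))" if j: "j \<in> I" for j x
    by (intro continuous_at_imp_continuous_on ballI DERIV_isCont[OF df[OF j]])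
  have cr: "continuous_on UNIV (\<lambda>t. (x(j := t)) j - P (x(j := t)) j)" if j: "j \<in> I" for j x
  proof (rule continuous_of_lipschitz_bound[where K=1])
    show "\<bar>(x(j := s)) j - P (x(j := s)) j - ((x(j := t)) j - P (x(j := t)) j)\<bar> \<le> 1 * \<bar>s - t\<bar>" for s t
      using residual_coord_lipschitz[OF j, of "x(j := s)" "x(j := t)"]
      unfolding L2_set_fun_upd_diff[OF fin j] .
  qed
  have cg: "continuous_on UNIV (\<lambda>t. g j (x(j := t)))" if j: "j \<in> I" for j x
  proof -
    have "soft_dist y \<noteq> 0" for y using soft_dist_ge_1[of y] by auto
    then show ?thesis unfolding g_def by (intro continuous_on_divide cr cs j) blast
  qed
  note * = gauss_variance_le_1[OF fin f g growth g1 df cg]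
  show "integrable (gauss_vec I) soft_dist" "integrable (gauss_vec I) (\<lambda>x. (soft_dist x)\<^sup>2)"
    "(\<integral>x. (soft_dist x)\<^sup>2 \<partial>gauss_vec I) - (\<integral>x. soft_dist x \<partial>gauss_vec I)\<^sup>2 \<le> 1"
    by (rule *; assumption)+
qed

text \<open>
  For a cone this is half the squared norm of the projection; in general its gradient is the projection
  \<open>P\<close>.
\<close>

definition proj_energy :: "(nat \<Rightarrow> real) \<Rightarrow> real" where
  "proj_energy z = ip I z z / 2 - energy z"

lemma proj_energy_expansion:
  "0 \<le> proj_energy y - proj_energy x - ip I (\<lambda>i. y i - x i) (P x)"
  "proj_energy y - proj_energy x - ip I (\<lambda>i. y i - x i) (P x) \<le> ip I (\<lambda>i. y i - x i) (\<lambda>i. y i - x i)"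
  using energy_expansion[of y x] ip_commute[of I x y]
  unfolding proj_energy_def abs_le_iff by (simp_all add: ip_simps field_simps)

text \<open>
  The linear functional \<open>\<langle>P z, b\<rangle>\<close> of the projection is Lipschitz but not differentiable. The difference
  quotient of \<open>proj_energy\<close> in direction \<open>b\<close> with step \<open>1 / (4 * V)\<close> is differentiable, has gradient of norm
  at most 1 by nonexpansiveness, and differs from \<open>\<langle>P z, b\<rangle> / V\<close> by at most the step times \<open>V\<close>.
\<close>

lemma projection_component_variance:
  assumes V: "V > 0" "(L2_set b I)\<^sup>2 = V\<^sup>2"
  obtains \<phi> where "integrable (gauss_vec I) \<phi>" "integrable (gauss_vec I) (\<lambda>x. (\<phi> x)\<^sup>2)"
    "(\<integral>x. (\<phi> x)\<^sup>2 \<partial>gauss_vec I) - (\<integral>x. \<phi> x \<partial>gauss_vec I)\<^sup>2 \<le> 1"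
    "\<And>z. \<bar>\<phi> z - ip I (P z) b / V\<bar> \<le> 1 / 4"
proof -
  \<comment> \<open>The step of the difference quotient; its size times \<open>V\<close> is the approximation error.\<close>
  define h where "h = 1 / (4 * V)"
  have h: "h > 0" "h * V = 1 / 4" using V by (auto simp: h_def)
  define sh where "sh x i = x i + h * b i" for x :: "nat \<Rightarrow> real" and i
  define \<phi> where "\<phi> x = (proj_energy (sh x) - proj_energy x) / (h * V)" for x
  define g where "g j x = (P (sh x) j - P x j) / (h * V)" for j x
  have bb: "ip I b b = V\<^sup>2" using V by (simp add: L2_set_square)
  have Lb: "L2_set b I = V"
    using V by (metis L2_set_nonneg less_imp_le power2_eq_imp_eq)
  have approx: "\<bar>\<phi> z - ip I (P z) b / V\<bar> \<le> 1 / 4" for z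
  proof -
    have d: "(\<lambda>i. sh z i - z i) = (\<lambda>i. h * b i)" by (simp add: sh_def fun_eq_iff)
    define e where "e = proj_energy (sh z) - proj_energy z - h * ip I (P z) b"
    have e: "0 \<le> e" "e \<le> h * (h * V\<^sup>2)"
      using proj_energy_expansion[where y="sh z" and x=z] unfolding e_def d
      by (simp_all add: ip_simps bb ip_commute[of I b "P z"])
    have "\<phi> z - ip I (P z) b / V = e / (h * V)"
      using h V by (simp add: \<phi>_def e_def field_simps)
    moreover have "0 \<le> e / (h * V)" using e h by simp
    moreover have "e / (h * V) \<le> h * (h * V\<^sup>2) / (h * V)"
      using e h V by (intro divide_right_mono) auto
    moreover have "h * (h * V\<^sup>2) / (h * V) = h * V" using h V by (simp add: power2_eq_square)
    ultimately show ?thesis using h by simp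
  qed
  have shd: "(\<lambda>i. sh x i - sh y i) = (\<lambda>i. x i - y i)" for x y
    by (simp add: sh_def fun_eq_iff)
  have shlip: "\<bar>(P (sh x) j - P x j) - (P (sh y) j - P y j)\<bar> \<le> 2 * L2_set (\<lambda>i. x i - y i) I" if "j \<in> I" for x y j
    using P_coord_lipschitz[OF that, of "sh x" "sh y"] P_coord_lipschitz[OF that, of x y] unfolding shd by linarith
  have shift_m: "(\<lambda>z. energy (sh z)) \<in> borel_measurable (gauss_vec I)"
  proof -
    have "(\<lambda>z. L2_set (\<lambda>i. sh z i - P (sh z) i) I) \<in> borel_measurable (gauss_vec I)"
    proof (rule lipschitz_measurable_gauss_vec[OF _ fin])
      show "\<bar>L2_set (\<lambda>i. sh x i - P (sh x) i) I - L2_set (\<lambda>i. sh y i - P (sh y) i) I\<bar> \<le> 1 * L2_set (\<lambda>i. x i - y i) I" for x y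
        using distance_lipschitz[of "sh x" "sh y"] unfolding shd .
    qed
    then show ?thesis unfolding energy_def by simp
  qed
  have f: "\<phi> \<in> borel_measurable (gauss_vec I)"
    unfolding \<phi>_def[abs_def] proj_energy_def ip_def sh_def[of _ "_::nat"]
    using shift_m[unfolded sh_def[abs_def]] energy_measurable
    by (intro borel_measurable_divide borel_measurable_diff borel_measurable_sum borel_measurable_times
        borel_measurable_add borel_measurable_const measurable_component_singleton)
       (auto simp: sh_def[abs_def])
  have g: "g j \<in> borel_measurable (gauss_vec I)" if "j \<in> I" for j
    unfolding g_def[abs_def]
    by (intro borel_measurable_divide lipschitz_measurable_gauss_vec[OF shlip[OF that] fin]) simp
  have growth: "\<bar>\<phi> x\<bar> \<le> (1 / 4 + L2_set (P (\<lambda>_. 0)) I) + L2_set x I" for x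
  proof -
    have "\<bar>ip I (P x) b / V\<bar> \<le> L2_set (P x) I * L2_set b I / V"
      using abs_ip_le[of I "P x" b] V(1) Lb by (simp add: abs_divide pos_divide_le_eq)
    also have "\<dots> = L2_set (P x) I" using Lb V by simp
    also have "\<dots> \<le> L2_set (\<lambda>i. P x i - P (\<lambda>_. 0) i) I + L2_set (P (\<lambda>_. 0)) I"
      by (rule L2_set_diff_triangle)
    also have "L2_set (\<lambda>i. P x i - P (\<lambda>_. 0) i) I \<le> L2_set x I"
      using nonexpansive[of x "\<lambda>_. 0"] by simp
    finally show ?thesis using approx[of x] by linarith
  qed
  have g1: "(\<Sum>j\<in>I. (g j x)\<^sup>2) \<le> 1" for x
  proof -
    have "(\<Sum>j\<in>I. (g j x)\<^sup>2) = (L2_set (\<lambda>i. P (sh x) i - P x i) I)\<^sup>2 / (h * V)\<^sup>2"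
      by (simp add: g_def power_divide sum_divide_distrib[symmetric] L2_set_square_sum)
    also have "\<dots> \<le> (L2_set (\<lambda>i. sh x i - x i) I)\<^sup>2 / (h * V)\<^sup>2"
      by (intro divide_right_mono power_mono nonexpansive) auto
    also have "(\<lambda>i. sh x i - x i) = (\<lambda>i. h * b i)" by (simp add: sh_def fun_eq_iff)
    also have "(L2_set (\<lambda>i. h * b i) I)\<^sup>2 / (h * V)\<^sup>2 = 1"
      unfolding L2_set_square using h V by (simp add: ip_simps bb power2_eq_square)
    finally show ?thesis .
  qed
  have df: "((\<lambda>t. \<phi> (x(j := t))) has_real_derivative g j (x(j := t))) (at t)" if j: "j \<in> I" for j x t
    unfolding \<phi>_def g_def
  proof (rule DERIV_cdivide, rule DERIV_of_quadratic_bound[where K=1])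
    fix s
    let ?y = "x(j := s)" and ?x = "x(j := t)"
    have i: "ip I (\<lambda>i. ?y i - ?x i) w = (s - t) * w j" for w
      by (rule ip_fun_upd_diff[OF fin j])
    have dd: "ip I (\<lambda>i. ?y i - ?x i) (\<lambda>i. ?y i - ?x i) = (s - t)\<^sup>2"
      unfolding i by (simp add: power2_eq_square)
    have 1: "0 \<le> proj_energy (sh ?y) - proj_energy (sh ?x) - (s - t) * P (sh ?x) j"
      "proj_energy (sh ?y) - proj_energy (sh ?x) - (s - t) * P (sh ?x) j \<le> (s - t)\<^sup>2"
      using proj_energy_expansion[where y="sh ?y" and x="sh ?x"] unfolding shd dd unfolding i by simp_all
    have 2: "0 \<le> proj_energy ?y - proj_energy ?x - (s - t) * P ?x j"
      "proj_energy ?y - proj_energy ?x - (s - t) * P ?x j \<le> (s - t)\<^sup>2"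
      using proj_energy_expansion[where y="?y" and x="?x"] unfolding dd unfolding i by simp_all
    show "\<bar>proj_energy (sh ?y) - proj_energy ?y - (proj_energy (sh ?x) - proj_energy ?x)
      - (s - t) * (P (sh ?x) j - P ?x j)\<bar> \<le> 1 * (s - t)\<^sup>2"
      unfolding right_diff_distrib abs_le_iff using 1 2 by linarith
  qed
  have cg: "continuous_on UNIV (\<lambda>t. g j (x(j := t)))" if j: "j \<in> I" for j x
    unfolding g_def
  proof (rule continuous_on_divide[OF continuous_of_lipschitz_bound[where K=2]])
    show "\<bar>P (sh (x(j := s))) j - P (x(j := s)) j - (P (sh (x(j := t))) j - P (x(j := t)) j)\<bar> \<le> 2 * \<bar>s - t\<bar>" for s t
      using shlip[OF j, of "x(j := s)" "x(j := t)"] unfolding L2_set_fun_upd_diff[OF fin j] .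
  qed (use h V in auto)
  show thesis
  proof (rule that[OF _ _ _ approx])
    show "integrable (gauss_vec I) \<phi>"
      by (rule gauss_variance_le_1(1)[OF fin f g growth g1 df cg]; assumption)
    show "integrable (gauss_vec I) (\<lambda>x. (\<phi> x)\<^sup>2)"
      by (rule gauss_variance_le_1(2)[OF fin f g growth g1 df cg]; assumption)
    show "(\<integral>x. (\<phi> x)\<^sup>2 \<partial>gauss_vec I) - (\<integral>x. \<phi> x \<partial>gauss_vec I)\<^sup>2 \<le> 1"
      by (rule gauss_variance_le_1(3)[OF fin f g growth g1 df cg]; assumption)
  qed
qed

end

section \<open>Subgradients of the total variation and the estimator\<close>

lemma summation_by_parts_paths:
  fixes w d :: "nat \<Rightarrow> real"
  assumes "n \<ge> 1"
  shows "(\<Sum>i=1..n. (w (i - 1) - w i) * d i) = (\<Sum>j=1..n - 1. w j * (d (j + 1) - d j)) + w 0 * d 1 - w n * d n"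
  using assms
proof (induction n rule: nat_induct_at_least)
  case base
  then show ?case by (simp add: algebra_simps)
next
  case (Suc n)
  have "(\<Sum>j=1..Suc n - 1. w j * (d (j + 1) - d j)) = (\<Sum>j=1..n - 1. w j * (d (j + 1) - d j)) + w n * (d (n + 1) - d n)"
    using Suc.hyps by (cases n) auto
  then show ?case using Suc by (simp add: algebra_simps)
qed

lemma exists_small_scale:
  fixes a c :: "'a \<Rightarrow> real"
  assumes "finite J" "\<And>j. j \<in> J \<Longrightarrow> c j > 0"
  shows "\<exists>\<epsilon>>0. \<forall>j\<in>J. \<epsilon> * \<bar>a j\<bar> \<le> c j"
  using assms
proof (induction J rule: finite_induct)
  case empty
  show ?case by (intro exI[of _ 1]) auto
next
  case (insert k J)
  then obtain \<epsilon> where e: "\<epsilon> > 0" "\<forall>j\<in>J. \<epsilon> * \<bar>a j\<bar> \<le> c j" by auto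
  have ck: "c k > 0" using insert.prems by simp
  define \<delta> where "\<delta> = c k / (\<bar>a k\<bar> + 1)"
  have d: "\<delta> > 0" using ck by (auto simp: \<delta>_def intro!: divide_pos_pos)
  have dk: "\<delta> * \<bar>a k\<bar> \<le> c k"
  proof -
    have "\<delta> * \<bar>a k\<bar> \<le> \<delta> * (\<bar>a k\<bar> + 1)" using d by (intro mult_left_mono) auto
    also have "\<dots> = c k" by (simp add: \<delta>_def)
    finally show ?thesis .
  qed
  have "min \<epsilon> \<delta> * \<bar>a j\<bar> \<le> c j" if j: "j \<in> insert k J" for j
  proof (cases "j = k")
    case True
    have "min \<epsilon> \<delta> * \<bar>a k\<bar> \<le> \<delta> * \<bar>a k\<bar>" by (intro mult_right_mono) auto
    then show ?thesis using dk True by simp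
  next
    case False
    have "min \<epsilon> \<delta> * \<bar>a j\<bar> \<le> \<epsilon> * \<bar>a j\<bar>" by (intro mult_right_mono) auto
    then show ?thesis using e(2) j False by force
  qed
  then show ?case using e(1) d by (intro exI[of _ "min \<epsilon> \<delta>"]) auto
qed

lemma compact_box_Rn:
  fixes a b :: "nat \<Rightarrow> real"
  shows "compact (PiE {1..n} (\<lambda>i. {a i..b i}))"
proof -
  let ?S = "\<lambda>i. if i \<in> {1..n} then {a i..b i} else {undefined}"
  have "compactin (product_topology (\<lambda>i. euclidean) UNIV) (PiE UNIV ?S)"
    unfolding compactin_PiE by (auto simp: compactin_euclidean_iff)
  then have "compact (PiE UNIV ?S)"
    by (simp add: euclidean_product_topology)
  also have "PiE UNIV ?S = PiE {1..n} (\<lambda>i. {a i..b i})"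
    by (auto simp: PiE_iff extensional_def split: if_splits)
  finally show ?thesis .
qed

lemma continuous_on_vnorm_diff:
  fixes f g :: "'a::topological_space \<Rightarrow> nat \<Rightarrow> real"
  assumes "\<And>i. continuous_on S (\<lambda>p. f p i)" 
  shows "continuous_on S (\<lambda>p. vnorm n (f p))"
  unfolding L2_set_def by (intro continuous_intros assms)

lemma subdifferential_D:
  assumes "v \<in> subdifferential n f \<theta>" "\<eta> \<in> Rn n"
  shows "f \<theta> + ip {1..n} v (\<lambda>i. \<eta> i - \<theta> i) \<le> f \<eta>"
  using assms by (auto simp: subdifferential_def ip_def)

lemma subdifferential_convex:
  assumes v: "v \<in> subdifferential n f \<theta>" "v' \<in> subdifferential n f \<theta>" and u: "0 \<le> u" "u \<le> 1"
  shows "(\<lambda>i\<in>{1..n}. (1 - u) * v i + u * v' i) \<in> subdifferential n f \<theta>"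
proof -
  have "f \<theta> + (\<Sum>i=1..n. (\<lambda>i\<in>{1..n}. (1 - u) * v i + u * v' i) i * (\<eta> i - \<theta> i)) \<le> f \<eta>" if \<eta>: "\<eta> \<in> Rn n" for \<eta>
  proof -
    have "(\<Sum>i=1..n. (\<lambda>i\<in>{1..n}. (1 - u) * v i + u * v' i) i * (\<eta> i - \<theta> i))
      = (1 - u) * ip {1..n} v (\<lambda>i. \<eta> i - \<theta> i) + u * ip {1..n} v' (\<lambda>i. \<eta> i - \<theta> i)"
      by (simp add: ip_def sum_distrib_left sum.distrib distrib_right mult.assoc)
    also have "\<dots> \<le> (1 - u) * (f \<eta> - f \<theta>) + u * (f \<eta> - f \<theta>)"
      using subdifferential_D[OF v(1) \<eta>] subdifferential_D[OF v(2) \<eta>] u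
      by (intro add_mono mult_left_mono) auto
    also have "\<dots> = f \<eta> - f \<theta>" by (simp add: algebra_simps)
    finally show ?thesis by simp
  qed
  then show ?thesis by (auto simp: subdifferential_def Rn_def)
qed

text \<open>
  Testing the subgradient inequality with unit changes of single coordinates bounds each coordinate, so
  the subdifferential is a closed subset of a compact box.
\<close>

lemma subdifferential_compact:
  fixes f :: "(nat \<Rightarrow> real) \<Rightarrow> real"
  assumes \<theta>: "\<theta> \<in> Rn n"
  shows "compact (subdifferential n f \<theta>)"
proof -
  let ?D = "subdifferential n f \<theta>"
  let ?B = "PiE {1..n} (\<lambda>i. {f \<theta> - f (\<theta>(i := \<theta> i - 1))..f (\<theta>(i := \<theta> i + 1)) - f \<theta>})"
  have sub: "?D \<subseteq> ?B"
  proof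
    fix v assume v: "v \<in> ?D"
    have "v i \<in> {f \<theta> - f (\<theta>(i := \<theta> i - 1))..f (\<theta>(i := \<theta> i + 1)) - f \<theta>}" if i: "i \<in> {1..n}" for i
    proof -
      have R: "\<theta>(i := t) \<in> Rn n" for t using \<theta> i by (auto simp: Rn_def PiE_iff extensional_def)
      have "ip {1..n} v (\<lambda>k. (\<theta>(i := t)) k - \<theta> k) = v i * (t - \<theta> i)" for t
      proof -
        have "ip {1..n} v (\<lambda>k. (\<theta>(i := t)) k - \<theta> k) = (\<Sum>k\<in>{1..n}. if k = i then v i * (t - \<theta> i) else 0)"
          unfolding ip_def by (intro sum.cong) auto
        then show ?thesis using i by simp
      qed
      then show ?thesis
        using subdifferential_D[OF v R[of "\<theta> i + 1"]] subdifferential_D[OF v R[of "\<theta> i - 1"]] by simp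
    qed
    moreover have "v \<in> Rn n" using v by (simp add: subdifferential_def)
    ultimately show "v \<in> ?B" by (auto simp: Rn_def PiE_iff)
  qed
  have "?D = ?B \<inter> (\<Inter>\<eta>\<in>Rn n. {v. (\<Sum>i=1..n. v i * (\<eta> i - \<theta> i)) \<le> f \<eta> - f \<theta>})"
  proof (intro equalityI subsetI)
    fix v assume "v \<in> ?D"
    moreover from this have "(\<Sum>i=1..n. v i * (\<eta> i - \<theta> i)) \<le> f \<eta> - f \<theta>" if "\<eta> \<in> Rn n" for \<eta>
      using subdifferential_D[OF _ that, of v f \<theta>] by (simp add: ip_def)
    ultimately show "v \<in> ?B \<inter> (\<Inter>\<eta>\<in>Rn n. {v. (\<Sum>i=1..n. v i * (\<eta> i - \<theta> i)) \<le> f \<eta> - f \<theta>})"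
      using sub by blast
  next
    fix v assume v: "v \<in> ?B \<inter> (\<Inter>\<eta>\<in>Rn n. {v. (\<Sum>i=1..n. v i * (\<eta> i - \<theta> i)) \<le> f \<eta> - f \<theta>})"
    then have "v \<in> Rn n" by (auto simp: Rn_def PiE_iff)
    moreover have "f \<theta> + (\<Sum>i=1..n. v i * (\<eta> i - \<theta> i)) \<le> f \<eta>" if "\<eta> \<in> Rn n" for \<eta>
    proof -
      have "(\<Sum>i=1..n. v i * (\<eta> i - \<theta> i)) \<le> f \<eta> - f \<theta>" using v that by blast
      then show ?thesis by linarith
    qed
    ultimately show "v \<in> ?D" by (simp add: subdifferential_def)
  qed
  moreover have "closed (\<Inter>\<eta>\<in>Rn n. {v. (\<Sum>i=1..n. v i * (\<eta> i - \<theta> i)) \<le> f \<eta> - f \<theta>})"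
    by (intro closed_INT ballI closed_Collect_le continuous_on_sum continuous_on_mult
        continuous_on_const continuous_on_product_coordinates)
  ultimately show ?thesis
    using compact_Int_closed[OF compact_box_Rn] by simp
qed

lemma total_var_nonneg: "0 \<le> total_var n \<theta>"
  by (simp add: total_var_def sum_nonneg)

lemma total_var_cong: "(\<And>i. i \<in> {1..n} \<Longrightarrow> x i = y i) \<Longrightarrow> total_var n x = total_var n y"
  unfolding total_var_def diff_op_def by (intro sum.cong refl) auto

lemma total_var_convex:
  assumes u: "0 \<le> u" "u \<le> 1"
  shows "total_var n (\<lambda>i\<in>{1..n}. x i + u * (y i - x i)) \<le> total_var n x + u * (total_var n y - total_var n x)"
proof -
  have "total_var n (\<lambda>i\<in>{1..n}. x i + u * (y i - x i)) = total_var n (\<lambda>i. x i + u * (y i - x i))"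
    by (rule total_var_cong) auto
  also have "\<dots> \<le> (\<Sum>i=1..n - 1. (1 - u) * \<bar>diff_op x i\<bar> + u * \<bar>diff_op y i\<bar>)"
    unfolding total_var_def
  proof (rule sum_mono)
    fix i
    have "diff_op (\<lambda>i. x i + u * (y i - x i)) i = (1 - u) * diff_op x i + u * diff_op y i"
      by (simp add: diff_op_def algebra_simps)
    also have "\<bar>\<dots>\<bar> \<le> (1 - u) * \<bar>diff_op x i\<bar> + u * \<bar>diff_op y i\<bar>"
      using abs_triangle_ineq[of "(1 - u) * diff_op x i" "u * diff_op y i"] u by (simp add: abs_mult)
    finally show "\<bar>diff_op (\<lambda>i. x i + u * (y i - x i)) i\<bar> \<le> (1 - u) * \<bar>diff_op x i\<bar> + u * \<bar>diff_op y i\<bar>" .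
  qed
  also have "\<dots> = total_var n x + u * (total_var n y - total_var n x)"
    unfolding total_var_def sum.distrib sum_distrib_left[symmetric] by (simp add: algebra_simps)
  finally show ?thesis .
qed

text \<open>
  Outside a box the quadratic term alone exceeds the value of the objective at \<open>y\<close>, and on the box a
  continuous function attains its minimum.
\<close>

lemma tv_estimator_minimizes:
  assumes \<sigma>: "\<sigma> > 0" and l: "l \<ge> 0"
  shows "tv_estimator n \<sigma> l y \<in> Rn n"
    and "\<eta> \<in> Rn n \<Longrightarrow> 1 / 2 * (vnorm n (\<lambda>i. y i - tv_estimator n \<sigma> l y i))\<^sup>2 + \<sigma> * l * total_var n (tv_estimator n \<sigma> l y)
      \<le> 1 / 2 * (vnorm n (\<lambda>i. y i - \<eta> i))\<^sup>2 + \<sigma> * l * total_var n \<eta>"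
proof -
  define J where "J \<theta> = 1 / 2 * (vnorm n (\<lambda>i. y i - \<theta> i))\<^sup>2 + \<sigma> * l * total_var n \<theta>" for \<theta>
  define y0 where "y0 = (\<lambda>i\<in>{1..n}. y i)"
  define c where "c = J y0"
  have y0: "y0 \<in> Rn n" by (auto simp: y0_def Rn_def)
  have pen: "0 \<le> \<sigma> * l * total_var n \<theta>" for \<theta> using \<sigma> l total_var_nonneg by simp
  have c0: "c \<ge> 0" using pen[of y0] by (simp add: c_def J_def)
  let ?B = "PiE {1..n} (\<lambda>i. {y i - sqrt (2 * c)..y i + sqrt (2 * c)})"
  have BR: "?B \<subseteq> Rn n" by (auto simp: Rn_def)
  have coord: "continuous_on S (\<lambda>\<theta>. \<theta> i)" for S :: "(nat \<Rightarrow> real) set" and i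
    by (rule continuous_on_product_then_coordinatewise[OF continuous_on_id])
  have cont: "continuous_on S J" for S
    unfolding J_def total_var_def diff_op_def by (intro continuous_intros continuous_on_vnorm_diff coord)
  have y0B: "y0 \<in> ?B" using c0 by (auto simp: y0_def PiE_iff)
  obtain m where m: "m \<in> ?B" "\<And>\<theta>. \<theta> \<in> ?B \<Longrightarrow> J m \<le> J \<theta>"
    using continuous_attains_inf[OF compact_box_Rn _ cont, of n "\<lambda>i. y i - sqrt (2 * c)" "\<lambda>i. y i + sqrt (2 * c)"] y0B by blast
  have min: "J m \<le> J \<theta>" if "\<theta> \<in> Rn n" for \<theta>
  proof (cases "\<theta> \<in> ?B")
    case False
    moreover have "\<theta> \<in> extensional {1..n}" using that by (simp add: Rn_def PiE_def)
    ultimately obtain i where i: "i \<in> {1..n}" "\<theta> i \<notin> {y i - sqrt (2 * c)..y i + sqrt (2 * c)}"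
      unfolding PiE_iff by blast
    then have "sqrt (2 * c) \<le> \<bar>y i - \<theta> i\<bar>" by auto
    also have "\<dots> \<le> vnorm n (\<lambda>i. y i - \<theta> i)"
      by (rule abs_le_L2_set) (use i in auto)
    finally have "2 * c \<le> (vnorm n (\<lambda>i. y i - \<theta> i))\<^sup>2"
      using c0 power_mono[of "sqrt (2 * c)" _ 2] by fastforce
    then have "c \<le> J \<theta>" using pen[of \<theta>] by (simp add: J_def)
    then show ?thesis using m(2)[OF y0B] by (simp add: c_def)
  qed (use m in simp)
  have "tv_estimator n \<sigma> l y \<in> Rn n \<and> (\<forall>\<eta>\<in>Rn n. J (tv_estimator n \<sigma> l y) \<le> J \<eta>)"
    unfolding tv_estimator_def J_def[symmetric]
  proof (rule arg_minI[of "\<lambda>\<theta>. \<theta> \<in> Rn n" m])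
    show "m \<in> Rn n" using m BR by blast
    show "\<not> J \<theta> < J m" if "\<theta> \<in> Rn n" for \<theta> using min[OF that] by simp
  qed (auto simp: not_less)
  then show "tv_estimator n \<sigma> l y \<in> Rn n"
    "\<eta> \<in> Rn n \<Longrightarrow> 1 / 2 * (vnorm n (\<lambda>i. y i - tv_estimator n \<sigma> l y i))\<^sup>2 + \<sigma> * l * total_var n (tv_estimator n \<sigma> l y)
      \<le> 1 / 2 * (vnorm n (\<lambda>i. y i - \<eta> i))\<^sup>2 + \<sigma> * l * total_var n \<eta>"
    by (auto simp: J_def)
qed

text \<open>
  With \<open>e\<close> the estimator, minimality along the segment from \<open>e\<close> to \<open>\<theta>\<close> says that
  \<open>\<langle>y - e, \<theta> - e\<rangle> \<le> \<sigma> * l * (TV \<theta> - TV e)\<close>, and the subgradient inequality bounds the right-hand side by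
  \<open>\<sigma> * l * \<langle>v, \<theta> - e\<rangle>\<close>. Hence \<open>\<parallel>e - \<theta>\<parallel>\<^sup>2 \<le> \<langle>y - \<theta> - \<sigma> * l * v, e - \<theta>\<rangle>\<close>.
\<close>

lemma tv_estimator_loss_le:
  assumes \<sigma>: "\<sigma> > 0" and l: "l \<ge> 0" and \<theta>: "\<theta> \<in> Rn n" and v: "v \<in> subdifferential n (total_var n) \<theta>"
  shows "vnorm n (\<lambda>i. tv_estimator n \<sigma> l y i - \<theta> i) \<le> vnorm n (\<lambda>i. (y i - \<theta> i) - \<sigma> * l * v i)"
proof -
  define e where "e = tv_estimator n \<sigma> l y"
  let ?I = "{1..n}"
  let ?r = "\<lambda>i. y i - e i" and ?d = "\<lambda>i. \<theta> i - e i"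
  note m = tv_estimator_minimizes[OF \<sigma> l, where n=n and y=y, folded e_def]
  have key: "ip ?I ?r ?d \<le> \<sigma> * l * (total_var n \<theta> - total_var n e) + u * (ip ?I ?d ?d / 2)"
    if u: "0 < u" "u \<le> 1" for u
  proof -
    let ?\<eta> = "\<lambda>i\<in>?I. e i + u * (\<theta> i - e i)"
    have "?\<eta> \<in> Rn n" by (auto simp: Rn_def)
    from m(2)[OF this] have "ip ?I ?r ?r / 2 + \<sigma> * l * total_var n e
      \<le> ip ?I (\<lambda>i. y i - ?\<eta> i) (\<lambda>i. y i - ?\<eta> i) / 2 + \<sigma> * l * total_var n ?\<eta>"
      unfolding L2_set_square by simp
    also have "ip ?I (\<lambda>i. y i - ?\<eta> i) (\<lambda>i. y i - ?\<eta> i) = ip ?I (\<lambda>i. ?r i - u * ?d i) (\<lambda>i. ?r i - u * ?d i)"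
      by (intro ip_cong) auto
    also have "\<dots> = ip ?I ?r ?r - 2 * u * ip ?I ?r ?d + u * (u * ip ?I ?d ?d)"
      using ip_commute[of ?I ?d ?r]
      unfolding ip_diff_left[of ?I ?r "\<lambda>i. u * ?d i"] ip_diff_right[of ?I _ ?r "\<lambda>i. u * ?d i"]
        ip_scale_left[of ?I u ?d] ip_scale_right[of ?I _ u ?d]
      by (simp add: algebra_simps)
    also have "\<sigma> * l * total_var n ?\<eta> \<le> \<sigma> * l * total_var n e + u * (\<sigma> * l * (total_var n \<theta> - total_var n e))"
    proof -
      have "\<sigma> * l * total_var n ?\<eta> \<le> \<sigma> * l * (total_var n e + u * (total_var n \<theta> - total_var n e))"
        using total_var_convex[where u=u and n=n and x=e and y=\<theta>] u \<sigma> l by (intro mult_left_mono) auto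
      then show ?thesis by (simp add: algebra_simps)
    qed
    finally have "u * ip ?I ?r ?d \<le> u * (\<sigma> * l * (total_var n \<theta> - total_var n e)) + u * (u * ip ?I ?d ?d) / 2"
      by (simp add: diff_divide_distrib add_divide_distrib)
    then have "u * ip ?I ?r ?d \<le> u * (\<sigma> * l * (total_var n \<theta> - total_var n e) + u * (ip ?I ?d ?d / 2))"
      unfolding distrib_left[of u] by simp
    then show ?thesis using u by simp
  qed
  have dd0: "ip ?I ?d ?d \<ge> 0" by (rule ip_self_nonneg)
  have lim: "ip ?I ?r ?d \<le> \<sigma> * l * (total_var n \<theta> - total_var n e)"
  proof (rule field_le_epsilon)
    fix \<epsilon> :: real assume \<epsilon>: "\<epsilon> > 0"
    define u where "u = min 1 (\<epsilon> / (ip ?I ?d ?d / 2 + 1))"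
    have "0 < \<epsilon> / (ip ?I ?d ?d / 2 + 1)" using \<epsilon> dd0 by (intro divide_pos_pos) auto
    then have u: "0 < u" "u \<le> 1" by (auto simp: u_def)
    have "u * (ip ?I ?d ?d / 2) \<le> \<epsilon> / (ip ?I ?d ?d / 2 + 1) * (ip ?I ?d ?d / 2 + 1)"
      using dd0 \<epsilon> by (intro mult_mono) (auto simp: u_def)
    also have "\<dots> = \<epsilon>" using dd0 by simp
    finally show "ip ?I ?r ?d \<le> \<sigma> * l * (total_var n \<theta> - total_var n e) + \<epsilon>"
      using key[OF u] by simp
  qed
  have "total_var n \<theta> + ip ?I v (\<lambda>i. e i - \<theta> i) \<le> total_var n e"
    by (rule subdifferential_D[OF v m(1)])
  then have "\<sigma> * l * (total_var n \<theta> - total_var n e) \<le> \<sigma> * l * (- ip ?I v (\<lambda>i. e i - \<theta> i))"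
    using \<sigma> l by (intro mult_left_mono) auto
  with lim have "ip ?I ?r ?d \<le> \<sigma> * l * ip ?I v ?d"
    by (simp add: ip_simps algebra_simps)
  then have "ip ?I (\<lambda>i. e i - \<theta> i) (\<lambda>i. e i - \<theta> i) \<le> ip ?I (\<lambda>i. (y i - \<theta> i) - (\<sigma> * l) * v i) (\<lambda>i. e i - \<theta> i)"
    unfolding ip_diff_left[of ?I "\<lambda>i. y i - \<theta> i" "\<lambda>i. (\<sigma> * l) * v i"] ip_scale_left[of ?I "\<sigma> * l" v]
    by (simp add: ip_simps ip_commute[of ?I e \<theta>] algebra_simps)
  also have "\<dots> \<le> vnorm n (\<lambda>i. (y i - \<theta> i) - (\<sigma> * l) * v i) * vnorm n (\<lambda>i. e i - \<theta> i)"
    by (rule ip_le)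
  finally have "vnorm n (\<lambda>i. e i - \<theta> i) * vnorm n (\<lambda>i. e i - \<theta> i)
    \<le> vnorm n (\<lambda>i. (y i - \<theta> i) - \<sigma> * l * v i) * vnorm n (\<lambda>i. e i - \<theta> i)"
    by (simp add: L2_set_square[symmetric] power2_eq_square)
  then show ?thesis
    unfolding e_def[symmetric] using L2_set_nonneg[of "\<lambda>i. e i - \<theta> i" ?I]
    by (cases "vnorm n (\<lambda>i. e i - \<theta> i) = 0") (simp, rule mult_right_le_imp_le, assumption, linarith)
qed

section \<open>The subdifferential at a signal with jumps\<close>

text \<open>
  The signal \<open>\<theta>\<close> is constant on the \<open>K\<close> pieces with the indices \<open>T p + 1, ..., T (p + 1)\<close>, and \<open>\<sigma> p\<close>
  is the sign of the jump after index \<open>T p\<close>, with value 0 at both ends of the signal. In this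
  form \<open>T p\<close> is the position at which a path of partial sums is constrained.
\<close>

locale jump_pieces =
  fixes n :: nat and \<theta> :: "nat \<Rightarrow> real" and T :: "nat \<Rightarrow> nat" and K :: nat and \<sigma> :: "nat \<Rightarrow> real"
  assumes theta: "\<theta> \<in> Rn n"
    and T0: "T 0 = 0" and TK: "T K = n" and Tmono: "p < K \<Longrightarrow> T p < T (Suc p)" and K2: "K \<ge> 2"
    and flat: "p < K \<Longrightarrow> T p < j \<Longrightarrow> j < T (Suc p) \<Longrightarrow> \<theta> (Suc j) = \<theta> j"
    and sig0: "\<sigma> 0 = 0" and sigK: "\<sigma> K = 0"
    and sig: "0 < p \<Longrightarrow> p < K \<Longrightarrow> \<sigma> p = sgn (\<theta> (Suc (T p)) - \<theta> (T p))"
    and sig_nz: "0 < p \<Longrightarrow> p < K \<Longrightarrow> \<sigma> p \<noteq> 0"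
begin

abbreviation "SD \<equiv> subdifferential n (total_var n) \<theta>"

definition len :: "nat \<Rightarrow> nat" where
  "len p = T (Suc p) - T p"

lemma len_pos: "p < K \<Longrightarrow> len p > 0"
  using Tmono by (simp add: len_def)

lemma T_mono: "p \<le> q \<Longrightarrow> q \<le> K \<Longrightarrow> T p \<le> T q"
proof (induction q rule: dec_induct)
  case (step q)
  then show ?case using Tmono[of q] by simp
qed simp

lemma T_le: "p \<le> K \<Longrightarrow> T p \<le> n"
  using T_mono[of p K] TK by simp

lemma T_inj: "p \<le> K \<Longrightarrow> q \<le> K \<Longrightarrow> T p = T q \<Longrightarrow> p = q"
  using T_mono[of "Suc p" q] T_mono[of "Suc q" p] Tmono[of p] Tmono[of q]
  by (cases p q rule: linorder_cases) auto

lemma n_pos: "n \<ge> 1"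
  using Tmono[of 0] T_le[of 1] T0 K2 by simp

lemma sigma_range: "p \<le> K \<Longrightarrow> \<sigma> p \<in> {- 1, 0, 1}"
  using sig[of p] sig0 sigK by (cases "p = 0 \<or> p = K") (auto simp: sgn_if)

lemma piece_exists:
  assumes "j \<le> n"
  shows "\<exists>p<K. T p \<le> j \<and> j \<le> T (Suc p)"
proof -
  define q where "q = (LEAST q. j \<le> T q \<and> q \<le> K)"
  have q: "j \<le> T q \<and> q \<le> K" unfolding q_def
    by (rule LeastI[of "\<lambda>q. j \<le> T q \<and> q \<le> K" K]) (use assms TK in simp)
  show ?thesis
  proof (cases q)
    case 0
    then show ?thesis using q T0 K2 by (intro exI[of _ 0]) auto
  next
    case (Suc p)
    then have "\<not> j \<le> T p" using not_less_Least[of p "\<lambda>q. j \<le> T q \<and> q \<le> K"] q by (auto simp: q_def)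
    then show ?thesis using q Suc by (intro exI[of _ p]) auto
  qed
qed

lemma knot_or_flat:
  assumes j: "1 \<le> j" "j \<le> n - 1"
  shows "(\<exists>p. 0 < p \<and> p < K \<and> j = T p) \<or> \<theta> (Suc j) = \<theta> j"
proof -
  have "j \<le> n" using j by linarith
  then obtain p where p: "p < K" "T p \<le> j" "j \<le> T (Suc p)" using piece_exists by blast
  consider "j = T p" | "j = T (Suc p)" | "T p < j" "j < T (Suc p)" using p by linarith
  then show ?thesis
  proof cases
    case 1
    then have "p \<noteq> 0" using T0 j by (metis not_one_le_zero)
    then show ?thesis using 1 p by (intro disjI1 exI[of _ p]) simp
  next
    case 2
    then have "Suc p \<noteq> K" using TK j by auto
    then show ?thesis using 2 p by (intro disjI1 exI[of _ "Suc p"]) auto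
  next
    case 3
    then show ?thesis using flat[OF p(1)] by simp
  qed
qed

text \<open>
  Summation by parts turns the pairing with \<open>\<eta> - \<theta>\<close> into \<open>\<Sum> w j * (\<eta> - \<theta>)'\<close>, where the prime stands
  for increments; \<open>w j\<close> times an increment of \<open>\<eta>\<close> is at most its absolute value, with equality for \<open>\<theta>\<close>.
\<close>

lemma path_subgradient:
  assumes w: "w 0 = 0" "w n = 0" "\<And>j. j \<le> n \<Longrightarrow> \<bar>w j\<bar> \<le> 1" "\<And>p. p \<le> K \<Longrightarrow> w (T p) = \<sigma> p"
  shows "(\<lambda>i\<in>{1..n}. w (i - 1) - w i) \<in> SD"
proof -
  have jump: "w j * diff_op \<theta> j = \<bar>diff_op \<theta> j\<bar>" if j: "1 \<le> j" "j \<le> n - 1" for j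
    using knot_or_flat[OF j]
  proof
    assume "\<exists>p. 0 < p \<and> p < K \<and> j = T p"
    then obtain p where "0 < p" "p < K" "j = T p" by blast
    then show ?thesis
      using w(4)[of p] sig[of p] by (simp add: diff_op_def sgn_mult_self_eq mult_sgn_abs sgn_if abs_if)
  qed (simp add: diff_op_def)
  have "total_var n \<theta> + (\<Sum>i=1..n. (\<lambda>i\<in>{1..n}. w (i - 1) - w i) i * (\<eta> i - \<theta> i)) \<le> total_var n \<eta>" for \<eta>
  proof -
    have "(\<Sum>i=1..n. (\<lambda>i\<in>{1..n}. w (i - 1) - w i) i * (\<eta> i - \<theta> i)) = (\<Sum>i=1..n. (w (i - 1) - w i) * (\<eta> i - \<theta> i))"
      by (intro sum.cong) auto
    also have "\<dots> = (\<Sum>j=1..n - 1. w j * (diff_op \<eta> j - diff_op \<theta> j))"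
      using summation_by_parts_paths[OF n_pos, of w "\<lambda>i. \<eta> i - \<theta> i"] w(1,2)
      by (simp add: diff_op_def algebra_simps)
    also have "\<dots> \<le> (\<Sum>j=1..n - 1. \<bar>diff_op \<eta> j\<bar> - \<bar>diff_op \<theta> j\<bar>)"
    proof (rule sum_mono)
      fix j assume j: "j \<in> {1..n - 1}"
      have "w j * diff_op \<eta> j \<le> \<bar>w j\<bar> * \<bar>diff_op \<eta> j\<bar>" by (metis abs_ge_self abs_mult)
      also have "\<dots> \<le> 1 * \<bar>diff_op \<eta> j\<bar>"
        using w(3)[of j] j by (intro mult_right_mono) auto
      finally show "w j * (diff_op \<eta> j - diff_op \<theta> j) \<le> \<bar>diff_op \<eta> j\<bar> - \<bar>diff_op \<theta> j\<bar>"
        using jump[of j] j by (simp add: right_diff_distrib)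
    qed
    also have "\<dots> = total_var n \<eta> - total_var n \<theta>"
      by (simp add: total_var_def sum_subtractf)
    finally show ?thesis by simp
  qed
  then show ?thesis by (auto simp: subdifferential_def Rn_def)
qed

text \<open>
  If \<open>b\<close> does not jump where \<open>\<theta>\<close> does not, then the total variation is affine on the segment
  between \<open>\<theta> - \<epsilon> * b\<close> and \<open>\<theta> + \<epsilon> * b\<close> for small \<open>\<epsilon>\<close>, and the subgradient inequality at both of its ends
  determines the pairing with \<open>b\<close>.
\<close>

lemma ip_subgradient_constant:
  assumes v: "v \<in> SD" and b: "\<And>j. 1 \<le> j \<Longrightarrow> j \<le> n - 1 \<Longrightarrow> \<theta> (Suc j) = \<theta> j \<Longrightarrow> b (Suc j) = b j"
  shows "ip {1..n} v b = (\<Sum>j=1..n - 1. sgn (diff_op \<theta> j) * diff_op b j)"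
proof -
  let ?J = "{j \<in> {1..n - 1}. diff_op \<theta> j \<noteq> 0}"
  obtain \<epsilon> where \<epsilon>: "\<epsilon> > 0" "\<And>j. j \<in> ?J \<Longrightarrow> \<epsilon> * \<bar>diff_op b j\<bar> \<le> \<bar>diff_op \<theta> j\<bar>"
    using exists_small_scale[of ?J "\<lambda>j. \<bar>diff_op \<theta> j\<bar>" "diff_op b"] by auto
  have main: "c * ip {1..n} v b \<le> c * (\<Sum>j=1..n - 1. sgn (diff_op \<theta> j) * diff_op b j)" if c: "\<bar>c\<bar> = \<epsilon>" for c
  proof -
    let ?\<eta> = "\<lambda>i\<in>{1..n}. \<theta> i + c * b i"
    have "total_var n ?\<eta> = total_var n (\<lambda>i. \<theta> i + c * b i)"
      by (rule total_var_cong) auto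
    also have "\<dots> = (\<Sum>j=1..n - 1. \<bar>diff_op \<theta> j\<bar> + c * (sgn (diff_op \<theta> j) * diff_op b j))"
      unfolding total_var_def
    proof (rule sum.cong[OF refl])
      fix j assume j: "j \<in> {1..n - 1}"
      have d: "diff_op (\<lambda>i. \<theta> i + c * b i) j = diff_op \<theta> j + c * diff_op b j"
        by (simp add: diff_op_def algebra_simps)
      show "\<bar>diff_op (\<lambda>i. \<theta> i + c * b i) j\<bar> = \<bar>diff_op \<theta> j\<bar> + c * (sgn (diff_op \<theta> j) * diff_op b j)"
      proof (cases "diff_op \<theta> j = 0")
        case True
        then have "diff_op b j = 0" using b[of j] j by (simp add: diff_op_def)
        then show ?thesis using True d by simp
      next
        case False
        then have "\<bar>c * diff_op b j\<bar> \<le> \<bar>diff_op \<theta> j\<bar>"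
          using \<epsilon>(2)[of j] j c by (simp add: abs_mult)
        then show ?thesis unfolding d using False by (auto simp: sgn_if abs_if split: if_splits)
      qed
    qed
    also have "\<dots> = total_var n \<theta> + c * (\<Sum>j=1..n - 1. sgn (diff_op \<theta> j) * diff_op b j)"
      by (simp add: total_var_def sum.distrib sum_distrib_left)
    finally have tv: "total_var n ?\<eta> = total_var n \<theta> + c * (\<Sum>j=1..n - 1. sgn (diff_op \<theta> j) * diff_op b j)" .
    have "?\<eta> \<in> Rn n" by (auto simp: Rn_def)
    from subdifferential_D[OF v this] have "ip {1..n} v (\<lambda>i. ?\<eta> i - \<theta> i) \<le> c * (\<Sum>j=1..n - 1. sgn (diff_op \<theta> j) * diff_op b j)"
      unfolding tv by simp
    moreover have "ip {1..n} v (\<lambda>i. ?\<eta> i - \<theta> i) = ip {1..n} v (\<lambda>i. c * b i)"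
      by (intro ip_cong) auto
    ultimately show ?thesis by (simp add: ip_simps)
  qed
  show ?thesis
    using main[of \<epsilon>] main[of "- \<epsilon>"] \<epsilon>(1) by simp
qed

text \<open>
  The path \<open>w\<close> is the linear interpolation of the signs.
\<close>

lemma slope_subgradient:
  "\<exists>b\<in>SD. (\<forall>p<K. \<forall>i. T p < i \<and> i \<le> T (Suc p) \<longrightarrow> b i = (\<sigma> p - \<sigma> (Suc p)) / real (len p))"
proof -
  define y where "y p j = \<sigma> p + (\<sigma> (Suc p) - \<sigma> p) * ((real j - real (T p)) / real (len p))" for p j
  have mono': "T p \<le> T (Suc p)" if "p < K" for p using Tmono[OF that] by simp
  have ends: "y p (T p) = \<sigma> p" "y p (T (Suc p)) = \<sigma> (Suc p)" if "p < K" for p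
    using Tmono[OF that] by (auto simp: y_def len_def)
  obtain w where w: "\<And>p j. p < K \<Longrightarrow> T p \<le> j \<Longrightarrow> j \<le> T (Suc p) \<Longrightarrow> w j = y p j"
    using glue_paths[of K T y \<sigma>, OF mono' ends] T_inj by blast
  have wT: "w (T p) = \<sigma> p" if "p \<le> K" for p
  proof (cases "p = K")
    case True
    then obtain q where "p = Suc q" "q < K" using K2 by (cases p) auto
    then show ?thesis using w[of q "T (Suc q)"] ends(2)[of q] mono'[of q] by simp
  next
    case False
    then show ?thesis using w[of p "T p"] ends(1)[of p] mono'[of p] that by simp
  qed
  have "\<bar>w j\<bar> \<le> 1" if jn: "j \<le> n" for j
  proof -
    obtain p where p: "p < K" "T p \<le> j" "j \<le> T (Suc p)" using piece_exists[OF jn] by blast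
    define f where "f = (real j - real (T p)) / real (len p)"
    have f: "0 \<le> f" "f \<le> 1" using p Tmono[OF p(1)] by (auto simp: f_def len_def divide_le_eq_1)
    have s: "\<bar>\<sigma> p\<bar> \<le> 1" "\<bar>\<sigma> (Suc p)\<bar> \<le> 1" using sigma_range[of p] sigma_range[of "Suc p"] p by auto
    have "w j = (1 - f) * \<sigma> p + f * \<sigma> (Suc p)"
      using w[OF p] unfolding y_def f_def[symmetric] by (simp add: algebra_simps)
    also have "\<bar>\<dots>\<bar> \<le> (1 - f) * \<bar>\<sigma> p\<bar> + f * \<bar>\<sigma> (Suc p)\<bar>"
      using abs_triangle_ineq[of "(1 - f) * \<sigma> p" "f * \<sigma> (Suc p)"] f by (simp add: abs_mult)
    also have "\<dots> \<le> (1 - f) * 1 + f * 1"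
      using f s by (intro add_mono mult_left_mono) auto
    finally show ?thesis by simp
  qed
  then have sd: "(\<lambda>i\<in>{1..n}. w (i - 1) - w i) \<in> SD"
    using wT[of 0] wT[of K] wT T0 TK sig0 sigK by (intro path_subgradient) auto
  have "(\<lambda>i\<in>{1..n}. w (i - 1) - w i) i = (\<sigma> p - \<sigma> (Suc p)) / real (len p)"
    if p: "p < K" and i: "T p < i" "i \<le> T (Suc p)" for p i
  proof -
    have "i \<in> {1..n}" using i T_le[of "Suc p"] p by auto
    moreover have "w (i - 1) = y p (i - 1)" "w i = y p i"
      using w[OF p, of "i - 1"] w[OF p, of i] i by auto
    ultimately show ?thesis
      using i len_pos[OF p] by (simp add: y_def of_nat_diff field_simps)
  qed
  then show ?thesis using sd by blast
qed

end

section \<open>Dilations of the subdifferential and the cone over it\<close>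

context jump_pieces
begin

(* Otherwise the simplifier rewrites {1..n} to {Suc 0..n}, and lemmas about {1..n} no longer match. *)
declare One_nat_def [simp del]

text \<open>
  The subgradient of least norm.
\<close>

definition vbar :: "nat \<Rightarrow> real" where
  "vbar = (SOME b. b \<in> SD \<and> (\<forall>p<K. \<forall>i. T p < i \<and> i \<le> T (Suc p) \<longrightarrow> b i = (\<sigma> p - \<sigma> (Suc p)) / real (len p)))"

lemma vbar: "vbar \<in> SD \<and> (\<forall>p<K. \<forall>i. T p < i \<and> i \<le> T (Suc p) \<longrightarrow> vbar i = (\<sigma> p - \<sigma> (Suc p)) / real (len p))"
  unfolding vbar_def by (rule someI_ex[OF slope_subgradient[unfolded Bex_def]])

lemma vbar_in: "vbar \<in> SD"
  using vbar by blast

lemma vbar_slope: "p < K \<Longrightarrow> T p < i \<Longrightarrow> i \<le> T (Suc p) \<Longrightarrow> vbar i = (\<sigma> p - \<sigma> (Suc p)) / real (len p)"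
  using vbar by blast

definition V :: real where
  "V = vnorm n vbar"

lemma vbar_flat:
  assumes j: "1 \<le> j" "j \<le> n - 1" and f: "\<theta> (Suc j) = \<theta> j"
  shows "vbar (Suc j) = vbar j"
proof -
  have "j \<le> n" using j by linarith
  then obtain p where p: "p < K" "T p \<le> j" "j \<le> T (Suc p)" using piece_exists by blast
  have nk: "j \<noteq> T q" if "q \<le> K" for q
  proof
    assume jq: "j = T q"
    have "q \<noteq> 0" using T0 j jq by (cases q) auto
    then have q0: "0 < q" by simp
    have "q \<noteq> K"
    proof
      assume "q = K"
      then have "j = n" using jq TK by simp
      then show False using j n_pos by linarith
    qed
    then have qK: "q < K" using that by simp
    have "\<sigma> q = 0" unfolding sig[OF q0 qK] using f jq by simp
    then show False using sig_nz[OF q0 qK] by blast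
  qed
  have "T p < j" "j < T (Suc p)"
    using p nk[of p] nk[of "Suc p"] by auto
  then show ?thesis using vbar_slope[OF p(1), of j] vbar_slope[OF p(1), of "Suc j"] by simp
qed

lemma ip_vbar:
  assumes "v \<in> SD"
  shows "ip {1..n} v vbar = V\<^sup>2"
proof -
  have c: "ip {1..n} u vbar = (\<Sum>j=1..n - 1. sgn (diff_op \<theta> j) * diff_op vbar j)" if "u \<in> SD" for u
    by (rule ip_subgradient_constant[OF that]) (rule vbar_flat)
  have "ip {1..n} v vbar = ip {1..n} vbar vbar"
    unfolding c[OF assms] c[OF vbar_in] ..
  then show ?thesis unfolding V_def L2_set_square .
qed

lemma V_square: "V\<^sup>2 = (\<Sum>p<K. (\<sigma> p - \<sigma> (Suc p))\<^sup>2 / real (len p))"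
proof -
  have "V\<^sup>2 = (\<Sum>i\<in>{0<..T K}. (vbar i)\<^sup>2)"
    unfolding V_def L2_set_square_sum TK by (intro sum.cong) auto
  also have "\<dots> = (\<Sum>p<K. \<Sum>i\<in>{T p<..T (Suc p)}. (vbar i)\<^sup>2)"
    by (rule sum_split_at_knots[OF less_imp_le[OF Tmono] T0])
  also have "\<dots> = (\<Sum>p<K. (\<sigma> p - \<sigma> (Suc p))\<^sup>2 / real (len p))"
  proof (rule sum.cong[OF refl])
    fix p assume "p \<in> {..<K}"
    then have p: "p < K" by simp
    have "(\<Sum>i\<in>{T p<..T (Suc p)}. (vbar i)\<^sup>2) = (\<Sum>i\<in>{T p<..T (Suc p)}. ((\<sigma> p - \<sigma> (Suc p)) / real (len p))\<^sup>2)"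
      using vbar_slope[OF p] by (intro sum.cong) auto
    also have "\<dots> = real (len p) * ((\<sigma> p - \<sigma> (Suc p)) / real (len p))\<^sup>2"
      unfolding len_def sum_constant card_greaterThanAtMost ..
    also have "\<dots> = (\<sigma> p - \<sigma> (Suc p))\<^sup>2 / real (len p)"
      using len_pos[OF p] by (simp add: power2_eq_square)
    finally show "(\<Sum>i\<in>{T p<..T (Suc p)}. (vbar i)\<^sup>2) = (\<sigma> p - \<sigma> (Suc p))\<^sup>2 / real (len p)" .
  qed
  finally show ?thesis .
qed

text \<open>
  The first sign is 0 and the second one is not.
\<close>

lemma V_pos: "V > 0"
proof -
  have K0: "0 < K" "Suc 0 < K" using K2 by auto
  have "0 < (\<sigma> 0 - \<sigma> (Suc 0))\<^sup>2 / real (len 0)"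
    using sig0 sig_nz[of "Suc 0"] K0 len_pos[of 0] by (intro divide_pos_pos) auto
  also have "\<dots> \<le> V\<^sup>2"
    unfolding V_square using K0 by (intro member_le_sum[of 0 "{..<K}" "\<lambda>p. (\<sigma> p - \<sigma> (Suc p))\<^sup>2 / real (len p)"]) auto
  finally have "V \<noteq> 0" by auto
  then show ?thesis using L2_set_nonneg[of vbar "{1..n}"] unfolding V_def by linarith
qed

lemma V_square_le: "V\<^sup>2 \<le> 4 * (\<Sum>p<K. of_bool (\<sigma> p \<noteq> \<sigma> (Suc p)) / real (len p))"
  unfolding V_square sum_distrib_left
proof (rule sum_mono)
  fix p assume "p \<in> {..<K}"
  then have s: "\<sigma> p \<in> {- 1, 0, 1}" "\<sigma> (Suc p) \<in> {- 1, 0, 1}" using sigma_range by auto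
  have "(\<sigma> p - \<sigma> (Suc p))\<^sup>2 \<le> 4 * of_bool (\<sigma> p \<noteq> \<sigma> (Suc p))"
    using s by auto
  then have "(\<sigma> p - \<sigma> (Suc p))\<^sup>2 / real (len p) \<le> 4 * of_bool (\<sigma> p \<noteq> \<sigma> (Suc p)) / real (len p)"
    by (rule divide_right_mono) simp
  then show "(\<sigma> p - \<sigma> (Suc p))\<^sup>2 / real (len p) \<le> 4 * (of_bool (\<sigma> p \<noteq> \<sigma> (Suc p)) / real (len p))"
    by simp
qed

text \<open>
  The affine hull is contained in the hyperplane \<open>\<langle>v, vbar\<rangle> = V\<^sup>2\<close>, of which \<open>vbar\<close> is the point of least
  norm.
\<close>

lemma vnorm_min_subgradient: "vnorm n (min_subgradient n \<theta>) = V"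
  unfolding min_subgradient_def V_def
proof (rule arg_min_equality[of "\<lambda>v. v \<in> affine_in n hull SD" vbar "vnorm n"])
  show "vbar \<in> affine_in n hull SD"
    by (rule hull_inc[OF vbar_in])
next
  fix x assume x: "x \<in> affine_in n hull SD"
  let ?W = "{v \<in> Rn n. ip {1..n} v vbar = V\<^sup>2}"
  have "SD \<subseteq> ?W" using ip_vbar by (auto simp: subdifferential_def)
  moreover have "affine_in n ?W"
    unfolding affine_in_def
  proof (intro conjI ballI allI impI)
    fix x y u v assume xy: "x \<in> ?W" "y \<in> ?W" and uv: "u + v = (1 :: real)"
    have "ip {1..n} (\<lambda>i\<in>{1..n}. u * x i + v * y i) vbar = ip {1..n} (\<lambda>i. u * x i + v * y i) vbar"
      by (intro ip_cong) auto
    also have "\<dots> = u * V\<^sup>2 + v * V\<^sup>2"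
      using xy unfolding ip_add_left[of "{1..n}" "\<lambda>i. u * x i" "\<lambda>i. v * y i"] ip_scale_left by simp
    also have "\<dots> = V\<^sup>2" using uv by (simp flip: distrib_right)
    finally show "(\<lambda>i\<in>{1..n}. u * x i + v * y i) \<in> ?W" by (simp add: Rn_def)
  qed auto
  ultimately have "affine_in n hull SD \<subseteq> ?W" by (rule hull_minimal)
  then have "V\<^sup>2 = ip {1..n} x vbar" using x by auto
  also have "\<dots> \<le> vnorm n x * V" unfolding V_def by (rule ip_le)
  finally have "V * V \<le> vnorm n x * V" by (simp add: power2_eq_square)
  then show "vnorm n vbar \<le> vnorm n x" using V_pos by (simp add: V_def)
qed

lemma SD_compact: "compact SD"
  by (rule subdifferential_compact[OF theta])

lemma coord_cont: "continuous_on S (\<lambda>v. v i)" for S :: "(nat \<Rightarrow> real) set"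
  by (rule continuous_on_product_then_coordinatewise[OF continuous_on_id])

lemma nearest_exists: "\<exists>v\<in>SD. \<forall>v'\<in>SD. vnorm n (\<lambda>i. z i - l * v i) \<le> vnorm n (\<lambda>i. z i - l * v' i)"
proof (rule continuous_attains_inf[OF SD_compact])
  show "SD \<noteq> {}" using vbar_in by blast
  show "continuous_on SD (\<lambda>v. vnorm n (\<lambda>i. z i - l * v i))"
    by (intro continuous_on_vnorm_diff continuous_on_diff continuous_on_mult continuous_on_const coord_cont)
qed

definition nearest :: "real \<Rightarrow> (nat \<Rightarrow> real) \<Rightarrow> nat \<Rightarrow> real" where
  "nearest l z = (SOME v. v \<in> SD \<and> (\<forall>v'\<in>SD. vnorm n (\<lambda>i. z i - l * v i) \<le> vnorm n (\<lambda>i. z i - l * v' i)))"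

lemma nearest: "nearest l z \<in> SD" "v' \<in> SD \<Longrightarrow> vnorm n (\<lambda>i. z i - l * nearest l z i) \<le> vnorm n (\<lambda>i. z i - l * v' i)"
proof -
  have "nearest l z \<in> SD \<and> (\<forall>v'\<in>SD. vnorm n (\<lambda>i. z i - l * nearest l z i) \<le> vnorm n (\<lambda>i. z i - l * v' i))"
    unfolding nearest_def by (rule someI_ex[OF nearest_exists[unfolded Bex_def]])
  then show "nearest l z \<in> SD" "v' \<in> SD \<Longrightarrow> vnorm n (\<lambda>i. z i - l * nearest l z i) \<le> vnorm n (\<lambda>i. z i - l * v' i)"
    by blast+
qed

definition dist_scaled :: "real \<Rightarrow> (nat \<Rightarrow> real) \<Rightarrow> real" where
  "dist_scaled l z = vnorm n (\<lambda>i. z i - l * nearest l z i)"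

lemma dist_scaled_le: "v \<in> SD \<Longrightarrow> dist_scaled l z \<le> vnorm n (\<lambda>i. z i - l * v i)"
  unfolding dist_scaled_def by (rule nearest(2))

lemma dist_scaled_nonneg: "0 \<le> dist_scaled l z"
  by (simp add: dist_scaled_def)

lemma INF_eq_dist_scaled: "(INF v\<in>SD. vnorm n (\<lambda>i. z i - l * v i)) = dist_scaled l z"
proof (rule cInf_eq_minimum)
  show "dist_scaled l z \<in> (\<lambda>v. vnorm n (\<lambda>i. z i - l * v i)) ` SD"
    unfolding dist_scaled_def by (intro imageI nearest(1))
qed (use dist_scaled_le in blast)

lemma convex_projection_dilate:
  "convex_projection {1..n} ((\<lambda>v i. l * v i) ` SD) (\<lambda>z i. l * nearest l z i)"
proof
  fix a b :: "nat \<Rightarrow> real" and u :: real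
  assume "a \<in> (\<lambda>v i. l * v i) ` SD" "b \<in> (\<lambda>v i. l * v i) ` SD" and u: "0 \<le> u" "u \<le> 1"
  then obtain v v' where v: "v \<in> SD" "v' \<in> SD" "a = (\<lambda>i. l * v i)" "b = (\<lambda>i. l * v' i)" by blast
  let ?w = "\<lambda>i\<in>{1..n}. (1 - u) * v i + u * v' i"
  have "?w \<in> SD" by (rule subdifferential_convex[OF v(1,2) u])
  then show "\<exists>c\<in>(\<lambda>v i. l * v i) ` SD. \<forall>i\<in>{1..n}. c i = a i + u * (b i - a i)"
    using v(3,4) by (intro bexI[of _ "\<lambda>i. l * ?w i"] imageI) (simp add: algebra_simps)
next
  fix z a assume "a \<in> (\<lambda>v i. l * v i) ` SD"
  then show "vnorm n (\<lambda>i. z i - l * nearest l z i) \<le> vnorm n (\<lambda>i. z i - a i)"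
    using nearest(2) by auto
qed (auto intro: nearest(1))

text \<open>
  The minimum over all scales is attained: the pairing with \<open>vbar\<close> shows that every point of \<open>l * SD\<close> has
  norm at least \<open>l * V\<close>, so that scales beyond \<open>2 * \<parallel>z\<parallel> / V\<close> are worse than scale 0, and on the remaining
  compact set of scales and subgradients the distance is continuous.
\<close>

lemma lambda_of_minimal:
  shows "0 \<le> lambda_of n \<theta> z" and "0 \<le> l \<Longrightarrow> dist_scaled (lambda_of n \<theta> z) z \<le> dist_scaled l z"
proof -
  define \<Lambda> where "\<Lambda> = 2 * vnorm n z / V"
  have \<Lambda>0: "0 \<le> \<Lambda>" using V_pos by (simp add: \<Lambda>_def)
  let ?S = "{0..\<Lambda>} \<times> SD"
  let ?f = "\<lambda>p. vnorm n (\<lambda>i. z i - fst p * snd p i)"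
  have "compact ?S" by (intro compact_Times SD_compact compact_Icc)
  moreover have "?S \<noteq> {}" using \<Lambda>0 vbar_in by auto
  moreover have "continuous_on ?S ?f"
    by (intro continuous_on_vnorm_diff continuous_on_diff continuous_on_mult continuous_on_const
        continuous_on_fst continuous_on_id continuous_on_product_then_coordinatewise[OF continuous_on_snd])
  ultimately obtain p where p: "p \<in> ?S" "\<And>q. q \<in> ?S \<Longrightarrow> ?f p \<le> ?f q"
    using continuous_attains_inf[of ?S ?f] by blast
  define l0 where "l0 = fst p"
  have l0: "0 \<le> l0" "l0 \<le> \<Lambda>" using p(1) by (auto simp: l0_def)
  have best: "dist_scaled l0 z \<le> ?f q" if "q \<in> ?S" for q
  proof -
    have "dist_scaled l0 z \<le> ?f p" unfolding l0_def using p(1) by (intro dist_scaled_le) auto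
    then show ?thesis using p(2)[OF that] by simp
  qed
  have min: "dist_scaled l0 z \<le> dist_scaled l z" if l: "0 \<le> l" for l
  proof (cases "l \<le> \<Lambda>")
    case True
    then have "dist_scaled l0 z \<le> ?f (l, nearest l z)" using l by (intro best) (auto intro: nearest(1))
    then show ?thesis by (simp add: dist_scaled_def)
  next
    case False
    let ?v = "nearest l z"
    have "l * V * V = ip {1..n} (\<lambda>i. l * ?v i) vbar"
      unfolding ip_scale_left ip_vbar[OF nearest(1)] by (simp add: power2_eq_square)
    also have "\<dots> \<le> vnorm n (\<lambda>i. l * ?v i) * V" unfolding V_def by (rule ip_le)
    finally have "l * V \<le> vnorm n (\<lambda>i. l * ?v i)" using V_pos by simp
    also have "\<dots> \<le> vnorm n (\<lambda>i. l * ?v i - z i) + vnorm n z" by (rule L2_set_diff_triangle)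
    also have "vnorm n (\<lambda>i. l * ?v i - z i) = dist_scaled l z"
      unfolding dist_scaled_def by (rule L2_set_minus_commute)
    finally have "l * V \<le> dist_scaled l z + vnorm n z" .
    moreover have "2 * vnorm n z < l * V"
      using False V_pos by (simp add: \<Lambda>_def field_simps)
    moreover have "dist_scaled l0 z \<le> ?f (0, vbar)" using \<Lambda>0 vbar_in by (intro best) auto
    ultimately show ?thesis by simp
  qed
  have "0 \<le> lambda_of n \<theta> z \<and> (\<forall>l\<ge>0. dist_scaled (lambda_of n \<theta> z) z \<le> dist_scaled l z)"
    unfolding lambda_of_def INF_eq_dist_scaled
  proof (rule arg_minI[of "\<lambda>l. 0 \<le> l" l0])
    show "\<not> dist_scaled l z < dist_scaled l0 z" if "0 \<le> l" for l using min[OF that] by simp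
  qed (use l0 in \<open>auto simp: not_less\<close>)
  then show "0 \<le> lambda_of n \<theta> z" "0 \<le> l \<Longrightarrow> dist_scaled (lambda_of n \<theta> z) z \<le> dist_scaled l z" by auto
qed

abbreviation "lam \<equiv> lambda_of n \<theta>"

definition cone_proj :: "(nat \<Rightarrow> real) \<Rightarrow> nat \<Rightarrow> real" where
  "cone_proj z i = lam z * nearest (lam z) z i"

definition cone :: "(nat \<Rightarrow> real) set" where
  "cone = {a. \<exists>l\<ge>0. \<exists>v\<in>SD. a = (\<lambda>i. l * v i)}"

text \<open>
  A convex combination of \<open>l * v\<close> and \<open>l' * v'\<close> is again a multiple of a subgradient, the weights being
  changed in proportion to the scales; both scales can vanish only in the combination 0.
\<close>

lemma convex_projection_cone: "convex_projection {1..n} cone cone_proj"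
proof
  fix a b :: "nat \<Rightarrow> real" and u :: real
  assume "a \<in> cone" "b \<in> cone" and u: "0 \<le> u" "u \<le> 1"
  then obtain l v l' v' where v: "0 \<le> l" "v \<in> SD" "a = (\<lambda>i. l * v i)" "0 \<le> l'" "v' \<in> SD" "b = (\<lambda>i. l' * v' i)"
    by (auto simp: cone_def)
  define m where "m = (1 - u) * l + u * l'"
  have nn: "0 \<le> (1 - u) * l" "0 \<le> u * l'" using u v by auto
  show "\<exists>c\<in>cone. \<forall>i\<in>{1..n}. c i = a i + u * (b i - a i)"
  proof (cases "m = 0")
    case True
    then have z: "(1 - u) * l = 0" "u * l' = 0" using nn unfolding m_def by linarith+
    have "a i + u * (b i - a i) = ((1 - u) * l) * v i + (u * l') * v' i" for i
      by (simp add: v algebra_simps)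
    then have "a i + u * (b i - a i) = 0 * v i" for i using z by simp
    moreover have "(\<lambda>i. 0 * v i) \<in> cone" unfolding cone_def using v(2) by blast
    ultimately show ?thesis by (intro bexI[of _ "\<lambda>i. 0 * v i"]) auto
  next
    case False
    then have m: "m > 0" using nn by (simp add: m_def)
    define t where "t = u * l' / m"
    have t: "0 \<le> t" "t \<le> 1" using nn m by (auto simp: t_def m_def)
    have mt1: "m * t = u * l'" using m by (simp add: t_def)
    have mt2: "m * (1 - t) = (1 - u) * l" unfolding right_diff_distrib mt1 by (simp add: m_def algebra_simps)
    let ?w = "\<lambda>i\<in>{1..n}. (1 - t) * v i + t * v' i"
    have "?w \<in> SD" by (rule subdifferential_convex[OF v(2,5) t])
    then have "(\<lambda>i. m * ?w i) \<in> cone" unfolding cone_def using m by (intro CollectI exI[of _ m] conjI bexI[of _ ?w]) simp_all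
    moreover have "m * ?w i = a i + u * (b i - a i)" if "i \<in> {1..n}" for i
    proof -
      have "m * ?w i = (m * (1 - t)) * v i + (m * t) * v' i" using that by (simp add: algebra_simps)
      then show ?thesis unfolding mt1 mt2 by (simp add: v algebra_simps)
    qed
    ultimately show ?thesis by (intro bexI[of _ "\<lambda>i. m * ?w i"]) auto
  qed
next
  fix z show "cone_proj z \<in> cone"
    unfolding cone_def cone_proj_def using lambda_of_minimal(1)[of z] nearest(1)[of "lam z" z] by blast
next
  fix z a assume "a \<in> cone"
  then obtain l v where "0 \<le> l" "v \<in> SD" "a = (\<lambda>i. l * v i)" by (auto simp: cone_def)
  then show "vnorm n (\<lambda>i. z i - cone_proj z i) \<le> vnorm n (\<lambda>i. z i - a i)"
    using lambda_of_minimal(2)[of l z] dist_scaled_le[of v l z] by (simp add: cone_proj_def dist_scaled_def)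
qed simp

sublocale cp: convex_projection "{1..n}" cone cone_proj
  by (rule convex_projection_cone)

text \<open>
  So the optimal scale is a linear functional of the projection to the cone, whose fluctuations are
  controlled by \<open>projection_component_variance\<close>.
\<close>

lemma ip_cone_proj: "ip {1..n} (cone_proj z) vbar = lam z * V\<^sup>2"
  unfolding cone_proj_def ip_scale_left ip_vbar[OF nearest(1)] ..

lemma dist_cone_le: "0 \<le> l \<Longrightarrow> vnorm n (\<lambda>i. z i - cone_proj z i) \<le> dist_scaled l z"
  using lambda_of_minimal(2)[of l z] by (simp add: cone_proj_def dist_scaled_def)

text \<open>
  The point \<open>cone_proj z + (l - lam z) * vbar\<close> belongs to \<open>l * SD\<close>, because \<open>vbar\<close> does to \<open>SD\<close>.
\<close>

lemma dist_scaled_above_lam: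
  assumes l: "lam z \<le> l"
  shows "dist_scaled l z \<le> vnorm n (\<lambda>i. z i - cone_proj z i) + (l - lam z) * V"
proof (cases "l = 0")
  case True
  then have "lam z = 0" using lambda_of_minimal(1)[of z] l by simp
  then show ?thesis using True by (simp add: dist_scaled_def cone_proj_def)
next
  case False
  then have l0: "l > 0" using lambda_of_minimal(1)[of z] l by simp
  define u where "u = 1 - lam z / l"
  have u: "0 \<le> u" "u \<le> 1" using l l0 lambda_of_minimal(1)[of z] by (auto simp: u_def)
  have lu: "l * u = l - lam z" "l * (1 - u) = lam z" using l0 by (auto simp: u_def algebra_simps)
  let ?v = "nearest (lam z) z"
  let ?w = "\<lambda>i\<in>{1..n}. (1 - u) * ?v i + u * vbar i"
  have "?w \<in> SD" by (rule subdifferential_convex[OF nearest(1) vbar_in u])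
  then have "dist_scaled l z \<le> vnorm n (\<lambda>i. z i - l * ?w i)" by (rule dist_scaled_le)
  also have "\<dots> = vnorm n (\<lambda>i. (z i - cone_proj z i) + - ((l - lam z) * vbar i))"
  proof (rule L2_set_cong[OF refl])
    fix i assume i: "i \<in> {1..n}"
    have "l * ?w i = (l * (1 - u)) * ?v i + (l * u) * vbar i" using i by (simp add: algebra_simps)
    then show "z i - l * ?w i = (z i - cone_proj z i) + - ((l - lam z) * vbar i)"
      unfolding lu by (simp add: cone_proj_def)
  qed
  also have "\<dots> \<le> vnorm n (\<lambda>i. z i - cone_proj z i) + vnorm n (\<lambda>i. - ((l - lam z) * vbar i))"
    by (rule L2_set_triangle_ineq)
  also have "vnorm n (\<lambda>i. - ((l - lam z) * vbar i)) = (l - lam z) * V"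
    using L2_set_right_distrib[of "l - lam z" vbar "{1..n}"] l by (simp add: V_def L2_set_def)
  finally show ?thesis .
qed

lemma lambda_star_eq: "lambda_star n \<theta> = (\<integral>z. lam z \<partial>gauss_vec {1..n}) + 2 / V"
  by (simp add: lambda_star_def gauss_eq_gauss_vec vnorm_min_subgradient)

lemma lam_integrable: "integrable (gauss_vec {1..n}) lam"
proof -
  interpret prob_space "gauss_vec {1..n}" by (rule prob_space_gauss_vec)
  have e: "lam z = ip {1..n} (cone_proj z) vbar / V\<^sup>2" for z
    using V_pos by (simp add: ip_cone_proj)
  have lip: "\<bar>lam x - lam y\<bar> \<le> 1 / V * vnorm n (\<lambda>i. x i - y i)" for x y
  proof -
    have "\<bar>ip {1..n} (\<lambda>i. cone_proj x i - cone_proj y i) vbar\<bar> \<le> vnorm n (\<lambda>i. cone_proj x i - cone_proj y i) * V"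
      unfolding V_def by (rule abs_ip_le)
    also have "\<dots> \<le> vnorm n (\<lambda>i. x i - y i) * V"
      using cp.nonexpansive V_pos by (intro mult_right_mono) auto
    finally have "\<bar>ip {1..n} (cone_proj x) vbar - ip {1..n} (cone_proj y) vbar\<bar> \<le> vnorm n (\<lambda>i. x i - y i) * V"
      by (simp only: ip_diff_left)
    then have "\<bar>(lam x - lam y) * V\<^sup>2\<bar> \<le> vnorm n (\<lambda>i. x i - y i) * V"
      by (simp add: ip_cone_proj left_diff_distrib)
    then have "(\<bar>lam x - lam y\<bar> * V) * V \<le> vnorm n (\<lambda>i. x i - y i) * V"
      by (simp add: abs_mult power2_eq_square)
    then have "\<bar>lam x - lam y\<bar> * V \<le> vnorm n (\<lambda>i. x i - y i)" using V_pos by simp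
    then show ?thesis using V_pos by (simp add: field_simps)
  qed
  have m: "lam \<in> borel_measurable (gauss_vec {1..n})"
    by (rule lipschitz_measurable_gauss_vec[OF lip]) simp
  have "integrable (gauss_vec {1..n}) (\<lambda>z. (lam z)\<^sup>2)"
  proof (rule integrable_gauss_vec_quadratic)
    show "(\<lambda>z. (lam z)\<^sup>2) \<in> borel_measurable (gauss_vec {1..n})" using m by simp
    fix x
    have "\<bar>lam x\<bar> \<le> \<bar>lam (\<lambda>_. 0)\<bar> + 1 / V * vnorm n x"
      using lip[of x "\<lambda>_. 0"] by simp
    then have "\<bar>lam x\<bar>\<^sup>2 \<le> (\<bar>lam (\<lambda>_. 0)\<bar> + 1 / V * vnorm n x)\<^sup>2" by (rule power_mono) simp
    also have "\<dots> \<le> 2 * \<bar>lam (\<lambda>_. 0)\<bar>\<^sup>2 + 2 * (1 / V * vnorm n x)\<^sup>2" by (rule square_add_le)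
    also have "\<dots> = 2 * (lam (\<lambda>_. 0))\<^sup>2 + (2 / V\<^sup>2) * (\<Sum>i\<in>{1..n}. (x i)\<^sup>2)"
      unfolding power_mult_distrib L2_set_square_sum by (simp add: power_divide)
    finally show "\<bar>(lam x)\<^sup>2\<bar> \<le> 2 * (lam (\<lambda>_. 0))\<^sup>2 + (2 / V\<^sup>2) * (\<Sum>i\<in>{1..n}. (x i)\<^sup>2)" by simp
  qed
  then show ?thesis by (rule square_integrable_imp_integrable[OF m])
qed

lemma square_sum5_le: "(a + b + c + d + e)\<^sup>2 \<le> 5 * (a\<^sup>2 + b\<^sup>2 + c\<^sup>2 + d\<^sup>2 + e\<^sup>2)" for a b c d e :: real
  using zero_le_power2[of "a - b"] zero_le_power2[of "a - c"] zero_le_power2[of "a - d"] zero_le_power2[of "a - e"] zero_le_power2[of "b - c"] zero_le_power2[of "b - d"] zero_le_power2[of "b - e"] zero_le_power2[of "c - d"] zero_le_power2[of "c - e"] zero_le_power2[of "d - e"]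
  by (simp add: power2_eq_square algebra_simps)

lemma dist_scaled_integrable: "integrable (gauss_vec {1..n}) (\<lambda>z. (dist_scaled l z)\<^sup>2)"
proof -
  interpret prob_space "gauss_vec {1..n}" by (rule prob_space_gauss_vec)
  interpret P: convex_projection "{1..n}" "(\<lambda>v i. l * v i) ` SD" "\<lambda>z i. l * nearest l z i"
    by (rule convex_projection_dilate)
  have "(dist_scaled l z)\<^sup>2 = (P.soft_dist z)\<^sup>2 - 1" for z
    unfolding P.soft_dist_square by (simp add: dist_scaled_def)
  then show ?thesis using P.soft_dist_variance(2) by simp
qed

text \<open>
  Let \<open>\<psi>\<close> be the smoothed distance to \<open>l * SD\<close> with mean \<open>e\<close>, and let \<open>\<phi>\<close>, with mean \<open>m\<close>, be within \<open>1 / 4\<close>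
  of \<open>V * lam\<close>. Both have variance at most 1. Where \<open>lam z \<le> l\<close>, the distance to \<open>l * SD\<close>
  is at most \<open>dist_scaled ld z + (l - lam z) * V\<close>, which bounds \<open>e\<close> by quantities with controlled second
  moment. Where \<open>lam z > l\<close>, the assumption on \<open>l\<close> forces \<open>\<phi> z - m \<ge> 3 / 2\<close>. Multiplying \<open>e\<^sup>2\<close> by
  \<open>1 - 4 / 9 * (\<phi> - m)\<^sup>2\<close>, which is then nonpositive, gives one inequality for all \<open>z\<close> that
  can be integrated, and the factor has mean at least \<open>5 / 9\<close>.
\<close>

theorem expected_square_dist_le:
  assumes l: "l \<ge> lambda_star n \<theta>" and ld: "ld \<ge> 0"
    and Q: "(\<integral>z. (dist_scaled ld z)\<^sup>2 \<partial>gauss_vec {1..n}) \<le> Q"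
  shows "(\<integral>z. (dist_scaled l z)\<^sup>2 \<partial>gauss_vec {1..n}) \<le> 129 * (1 + Q + (l - lambda_star n \<theta>)\<^sup>2 * V\<^sup>2)"
proof -
  let ?G = "gauss_vec {1..n}"
  interpret prob_space ?G by (rule prob_space_gauss_vec)
  interpret P: convex_projection "{1..n}" "(\<lambda>v i. l * v i) ` SD" "\<lambda>z i. l * nearest l z i"
    by (rule convex_projection_dilate)
  define \<psi> where "\<psi> = P.soft_dist"
  define e where "e = (\<integral>z. \<psi> z \<partial>?G)"
  have \<psi>1: "integrable ?G \<psi>" and \<psi>2: "integrable ?G (\<lambda>z. (\<psi> z)\<^sup>2)"
    and v\<psi>: "(\<integral>z. (\<psi> z)\<^sup>2 \<partial>?G) - e\<^sup>2 \<le> 1"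
    using P.soft_dist_variance unfolding \<psi>_def e_def by auto
  have \<psi>d: "\<psi> z \<le> 1 + dist_scaled l z" for z
    using P.soft_dist_le[of z] by (simp add: \<psi>_def dist_scaled_def)
  have d\<psi>: "(dist_scaled l z)\<^sup>2 = (\<psi> z)\<^sup>2 - 1" for z
    unfolding \<psi>_def P.soft_dist_square by (simp add: dist_scaled_def)
  obtain \<phi> where \<phi>1: "integrable ?G \<phi>" and \<phi>2: "integrable ?G (\<lambda>z. (\<phi> z)\<^sup>2)"
    and v\<phi>: "(\<integral>z. (\<phi> z)\<^sup>2 \<partial>?G) - (\<integral>z. \<phi> z \<partial>?G)\<^sup>2 \<le> 1"
    and a\<phi>: "\<And>z. \<bar>\<phi> z - ip {1..n} (cone_proj z) vbar / V\<bar> \<le> 1 / 4"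
    using cp.projection_component_variance[of V vbar] V_pos V_def by auto
  define m where "m = (\<integral>z. \<phi> z \<partial>?G)"
  define E where "E = (\<integral>z. lam z \<partial>?G)"
  have lamV: "\<bar>\<phi> z - lam z * V\<bar> \<le> 1 / 4" for z
    using a\<phi>[of z] V_pos by (simp add: ip_cone_proj power2_eq_square)
  have mE: "\<bar>m - E * V\<bar> \<le> 1 / 4"
  proof -
    have "m - E * V = (\<integral>z. \<phi> z - lam z * V \<partial>?G)"
      unfolding m_def E_def using \<phi>1 lam_integrable by simp
    also have "\<bar>\<dots>\<bar> \<le> (\<integral>z. \<bar>\<phi> z - lam z * V\<bar> \<partial>?G)" by (rule integral_abs_bound)
    also have "\<dots> \<le> (\<integral>z. 1 / 4 \<partial>?G)"
      using \<phi>1 lam_integrable lamV by (intro integral_mono) auto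
    finally show ?thesis by (simp add: prob_space)
  qed
  define ls where "ls = lambda_star n \<theta>"
  have lsV: "ls * V = E * V + 2"
    using V_pos by (simp add: ls_def lambda_star_eq E_def field_simps)
  have lls: "ls \<le> l" using l by (simp add: ls_def)
  define R where "R = (l - ls) * V"
  have R0: "0 \<le> R" using lls V_pos by (simp add: R_def)
  define W where "W z = (\<psi> z - e)\<^sup>2 + (7 / 2)\<^sup>2 + (dist_scaled ld z)\<^sup>2 + R\<^sup>2 + (\<phi> z - m)\<^sup>2" for z
  have e1: "e \<ge> 1"
  proof -
    have "(\<integral>z. 1 \<partial>?G) \<le> e"
      unfolding e_def using P.soft_dist_ge_1 \<psi>1 by (intro integral_mono) (auto simp: \<psi>_def)
    then show ?thesis by (simp add: prob_space)
  qed
  have W0: "0 \<le> W z" for z by (simp add: W_def add_nonneg_nonneg)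
  \<comment> \<open>The weight is at most 1, and nonpositive where the comparison of distances fails.\<close>
  have point: "e\<^sup>2 * (1 - 4 / 9 * (\<phi> z - m)\<^sup>2) \<le> 5 * W z" for z
  proof (cases "lam z \<le> l")
    case True
    have "(l - lam z) * V = R + (ls * V - lam z * V)"
      by (simp add: R_def algebra_simps)
    also have "\<dots> \<le> R + (5 / 2 + \<bar>\<phi> z - m\<bar>)"
      unfolding lsV using lamV[of z] mE by linarith
    finally have "dist_scaled l z \<le> dist_scaled ld z + R + (5 / 2 + \<bar>\<phi> z - m\<bar>)"
      using dist_scaled_above_lam[OF True] dist_cone_le[OF ld, of z] by linarith
    then have "e \<le> \<bar>\<psi> z - e\<bar> + 7 / 2 + dist_scaled ld z + R + \<bar>\<phi> z - m\<bar>"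
      using \<psi>d[of z] by linarith
    then have "e\<^sup>2 \<le> (\<bar>\<psi> z - e\<bar> + 7 / 2 + dist_scaled ld z + R + \<bar>\<phi> z - m\<bar>)\<^sup>2"
      using e1 by (intro power_mono) auto
    also have "\<dots> \<le> 5 * (\<bar>\<psi> z - e\<bar>\<^sup>2 + (7 / 2)\<^sup>2 + (dist_scaled ld z)\<^sup>2 + R\<^sup>2 + \<bar>\<phi> z - m\<bar>\<^sup>2)"
      by (rule square_sum5_le)
    also have "\<dots> = 5 * W z" by (simp add: W_def)
    finally have "e\<^sup>2 \<le> 5 * W z" .
    moreover have "e\<^sup>2 * (1 - 4 / 9 * (\<phi> z - m)\<^sup>2) \<le> e\<^sup>2 * 1" by (intro mult_left_mono) auto
    ultimately show ?thesis by simp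
  next
    case False
    then have "ls * V < lam z * V" using lls V_pos by simp
    then have "3 / 2 \<le> \<phi> z - m" unfolding lsV using lamV[of z] mE by linarith
    then have "(3 / 2)\<^sup>2 \<le> (\<phi> z - m)\<^sup>2" by (rule power_mono) simp
    then have "1 - 4 / 9 * (\<phi> z - m)\<^sup>2 \<le> 0" by (simp add: power2_eq_square)
    then have "e\<^sup>2 * (1 - 4 / 9 * (\<phi> z - m)\<^sup>2) \<le> 0" by (simp add: mult_nonneg_nonpos)
    then show ?thesis using W0[of z] by simp
  qed
  have sq: "(a - b)\<^sup>2 = a\<^sup>2 - 2 * b * a + b\<^sup>2" for a b :: real by (simp add: power2_eq_square algebra_simps)
  have i\<psi>: "integrable ?G (\<lambda>z. (\<psi> z - e)\<^sup>2)" and i\<phi>: "integrable ?G (\<lambda>z. (\<phi> z - m)\<^sup>2)"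
    unfolding sq using \<psi>1 \<psi>2 \<phi>1 \<phi>2 by auto
  have vi\<psi>: "(\<integral>z. (\<psi> z - e)\<^sup>2 \<partial>?G) \<le> 1"
  proof -
    have "(\<integral>z. (\<psi> z - e)\<^sup>2 \<partial>?G) = (\<integral>z. (\<psi> z)\<^sup>2 \<partial>?G) - 2 * e * e + e\<^sup>2"
      unfolding sq using \<psi>1 \<psi>2 by (simp add: prob_space e_def)
    then show ?thesis using v\<psi> by (simp add: power2_eq_square)
  qed
  have vi\<phi>: "(\<integral>z. (\<phi> z - m)\<^sup>2 \<partial>?G) \<le> 1"
  proof -
    have "(\<integral>z. (\<phi> z - m)\<^sup>2 \<partial>?G) = (\<integral>z. (\<phi> z)\<^sup>2 \<partial>?G) - 2 * m * m + m\<^sup>2"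
      unfolding sq using \<phi>1 \<phi>2 by (simp add: prob_space m_def)
    then show ?thesis using v\<phi> by (simp add: power2_eq_square m_def)
  qed
  have iW: "integrable ?G W"
    unfolding W_def by (intro Bochner_Integration.integrable_add i\<psi> i\<phi> dist_scaled_integrable) auto
  have "(\<integral>z. e\<^sup>2 * (1 - 4 / 9 * (\<phi> z - m)\<^sup>2) \<partial>?G) \<le> (\<integral>z. 5 * W z \<partial>?G)"
    using i\<phi> iW point by (intro integral_mono) auto
  also have "(\<integral>z. e\<^sup>2 * (1 - 4 / 9 * (\<phi> z - m)\<^sup>2) \<partial>?G) = e\<^sup>2 * (1 - 4 / 9 * (\<integral>z. (\<phi> z - m)\<^sup>2 \<partial>?G))"
    using i\<phi> by (simp add: prob_space)
  also have "(\<integral>z. 5 * W z \<partial>?G) = 5 * ((\<integral>z. (\<psi> z - e)\<^sup>2 \<partial>?G) + (7 / 2)\<^sup>2 + (\<integral>z. (dist_scaled ld z)\<^sup>2 \<partial>?G) + R\<^sup>2 + (\<integral>z. (\<phi> z - m)\<^sup>2 \<partial>?G))"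
    unfolding W_def using i\<psi> i\<phi> dist_scaled_integrable[of ld] by (simp add: prob_space)
  also have "\<dots> \<le> 5 * (1 + (7 / 2)\<^sup>2 + Q + R\<^sup>2 + 1)"
    using vi\<psi> vi\<phi> Q by simp
  finally have 1: "e\<^sup>2 * (1 - 4 / 9 * (\<integral>z. (\<phi> z - m)\<^sup>2 \<partial>?G)) \<le> 5 * (1 + (7 / 2)\<^sup>2 + Q + R\<^sup>2 + 1)" .
  have "e\<^sup>2 * (5 / 9) \<le> e\<^sup>2 * (1 - 4 / 9 * (\<integral>z. (\<phi> z - m)\<^sup>2 \<partial>?G))"
    using vi\<phi> by (intro mult_left_mono) auto
  with 1 have e2: "e\<^sup>2 \<le> 9 * (57 / 4 + Q + R\<^sup>2)" by (simp add: power2_eq_square)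
  have "0 \<le> (\<integral>z. (dist_scaled ld z)\<^sup>2 \<partial>?G)" by simp
  then have Q0: "0 \<le> Q" using Q by linarith
  have "(\<integral>z. (dist_scaled l z)\<^sup>2 \<partial>?G) = (\<integral>z. (\<psi> z)\<^sup>2 \<partial>?G) - 1"
    unfolding d\<psi> using \<psi>2 by (simp add: prob_space)
  also have "\<dots> \<le> e\<^sup>2" using v\<psi> by simp
  also have "\<dots> \<le> 9 * (57 / 4 + Q + R\<^sup>2)" by (rule e2)
  also have "\<dots> \<le> 129 * (1 + Q + R\<^sup>2)" using Q0 zero_le_power2[of R] by simp
  also have "R\<^sup>2 = (l - lambda_star n \<theta>)\<^sup>2 * V\<^sup>2" by (simp add: R_def ls_def power_mult_distrib)
  finally show ?thesis .
qed

end

section \<open>A cheap subgradient from the taut path\<close>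

text \<open>
  Bounds on means of nonnegative functions in a form that is closed under sums and multiples, without
  separate integrability proofs.
\<close>

definition mean_le :: "'a measure \<Rightarrow> ('a \<Rightarrow> real) \<Rightarrow> real \<Rightarrow> bool" where
  "mean_le M f c \<longleftrightarrow> f \<in> borel_measurable M \<and> (\<forall>x. 0 \<le> f x) \<and> 0 \<le> c \<and> (\<integral>\<^sup>+x. ennreal (f x) \<partial>M) \<le> ennreal c"

lemma mean_le_mono: "mean_le M f c \<Longrightarrow> c \<le> d \<Longrightarrow> mean_le M f d"
  by (auto simp: mean_le_def intro: order_trans ennreal_leI)

lemma mean_le_add: "mean_le M f c \<Longrightarrow> mean_le M g d \<Longrightarrow> mean_le M (\<lambda>x. f x + g x) (c + d)"
  by (auto simp: mean_le_def nn_integral_add intro!: add_mono)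

lemma mean_le_sum:
  assumes "finite S" "\<And>s. s \<in> S \<Longrightarrow> mean_le M (f s) (c s)"
  shows "mean_le M (\<lambda>x. \<Sum>s\<in>S. f s x) (\<Sum>s\<in>S. c s)"
  using assms
proof (induction S rule: finite_induct)
  case empty
  then show ?case by (simp add: mean_le_def)
next
  case (insert s S)
  then show ?case using mean_le_add[of M "f s" "c s" "\<lambda>x. \<Sum>s\<in>S. f s x" "\<Sum>s\<in>S. c s"] by simp
qed

lemma mean_le_cmult:
  assumes "mean_le M f c" "0 \<le> a"
  shows "mean_le M (\<lambda>x. a * f x) (a * c)"
proof -
  have "(\<integral>\<^sup>+x. ennreal (a * f x) \<partial>M) = ennreal a * (\<integral>\<^sup>+x. ennreal (f x) \<partial>M)"
    using assms by (subst nn_integral_cmult[symmetric]) (auto simp: mean_le_def ennreal_mult)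
  also have "\<dots> \<le> ennreal a * ennreal c"
    using assms by (intro mult_left_mono) (auto simp: mean_le_def)
  also have "\<dots> = ennreal (a * c)"
    using assms by (simp add: mean_le_def ennreal_mult)
  finally show ?thesis using assms by (auto simp: mean_le_def)
qed

lemma (in prob_space) mean_le_const: "0 \<le> c \<Longrightarrow> mean_le M (\<lambda>_. c) c"
  by (simp add: mean_le_def emeasure_space_1)

lemma right_of_range: "t + m \<le> n \<Longrightarrow> right_of t ` {..<m} \<subseteq> {1..n}"
  by (auto simp: right_of_def)

lemma right_of_inj: "inj_on (right_of t) A"
  by (auto simp: right_of_def inj_on_def)

lemma left_of_range: "m \<le> t \<Longrightarrow> t \<le> n \<Longrightarrow> left_of t ` {..<m} \<subseteq> {1..n}"
  by (auto simp: left_of_def)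

lemma left_of_inj: "m \<le> t \<Longrightarrow> inj_on (left_of t) {..<m}"
  by (auto simp: left_of_def inj_on_def)

lemma mean_le_tube_cost:
  fixes N :: real
  assumes B: "B \<ge> 1" "real B \<le> N"
  shows "mean_le (gauss_vec {1..n}) (tube_cost (4 * sqrt (N * (1 + ln N))) n B) (17 * real (n div B + 1))"
proof -
  let ?r = "4 * sqrt (N * (1 + ln N))"
  let ?t = "block_end n B"
  have r0: "0 \<le> ?r" using B by simp
  have "mean_le (gauss_vec {1..n}) (block_cost ?r (right_of (?t q)) (?t (Suc q) - ?t q)) 17" for q
  proof -
    let ?b = "?t (Suc q) - ?t q"
    have le: "?t q + ?b \<le> n" by (auto simp: block_end_def)
    have bB: "?b \<le> B" by (auto simp: block_end_def min_def)
    have "(\<integral>\<^sup>+z. ennreal (block_cost ?r (right_of (?t q)) ?b z) \<partial>gauss_vec {1..n}) \<le> ennreal 17"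
    proof (cases "?b = 0")
      case True
      have "block_cost ?r (right_of (?t q)) ?b z = 0" for z
        unfolding True using r0 by (simp add: block_cost_def run_abs_def del: real_sqrt_mult)
      then show ?thesis by simp
    next
      case False
      have "real ?b \<le> N" using B bB by linarith
      then show ?thesis
        using False by (intro nn_integral_block_cost_le right_of_inj right_of_range le) auto
    qed
    then show ?thesis
      using block_cost_measurable[OF right_of_range[OF le]] by (simp add: mean_le_def block_cost_nonneg)
  qed
  from mean_le_sum[OF finite_lessThan[of "n div B + 1"] this, of "\<lambda>q. q"]
  show ?thesis unfolding tube_cost_def[abs_def] by (simp add: algebra_simps)
qed

lemma mean_le_envelope_cost:
  assumes "inj_on e {..<m}" "e ` {..<m} \<subseteq> {1..n}" "m \<ge> 1"
  shows "mean_le (gauss_vec {1..n}) (\<lambda>z. envelope_cost (walk e z) m) (64 * (1 + ln (real m)))"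
  using nn_integral_envelope_cost_le[of "{1..n}" e m] envelope_cost_measurable[of e m "{1..n}"] assms
  by (auto simp: mean_le_def envelope_cost_nonneg)

context jump_pieces
begin

lemma index_le_T: "p \<le> K \<Longrightarrow> p \<le> T p"
proof (induction p)
  case (Suc p)
  then show ?case using Tmono[of p] by simp
qed simp

lemma K_le_n: "K \<le> n"
  using index_le_T[of K] TK by simp

lemma sum_len: "(\<Sum>p<K. real (len p)) = real n"
proof -
  have "real n = (\<Sum>i\<in>{0<..T K}. 1)" by (simp add: TK)
  also have "\<dots> = (\<Sum>p<K. \<Sum>i\<in>{T p<..T (Suc p)}. 1)"
    by (rule sum_split_at_knots[OF less_imp_le[OF Tmono] T0])
  finally show ?thesis by (simp add: len_def)
qed

text \<open>
  Concavity of the logarithm, in the form \<open>ln (x / N) \<le> x / N - 1\<close> at the average piece length \<open>N\<close>.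
\<close>

lemma sum_ln_len_le: "(\<Sum>p<K. 1 + ln (real (len p))) \<le> real K * (1 + ln (real n / real K))"
proof -
  define N where "N = real n / real K"
  have N: "N > 0" using n_pos K2 by (auto simp: N_def)
  have "1 + ln (real (len p)) \<le> ln N + real (len p) / N" if "p < K" for p
  proof -
    have "ln (real (len p) / N) \<le> real (len p) / N - 1"
      using N len_pos[OF that] by (intro ln_le_minus_one) auto
    moreover have "ln (real (len p) / N) = ln (real (len p)) - ln N"
      using N len_pos[OF that] by (intro ln_divide_pos) auto
    ultimately show ?thesis by simp
  qed
  then have "(\<Sum>p<K. 1 + ln (real (len p))) \<le> (\<Sum>p<K. ln N + real (len p) / N)"
    by (intro sum_mono) auto
  also have "\<dots> = real K * ln N + real n / N"
    by (simp add: sum.distrib sum_divide_distrib[symmetric] sum_len)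
  also have "real n / N = real K" using n_pos K2 by (auto simp: N_def)
  finally show ?thesis by (simp add: N_def algebra_simps)
qed

definition path_cost :: "real \<Rightarrow> nat \<Rightarrow> (nat \<Rightarrow> real) \<Rightarrow> real" where
  "path_cost r B z = tube_cost r n B z + (\<Sum>p<K.
        2 * envelope_cost (walk (right_of (T p)) z) (len p)
        + 2 * envelope_cost (walk (left_of (T (Suc p))) z) (len p)
        + 4 * r\<^sup>2 * (\<sigma> p - \<sigma> (Suc p))\<^sup>2 / real (len p))"

text \<open>
  The pieces of a tube path are modified near the jumps by \<open>piece_path\<close> and glued again.
\<close>

lemma taut_string_path:
  assumes B: "B \<ge> 1" and r: "r \<ge> 0"
  shows "\<exists>y. (\<forall>p\<le>K. y (T p) = psum z (T p) + r * \<sigma> p) \<and> (\<forall>j\<le>n. \<bar>y j - psum z j\<bar> \<le> r)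
    \<and> step_cost 0 n y \<le> path_cost r B z"
proof -
  let ?c = "\<lambda>p. 2 * envelope_cost (walk (right_of (T p)) z) (len p)
        + 2 * envelope_cost (walk (left_of (T (Suc p))) z) (len p)
        + 4 * r\<^sup>2 * (\<sigma> p - \<sigma> (Suc p))\<^sup>2 / real (len p)"
  obtain mid where mid: "mid 0 = 0" "mid n = psum z n" "\<forall>j\<le>n. \<bar>mid j - psum z j\<bar> \<le> r"
    "step_cost 0 n mid \<le> tube_cost r n B z"
    using tube_path[OF B r, of n z] by blast
  have mono: "T p \<le> T (Suc p)" if "p < K" for p using Tmono[OF that] by simp
  have m0: "mid (T p) = psum z (T p)" if "p \<le> K" "\<sigma> p = 0" for p
  proof -
    have "p = 0 \<or> p = K"
      using sig_nz[of p] that le_neq_implies_less[of p K] gr0I[of p] by blast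
    then show ?thesis using mid(1,2) T0 TK by auto
  qed
  define P where "P p y \<longleftrightarrow> y (T p) = psum z (T p) + r * \<sigma> p \<and> y (T (Suc p)) = psum z (T (Suc p)) + r * \<sigma> (Suc p)
    \<and> (\<forall>j. T p \<le> j \<and> j \<le> T (Suc p) \<longrightarrow> \<bar>y j - psum z j\<bar> \<le> r)
    \<and> step_cost (T p) (T (Suc p)) y \<le> step_cost (T p) (T (Suc p)) mid + ?c p" for p y
  have "\<exists>y. P p y" if p: "p < K" for p
  proof -
    have "\<bar>mid j - psum z j\<bar> \<le> r" if "j \<le> T (Suc p)" for j
      using mid(3) T_le[of "Suc p"] that p by auto
    then show ?thesis
      unfolding P_def len_def add.assoc[symmetric]
      using Tmono[OF p] sigma_range[of p] sigma_range[of "Suc p"] r m0[of p] m0[of "Suc p"] p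
      by (intro piece_path) simp_all
  qed
  then have "\<forall>p. \<exists>y. p < K \<longrightarrow> P p y" by blast
  then obtain Y where Y': "\<forall>p. p < K \<longrightarrow> P p (Y p)"
    using choice[of "\<lambda>p y. p < K \<longrightarrow> P p y"] by blast
  have Y: "\<And>p. p < K \<Longrightarrow> Y p (T p) = psum z (T p) + r * \<sigma> p"
    "\<And>p. p < K \<Longrightarrow> Y p (T (Suc p)) = psum z (T (Suc p)) + r * \<sigma> (Suc p)"
    "\<And>p j. p < K \<Longrightarrow> T p \<le> j \<Longrightarrow> j \<le> T (Suc p) \<Longrightarrow> \<bar>Y p j - psum z j\<bar> \<le> r"
    "\<And>p. p < K \<Longrightarrow> step_cost (T p) (T (Suc p)) (Y p) \<le> step_cost (T p) (T (Suc p)) mid + ?c p"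
    using Y' unfolding P_def by simp_all
  obtain w where w: "\<And>p j. p < K \<Longrightarrow> T p \<le> j \<Longrightarrow> j \<le> T (Suc p) \<Longrightarrow> w j = Y p j"
    using glue_paths[of K T Y "\<lambda>p. psum z (T p) + r * \<sigma> p", OF mono Y(1,2)] T_inj by blast
  have "step_cost 0 n w = (\<Sum>p<K. step_cost (T p) (T (Suc p)) (Y p))"
    using step_cost_glue[of K T w Y, OF mono T0 w] TK by simp
  also have "\<dots> \<le> (\<Sum>p<K. step_cost (T p) (T (Suc p)) mid + ?c p)"
    by (intro sum_mono Y(4)) simp
  also have "\<dots> = step_cost 0 n mid + (\<Sum>p<K. ?c p)"
    using step_cost_glue[of K T mid "\<lambda>_. mid", OF mono T0] TK by (simp add: sum.distrib)
  also have "\<dots> \<le> path_cost r B z"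
    using mid(4) by (simp add: path_cost_def)
  finally have cost: "step_cost 0 n w \<le> path_cost r B z" .
  have "w (T p) = psum z (T p) + r * \<sigma> p" if "p \<le> K" for p
  proof (cases "p = K")
    case True
    then obtain q where "p = Suc q" "q < K" using K2 by (cases p) auto
    then show ?thesis using w[of q "T (Suc q)"] Y(2)[of q] mono by simp
  next
    case False
    then show ?thesis using w[of p "T p"] Y(1)[of p] mono[of p] that by simp
  qed
  moreover have "\<bar>w j - psum z j\<bar> \<le> r" if "j \<le> n" for j
    using piece_exists[OF that] w Y(3) by metis
  ultimately show ?thesis using cost by (intro exI[of _ w] conjI) simp_all
qed

text \<open>
  For the path \<open>w = (y - S) / r\<close> of the taut path \<open>y\<close>, with \<open>S\<close> the partial sums of \<open>z\<close>, the vector \<open>v\<close> of negated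
  increments is a subgradient and \<open>z - r * v\<close> is the vector of increments of \<open>y\<close>.
\<close>

lemma square_dist_le_path_cost:
  assumes r: "r > 0" and B: "B \<ge> 1"
  shows "(dist_scaled r z)\<^sup>2 \<le> path_cost r B z"
proof -
  obtain y where y: "\<forall>p\<le>K. y (T p) = psum z (T p) + r * \<sigma> p" "\<forall>j\<le>n. \<bar>y j - psum z j\<bar> \<le> r"
    "step_cost 0 n y \<le> path_cost r B z"
    using taut_string_path[OF B less_imp_le[OF r]] by blast
  define w where "w j = (y j - psum z j) / r" for j
  have wT: "w (T p) = \<sigma> p" if "p \<le> K" for p
    using y(1) that r by (simp add: w_def)
  have wb: "\<bar>w j\<bar> \<le> 1" if "j \<le> n" for j
    using y(2) that r by (simp add: w_def abs_divide divide_le_eq_1)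
  have v: "(\<lambda>i\<in>{1..n}. w (i - 1) - w i) \<in> SD" (is "?v \<in> SD")
    using wT[of 0] wT[of K] wT T0 TK sig0 sigK wb by (intro path_subgradient) auto
  have "(vnorm n (\<lambda>i. z i - r * ?v i))\<^sup>2 = (\<Sum>i\<in>{1..n}. (y i - y (i - 1))\<^sup>2)"
    unfolding L2_set_square_sum
  proof (rule sum.cong[OF refl])
    fix i assume i: "i \<in> {1..n}"
    then obtain j where j: "i = Suc j" by (cases i) auto
    have "r * ?v i = (y j - psum z j) - (y i - psum z i)"
      using i r by (simp add: w_def j diff_divide_distrib[symmetric])
    then have "z i - r * ?v i = y i - y (i - 1)"
      by (simp add: j)
    then show "(z i - r * ?v i)\<^sup>2 = (y i - y (i - 1))\<^sup>2" by simp
  qed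
  also have "\<dots> = step_cost 0 n y"
    unfolding step_cost_def by (intro sum.cong) auto
  finally have e: "(vnorm n (\<lambda>i. z i - r * ?v i))\<^sup>2 = step_cost 0 n y" .
  have "(dist_scaled r z)\<^sup>2 \<le> (vnorm n (\<lambda>i. z i - r * ?v i))\<^sup>2"
    by (intro power_mono dist_scaled_le v dist_scaled_nonneg)
  then show ?thesis using e y(3) by simp
qed

text \<open>
  There are at most \<open>2 * K\<close> blocks of mean cost 17, each piece has two envelopes of mean cost
  \<open>64 * (1 + ln (len p))\<close>, counted twice, and the ramps add \<open>4 * r\<^sup>2 * V\<^sup>2\<close>.
\<close>

theorem expected_square_dist_at_tube_width:
  fixes N L :: real
  defines "N \<equiv> real n / real K" and "L \<equiv> 1 + ln N"
  shows "(\<integral>z. (dist_scaled (4 * sqrt (N * L)) z)\<^sup>2 \<partial>gauss_vec {1..n}) \<le> 290 * real K * L + 64 * N * L * V\<^sup>2"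
proof -
  interpret prob_space "gauss_vec {1..n}" by (rule prob_space_gauss_vec)
  let ?G = "gauss_vec {1..n}"
  define r where "r = 4 * sqrt (N * L)"
  define B where "B = n div K"
  have K0: "K > 0" using K2 by simp
  have N1: "N \<ge> 1" using K_le_n K0 by (simp add: N_def)
  have L1: "L \<ge> 1" using N1 by (simp add: L_def)
  have r0: "r > 0" using N1 L1 by (simp add: r_def)
  have r2: "r\<^sup>2 = 16 * (N * L)" using N1 L1 by (simp add: r_def power_mult_distrib)
  have B1: "B \<ge> 1" using div_le_mono[OF K_le_n, of K] K0 by (simp add: B_def)
  have BN: "real B \<le> N"
  proof -
    have "real (B * K) \<le> real n" unfolding B_def by (intro of_nat_mono div_times_less_eq_dividend)
    then show ?thesis using K0 by (simp add: N_def pos_le_divide_eq)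
  qed
  \<comment> \<open>Rounding down costs at most a factor 2: \<open>n / K < B + 1 \<le> 2 * B\<close>.\<close>
  have blocks: "n div B + 1 \<le> 2 * K"
  proof -
    have "n < (B + 1) * K"
      using dividend_less_div_times[of K n] K0 by (simp add: B_def algebra_simps)
    also have "\<dots> \<le> (2 * K) * B" using B1 by (simp add: algebra_simps)
    finally have "n div B < 2 * K" using B1 by (intro less_mult_imp_div_less) (simp add: mult.commute)
    then show ?thesis by simp
  qed
  have tube: "mean_le ?G (tube_cost r n B) (34 * real K)"
  proof (rule mean_le_mono)
    show "mean_le ?G (tube_cost r n B) (17 * real (n div B + 1))"
      unfolding r_def L_def by (rule mean_le_tube_cost[OF B1 BN])
    have "real (n div B + 1) \<le> real (2 * K)" using blocks by (rule of_nat_mono)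
    then show "17 * real (n div B + 1) \<le> 34 * real K" by simp
  qed
  have piece: "mean_le ?G (\<lambda>z. 2 * envelope_cost (walk (right_of (T p)) z) (len p)
        + 2 * envelope_cost (walk (left_of (T (Suc p))) z) (len p)
        + 4 * r\<^sup>2 * (\<sigma> p - \<sigma> (Suc p))\<^sup>2 / real (len p))
     (2 * (64 * (1 + ln (real (len p)))) + 2 * (64 * (1 + ln (real (len p)))) + 4 * r\<^sup>2 * (\<sigma> p - \<sigma> (Suc p))\<^sup>2 / real (len p))"
    if "p \<in> {..<K}" for p
  proof -
    have p: "p < K" using that by simp
    have l1: "len p \<ge> 1" using len_pos[OF p] by simp
    have a: "T p + len p \<le> n" "len p \<le> T (Suc p)" "T (Suc p) \<le> n"
      using T_le[of "Suc p"] Tmono[OF p] p by (auto simp: len_def)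
    show ?thesis
      by (intro mean_le_add mean_le_cmult mean_le_const mean_le_envelope_cost right_of_inj left_of_inj
          right_of_range left_of_range a l1) auto
  qed
  have "mean_le ?G (path_cost r B) (34 * real K + (\<Sum>p<K. 2 * (64 * (1 + ln (real (len p)))) + 2 * (64 * (1 + ln (real (len p))))
      + 4 * r\<^sup>2 * (\<sigma> p - \<sigma> (Suc p))\<^sup>2 / real (len p)))"
    unfolding path_cost_def[abs_def] by (intro mean_le_add tube mean_le_sum piece) auto
  also have "(\<Sum>p<K. 2 * (64 * (1 + ln (real (len p)))) + 2 * (64 * (1 + ln (real (len p))))
      + 4 * r\<^sup>2 * (\<sigma> p - \<sigma> (Suc p))\<^sup>2 / real (len p))
    = 256 * (\<Sum>p<K. 1 + ln (real (len p))) + 4 * r\<^sup>2 * V\<^sup>2"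
  proof -
    have "(\<Sum>p<K. 2 * (64 * (1 + ln (real (len p)))) + 2 * (64 * (1 + ln (real (len p))))
      + 4 * r\<^sup>2 * (\<sigma> p - \<sigma> (Suc p))\<^sup>2 / real (len p))
      = (\<Sum>p<K. 256 * (1 + ln (real (len p))) + 4 * r\<^sup>2 * ((\<sigma> p - \<sigma> (Suc p))\<^sup>2 / real (len p)))"
      by (intro sum.cong refl) simp
    then show ?thesis
      unfolding V_square sum.distrib[of "\<lambda>p. 256 * _ p"] sum_distrib_left by (simp add: sum.distrib)
  qed
  finally have m: "mean_le ?G (path_cost r B) (34 * real K + (256 * (\<Sum>p<K. 1 + ln (real (len p))) + 4 * r\<^sup>2 * V\<^sup>2))" .
  have "34 * real K + (256 * (\<Sum>p<K. 1 + ln (real (len p))) + 4 * r\<^sup>2 * V\<^sup>2)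
    \<le> 34 * (real K * L) + (256 * (real K * L) + 64 * N * L * V\<^sup>2)"
  proof (intro add_mono mult_left_mono)
    show "real K \<le> real K * L" using L1 K0 by simp
    show "(\<Sum>p<K. 1 + ln (real (len p))) \<le> real K * L"
      using sum_ln_len_le by (simp add: L_def N_def)
    show "4 * r\<^sup>2 * V\<^sup>2 \<le> 64 * N * L * V\<^sup>2" by (simp add: r2)
  qed auto
  also have "\<dots> = 290 * real K * L + 64 * N * L * V\<^sup>2" by simp
  finally have m2: "mean_le ?G (path_cost r B) (290 * real K * L + 64 * N * L * V\<^sup>2)"
    by (rule mean_le_mono[OF m])
  have "ennreal (\<integral>z. (dist_scaled r z)\<^sup>2 \<partial>?G) = (\<integral>\<^sup>+z. ennreal ((dist_scaled r z)\<^sup>2) \<partial>?G)"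
    by (rule nn_integral_eq_integral[symmetric]) (auto intro: dist_scaled_integrable)
  also have "\<dots> \<le> (\<integral>\<^sup>+z. ennreal (path_cost r B z) \<partial>?G)"
    by (intro nn_integral_mono ennreal_leI square_dist_le_path_cost r0 B1)
  also have "\<dots> \<le> ennreal (290 * real K * L + 64 * N * L * V\<^sup>2)"
    using m2 by (simp add: mean_le_def)
  finally show ?thesis
    using m2 unfolding r_def[symmetric] by (simp add: mean_le_def ennreal_le_iff)
qed

lemma dist_scaled_measurable: "dist_scaled l \<in> borel_measurable (gauss_vec {1..n})"
proof -
  interpret P: convex_projection "{1..n}" "(\<lambda>v i. l * v i) ` SD" "\<lambda>z i. l * nearest l z i"
    by (rule convex_projection_dilate)
  show ?thesis using P.distance_measurable unfolding dist_scaled_def[abs_def] .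
qed

text \<open>
  The estimator enters the integrand only through its pointwise bound, which is a measurable function of
  the standardised data.
\<close>

theorem risk_le_expected_square_dist:
  assumes s: "s > 0" and l: "l \<ge> 0"
  shows "risk n s (tv_estimator n s l) \<theta> \<le> ennreal (s\<^sup>2 / real n * (\<integral>z. (dist_scaled l z)\<^sup>2 \<partial>gauss_vec {1..n}))"
proof -
  let ?I = "{1..n}"
  define F where "F y = s\<^sup>2 * (dist_scaled l (\<lambda>i\<in>?I. (y i - \<theta> i) / s))\<^sup>2" for y
  have "(\<lambda>y. \<lambda>i\<in>?I. (y i - \<theta> i) / s) \<in> measurable (gauss n \<theta> s) (gauss_vec ?I)"
    unfolding gauss_def by (intro measurable_restrict) simp
  from measurable_compose[OF this dist_scaled_measurable[of l]]
  have Fm: "(\<lambda>y. ennreal (F y)) \<in> borel_measurable (gauss n \<theta> s)"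
    unfolding F_def by simp
  have loss: "(vnorm n (\<lambda>i. tv_estimator n s l y i - \<theta> i))\<^sup>2 \<le> F y" for y
  proof -
    let ?z = "\<lambda>i\<in>?I. (y i - \<theta> i) / s"
    let ?v = "nearest l ?z"
    have "vnorm n (\<lambda>i. tv_estimator n s l y i - \<theta> i) \<le> vnorm n (\<lambda>i. (y i - \<theta> i) - s * l * ?v i)"
      by (rule tv_estimator_loss_le[OF s l theta nearest(1)])
    also have "\<dots> = vnorm n (\<lambda>i. s * (?z i - l * ?v i))"
      using s by (intro L2_set_cong refl) (simp add: right_diff_distrib[of s "_ / _"])
    also have "\<dots> = s * dist_scaled l ?z"
      unfolding dist_scaled_def using s by (intro L2_set_right_distrib[symmetric]) simp
    finally have "(vnorm n (\<lambda>i. tv_estimator n s l y i - \<theta> i))\<^sup>2 \<le> (s * dist_scaled l ?z)\<^sup>2"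
      by (rule power_mono) simp
    then show ?thesis by (simp add: F_def power_mult_distrib)
  qed
  have "(\<integral>\<^sup>+y. ennreal ((vnorm n (\<lambda>i. tv_estimator n s l y i - \<theta> i))\<^sup>2) \<partial>gauss n \<theta> s)
    \<le> (\<integral>\<^sup>+y. ennreal (F y) \<partial>gauss n \<theta> s)"
    by (intro nn_integral_mono ennreal_leI loss)
  also have "\<dots> = (\<integral>\<^sup>+y. ennreal (F y) \<partial>distr (gauss_vec ?I) (gauss n \<theta> s) (\<lambda>z. \<lambda>i\<in>?I. \<theta> i + s * z i))"
    using gauss_eq_distr(1)[OF s, of n \<theta>] by simp
  also have "\<dots> = (\<integral>\<^sup>+z. ennreal (F (\<lambda>i\<in>?I. \<theta> i + s * z i)) \<partial>gauss_vec ?I)"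
    by (rule nn_integral_distr[OF gauss_eq_distr(2)[OF s]]) (simp only: measurable_distr_eq1 Fm)
  also have "\<dots> = (\<integral>\<^sup>+z. ennreal (s\<^sup>2 * (dist_scaled l z)\<^sup>2) \<partial>gauss_vec ?I)"
  proof (rule nn_integral_cong)
    fix z assume "z \<in> space (gauss_vec ?I)"
    then have "(\<lambda>i\<in>?I. ((\<lambda>i\<in>?I. \<theta> i + s * z i) i - \<theta> i) / s) = z"
      using s by (auto simp: space_gauss_vec PiE_iff extensional_def fun_eq_iff)
    then show "ennreal (F (\<lambda>i\<in>?I. \<theta> i + s * z i)) = ennreal (s\<^sup>2 * (dist_scaled l z)\<^sup>2)"
      by (simp only: F_def)
  qed
  also have "\<dots> = ennreal (\<integral>z. s\<^sup>2 * (dist_scaled l z)\<^sup>2 \<partial>gauss_vec ?I)"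
    by (rule nn_integral_eq_integral) (auto intro: dist_scaled_integrable)
  also have "\<dots> = ennreal (s\<^sup>2 * (\<integral>z. (dist_scaled l z)\<^sup>2 \<partial>gauss_vec ?I))" by simp
  finally have "risk n s (tv_estimator n s l) \<theta> \<le> ennreal (1 / real n) * ennreal (s\<^sup>2 * (\<integral>z. (dist_scaled l z)\<^sup>2 \<partial>gauss_vec ?I))"
    unfolding risk_def by (rule mult_left_mono) simp
  also have "\<dots> = ennreal (s\<^sup>2 / real n * (\<integral>z. (dist_scaled l z)\<^sup>2 \<partial>gauss_vec ?I))"
    by (subst ennreal_mult[symmetric]) auto
  finally show ?thesis .
qed

theorem risk_bound:
  fixes N L S :: real
  assumes s: "s > 0" and l: "l \<ge> lambda_star n \<theta>"
  defines "N \<equiv> real n / real K" and "L \<equiv> 1 + ln N"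
    and "S \<equiv> \<Sum>p<K. of_bool (\<sigma> p \<noteq> \<sigma> (Suc p)) / real (len p)"
  shows "risk n s (tv_estimator n s l) \<theta>
    \<le> ennreal (40000 * s\<^sup>2 / real n * (real K * L + N * L * S + (l - lambda_star n \<theta>)\<^sup>2 * S))"
proof -
  let ?ls = "lambda_star n \<theta>"
  interpret prob_space "gauss_vec {1..n}" by (rule prob_space_gauss_vec)
  have K0: "K > 0" using K2 by simp
  have N1: "N \<ge> 1" using K_le_n K0 by (simp add: N_def)
  have L1: "L \<ge> 1" using N1 by (simp add: L_def)
  have "0 \<le> (\<integral>z. lam z \<partial>gauss_vec {1..n})"
    by (intro integral_nonneg_AE AE_I2 lambda_of_minimal(1))
  moreover have "0 \<le> 2 / V" using V_pos by simp
  ultimately have l0: "l \<ge> 0" using l lambda_star_eq by linarith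
  have VS: "V\<^sup>2 \<le> 4 * S" using V_square_le by (simp add: S_def)
  have KL: "1 \<le> real K * L"
  proof -
    have "1 * 1 \<le> real K * L" using K0 L1 by (intro mult_mono) auto
    then show ?thesis by simp
  qed
  have NL: "0 \<le> 64 * N * L" using N1 L1 by simp
  have "(\<integral>z. (dist_scaled l z)\<^sup>2 \<partial>gauss_vec {1..n})
    \<le> 129 * (1 + (290 * real K * L + 64 * N * L * V\<^sup>2) + (l - ?ls)\<^sup>2 * V\<^sup>2)"
    using expected_square_dist_at_tube_width N1 L1
    by (intro expected_square_dist_le[OF l, of "4 * sqrt (N * L)"]) (simp_all add: N_def L_def)
  also have "\<dots> \<le> 129 * (real K * L + (290 * real K * L + 64 * N * L * (4 * S)) + (l - ?ls)\<^sup>2 * (4 * S))"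
    by (intro mult_left_mono add_mono VS KL NL order_refl) auto
  also have "\<dots> \<le> 40000 * (real K * L + N * L * S + (l - ?ls)\<^sup>2 * S)"
  proof -
    have "0 \<le> S" by (simp add: S_def sum_nonneg)
    then have "0 \<le> N * L * S" "0 \<le> (l - ?ls)\<^sup>2 * S" using N1 L1 by auto
    moreover have "0 \<le> real K * L" using KL by simp
    ultimately show ?thesis by (simp add: algebra_simps)
  qed
  finally have "s\<^sup>2 / real n * (\<integral>z. (dist_scaled l z)\<^sup>2 \<partial>gauss_vec {1..n})
    \<le> s\<^sup>2 / real n * (40000 * (real K * L + N * L * S + (l - ?ls)\<^sup>2 * S))"
    by (rule mult_left_mono) simp
  also have "\<dots> = 40000 * s\<^sup>2 / real n * (real K * L + N * L * S + (l - ?ls)\<^sup>2 * S)" by simp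
  finally show ?thesis
    using risk_le_expected_square_dist[OF s l0] by (meson ennreal_leI order_trans)
qed

end

section \<open>The jumps of a signal and the risk bound\<close>

lemma knot_properties:
  fixes \<theta> :: "nat \<Rightarrow> real"
  assumes n: "n \<ge> 2"
  defines "k \<equiv> num_jumps n \<theta>"
  shows "knot n \<theta> 0 = 1" "knot n \<theta> (k + 1) = n + 1"
    and "\<And>p. p \<le> k \<Longrightarrow> knot n \<theta> p < knot n \<theta> (p + 1)"
    and "\<And>p. 1 \<le> p \<Longrightarrow> p \<le> k \<Longrightarrow> knot n \<theta> p \<in> jumps n \<theta>"
    and "\<And>p j. p \<le> k \<Longrightarrow> knot n \<theta> p < j \<Longrightarrow> j < knot n \<theta> (p + 1) \<Longrightarrow> j \<notin> jumps n \<theta>"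
proof -
  define xs where "xs = sorted_list_of_set (jumps n \<theta>)"
  define ys where "ys = 1 # xs @ [n + 1]"
  have fin: "finite (jumps n \<theta>)" by (simp add: jumps_def)
  have set_xs: "set xs = jumps n \<theta>" using fin by (simp add: xs_def)
  have len: "length xs = k" by (simp add: xs_def k_def num_jumps_def)
  have knot: "knot n \<theta> p = ys ! p" for p by (simp add: knot_def ys_def xs_def)
  have sxs: "sorted_wrt (<) xs" by (simp add: xs_def)
  have range: "\<And>x. x \<in> set xs \<Longrightarrow> 2 \<le> x \<and> x \<le> n" by (auto simp: set_xs jumps_def)
  have "sorted_wrt (<) (xs @ [n + 1])"
    using sxs range by (auto simp: sorted_wrt_append less_Suc_eq_le)
  then have sys: "sorted_wrt (<) ys"
    unfolding ys_def using range n by fastforce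
  have ly: "length ys = k + 2" by (simp add: ys_def len)
  show "knot n \<theta> 0 = 1" by (simp add: knot ys_def)
  show "knot n \<theta> (k + 1) = n + 1" by (simp add: knot ys_def len nth_append)
  show mono: "knot n \<theta> p < knot n \<theta> (p + 1)" if "p \<le> k" for p
    unfolding knot using sorted_wrt_nth_less[OF sys, of p "p + 1"] that ly by simp
  show "knot n \<theta> p \<in> jumps n \<theta>" if "1 \<le> p" "p \<le> k" for p
  proof -
    have "ys ! p = xs ! (p - 1)" using that len by (auto simp: ys_def nth_Cons' nth_append)
    then show ?thesis unfolding knot using that len set_xs by (metis diff_less less_le_trans nth_mem zero_less_one One_nat_def Suc_le_eq Suc_pred' not_less_eq_eq)
  qed
  show "j \<notin> jumps n \<theta>" if p: "p \<le> k" "knot n \<theta> p < j" "j < knot n \<theta> (p + 1)" for p j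
  proof
    assume "j \<in> jumps n \<theta>"
    then have "j \<in> set ys" by (simp add: ys_def set_xs)
    then obtain q where q: "q < length ys" "j = ys ! q" by (auto simp: in_set_conv_nth)
    have nl: "ys ! a \<le> ys ! b" if "a \<le> b" "b < length ys" for a b
      using sorted_wrt_nth_less[OF sys, of a b] that by (cases "a = b") auto
    show False
    proof (cases "q \<le> p")
      case True
      then show False using nl[of q p] p q ly by (simp add: knot)
    next
      case False
      then show False using nl[of "p + 1" q] p q ly by (simp add: knot)
    qed
  qed
qed

lemma jump_pieces_of_theta:
  assumes n: "n \<ge> 2" and \<theta>: "\<theta> \<in> Rn n" and k: "num_jumps n \<theta> \<ge> 1"
  shows "jump_pieces n \<theta> (\<lambda>p. knot n \<theta> p - 1) (num_jumps n \<theta> + 1) (\<lambda>p. real_of_int (jump_sign n \<theta> p))"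
proof -
  let ?k = "num_jumps n \<theta>"
  note K = knot_properties[OF n, where \<theta>=\<theta>]
  have pos: "1 \<le> knot n \<theta> p" if "p \<le> ?k + 1" for p
    using that
  proof (induction p)
    case (Suc p)
    then show ?case using K(3)[of p] by simp
  qed (simp add: K(1))
  show ?thesis
  proof
    fix p assume "p < ?k + 1"
    then show "knot n \<theta> p - 1 < knot n \<theta> (Suc p) - 1" using K(3)[of p] pos[of p] by simp
  next
    fix p j assume p: "p < ?k + 1" "knot n \<theta> p - 1 < j" "j < knot n \<theta> (Suc p) - 1"
    have "knot n \<theta> (Suc p) \<le> n + 1"
    proof -
      have "knot n \<theta> q \<le> knot n \<theta> (?k + 1)" if "q \<le> ?k + 1" for q
        using that
      proof (induction rule: inc_induct)
        case (step q)
        then show ?case using K(3)[of q] by simp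
      qed simp
      then show ?thesis using p K(2) by simp
    qed
    then have j: "1 \<le> j" "Suc j \<le> n" using p by auto
    have "Suc j \<notin> jumps n \<theta>" using p by (intro K(5)[of p]) auto
    then show "\<theta> (Suc j) = \<theta> j" using j by (auto simp: jumps_def)
  next
    fix p assume p: "0 < p" "p < ?k + 1"
    then have J: "knot n \<theta> p \<in> jumps n \<theta>" by (intro K(4)) auto
    then have s: "Suc (knot n \<theta> p - 1) = knot n \<theta> p" by (auto simp: jumps_def)
    have ne: "\<theta> (knot n \<theta> p - 1) \<noteq> \<theta> (knot n \<theta> p)" using J by (auto simp: jumps_def)
    show "real_of_int (jump_sign n \<theta> p) = sgn (\<theta> (Suc (knot n \<theta> p - 1)) - \<theta> (knot n \<theta> p - 1))"
      unfolding s using ne p by (auto simp: jump_sign_def sgn_if)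
    show "real_of_int (jump_sign n \<theta> p) \<noteq> 0" using p by (auto simp: jump_sign_def)
  qed (use \<theta> k K(1,2) in \<open>auto simp: jump_sign_def\<close>)
qed

text \<open>
  Truncation only shortens the pieces, and the two outer pieces always count as sign changes.
\<close>

lemma piece_sum_le_delta1_square:
  assumes n: "n \<ge> 2" and k: "num_jumps n \<theta> \<ge> 1"
  shows "(\<Sum>i = 0..num_jumps n \<theta>. of_bool (jump_sign n \<theta> i \<noteq> jump_sign n \<theta> (i + 1)) / real (piece_length n \<theta> i))
    \<le> (delta1 n \<theta>)\<^sup>2"
proof -
  let ?k = "num_jumps n \<theta>" and ?s = "jump_sign n \<theta>" and ?m = "piece_length n \<theta>" and ?t = "trunc_length n \<theta>"
  have mpos: "?m i > 0" if "i \<le> ?k" for i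
    using knot_properties(3)[OF n that] by (simp add: piece_length_def)
  have tpos: "?t i > 0" if "i \<le> ?k" for i
    using mpos[OF that] n by (simp add: trunc_length_def)
  have le: "of_bool b / real (?m i) \<le> inverse (?t i) * of_bool b" if "i \<le> ?k" for i b
    using tpos[OF that] by (auto simp: trunc_length_def divide_inverse intro!: le_imp_inverse_le)
  have split: "{0..?k} = insert 0 (insert ?k {1..?k - 1})" using k by auto
  have "(\<Sum>i = 0..?k. of_bool (?s i \<noteq> ?s (i + 1)) / real (?m i))
    \<le> (\<Sum>i = 0..?k. inverse (?t i) * of_bool (?s i \<noteq> ?s (i + 1)))"
    by (intro sum_mono le) auto
  also have "\<dots> = inverse (?t 0) * of_bool (?s 0 \<noteq> ?s 1) + inverse (?t ?k) * of_bool (?s ?k \<noteq> ?s (?k + 1))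
      + (\<Sum>i = 1..?k - 1. inverse (?t i) * of_bool (?s i \<noteq> ?s (i + 1)))"
    unfolding split using k by (subst sum.insert; simp)
  also have "\<dots> \<le> inverse (?t 0) + inverse (?t ?k) + (\<Sum>i = 1..?k - 1. inverse (?t i) * of_bool (?s i \<noteq> ?s (i + 1)))"
    using tpos[of 0] tpos[of ?k] by (intro add_mono) auto
  also have "\<dots> = (delta1 n \<theta>)\<^sup>2"
  proof -
    have "0 \<le> inverse (?t 0) + inverse (?t ?k) + (\<Sum>i = 1..?k - 1. inverse (?t i) * of_bool (?s i \<noteq> ?s (i + 1)))"
      using tpos[of 0] tpos[of ?k] less_imp_le[OF tpos] by (intro add_nonneg_nonneg sum_nonneg mult_nonneg_nonneg) auto
    then show ?thesis by (simp add: delta1_def Let_def)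
  qed
  finally show ?thesis .
qed

theorem corollary2p8:
  "\<exists>(C :: real) (Cmin :: real \<Rightarrow> real). \<forall>(n :: nat) (\<sigma> :: real) (\<theta> :: nat \<Rightarrow> real).
     n \<ge> 2 \<longrightarrow> \<sigma> > 0 \<longrightarrow> \<theta> \<in> Rn n \<longrightarrow> num_jumps n \<theta> \<ge> 1 \<longrightarrow>
     (let k = num_jumps n \<theta>; s = jump_sign n \<theta>; m = piece_length n \<theta>;
          ls = lambda_star n \<theta> in
       (\<forall>l \<ge> ls. risk n \<sigma> (tv_estimator n \<sigma> l) \<theta>
          \<le> ennreal (C * \<sigma>\<^sup>2 * (Delta1 n \<theta> +
               (l - ls)\<^sup>2 / real n * (\<Sum>i = 0..k. of_bool (s i \<noteq> s (i + 1)) / real (m i))))) \<and>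
       (\<forall>c. 0 < c \<longrightarrow> c \<le> 1 \<longrightarrow>
          (\<forall>i \<in> {0..k}. s i \<noteq> s (i + 1) \<longrightarrow> real (m i) \<ge> c * real n / (real k + 1)) \<longrightarrow>
          (\<forall>l \<ge> ls. risk n \<sigma> (tv_estimator n \<sigma> l) \<theta>
             \<le> ennreal (Cmin c * \<sigma>\<^sup>2 *
                  ((real k + 1) / real n * ln (exp 1 * real n / (real k + 1)) +
                   (l - ls)\<^sup>2 * ((real k + 1) / (real n)\<^sup>2) *
                     (\<Sum>i = 0..k. of_bool (s i \<noteq> s (i + 1))))))))"
proof (rule exI[of _ 40000], rule exI[of _ "\<lambda>c. 80000 / c"], intro allI impI)
  fix n :: nat and \<sigma> :: real and \<theta> :: "nat \<Rightarrow> real"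
  assume n: "n \<ge> 2" and \<sigma>: "\<sigma> > 0" and \<theta>: "\<theta> \<in> Rn n" and k1: "num_jumps n \<theta> \<ge> 1"
  define k where "k = num_jumps n \<theta>"
  define s where "s = jump_sign n \<theta>"
  define m where "m = piece_length n \<theta>"
  define ls where "ls = lambda_star n \<theta>"
  define L where "L = ln (exp 1 * real n / (real k + 1))"
  define S where "S = (\<Sum>i = 0..k. of_bool (s i \<noteq> s (i + 1)) / real (m i))"
  define H where "H = (\<Sum>i = 0..k. of_bool (s i \<noteq> s (i + 1)) :: real)"
  interpret jump_pieces n \<theta> "\<lambda>p. knot n \<theta> p - 1" "k + 1" "\<lambda>p. real_of_int (s p)"
    unfolding k_def s_def by (rule jump_pieces_of_theta[OF n \<theta> k1])
  have kn: "real k + 1 \<le> real n" using K_le_n by simp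
  have n0: "real n > 0" using n by simp
  have Leq: "1 + ln (real n / real (k + 1)) = L"
    using n0 by (simp add: L_def ln_mult ln_divide_pos add.commute)
  have L1: "L \<ge> 1" unfolding Leq[symmetric] using kn by (simp add: add.commute)
  have m_len: "len p = m p" if "p \<le> k" for p
  proof -
    have "knot n \<theta> p \<ge> 1"
    proof (cases p)
      case 0
      then show ?thesis using knot_properties(1)[OF n] by simp
    next
      case (Suc q)
      then have "knot n \<theta> q < knot n \<theta> (q + 1)"
        using that by (intro knot_properties(3)[OF n]) (simp add: k_def)
      then show ?thesis unfolding Suc Suc_eq_plus1 by linarith
    qed
    then show ?thesis by (simp add: len_def m_def piece_length_def Suc_eq_plus1 del: add_Suc_right)
  qed
  have Seq: "(\<Sum>p<k + 1. of_bool (real_of_int (s p) \<noteq> real_of_int (s (Suc p))) / real (len p)) = S"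
    unfolding S_def by (intro sum.cong) (auto simp: m_len Suc_eq_plus1)
  have S0: "S \<ge> 0" by (simp add: S_def sum_nonneg)
  have main: "risk n \<sigma> (tv_estimator n \<sigma> l) \<theta>
    \<le> ennreal (40000 * \<sigma>\<^sup>2 / real n * (real (k + 1) * L + real n / real (k + 1) * L * S + (l - ls)\<^sup>2 * S))"
    if "l \<ge> ls" for l
    using risk_bound[OF \<sigma>, of l] that unfolding Seq Leq ls_def by simp
  have A: "risk n \<sigma> (tv_estimator n \<sigma> l) \<theta> \<le> ennreal (40000 * \<sigma>\<^sup>2 * (Delta1 n \<theta> + (l - ls)\<^sup>2 / real n * S))"
    if l: "l \<ge> ls" for l
  proof (rule order_trans[OF main[OF l]], rule ennreal_leI)
    have Sd: "S \<le> (delta1 n \<theta>)\<^sup>2"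
      unfolding S_def s_def m_def k_def by (rule piece_sum_le_delta1_square[OF n k1])
    have d0: "delta1 n \<theta> \<ge> 0"
    proof -
      have "0 \<le> trunc_length n \<theta> i" for i by (simp add: trunc_length_def)
      then show ?thesis unfolding delta1_def Let_def
        by (intro real_sqrt_ge_zero add_nonneg_nonneg sum_nonneg mult_nonneg_nonneg) auto
    qed
    have D: "Delta1 n \<theta> = (real k + 1) / real n * L + (delta1 n \<theta>)\<^sup>2 / real n * (real n / (real k + 1)) * L + delta1 n \<theta> / sqrt (real n)"
      by (simp add: Delta1_def Let_def k_def L_def)
    have "real n / real (k + 1) * L * S \<le> real n / real (k + 1) * L * (delta1 n \<theta>)\<^sup>2"
      using L1 n0 by (intro mult_left_mono Sd mult_nonneg_nonneg) auto
    then have "(real (k + 1) * L + real n / real (k + 1) * L * S + (l - ls)\<^sup>2 * S) / real n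
      \<le> (real (k + 1) * L + real n / real (k + 1) * L * (delta1 n \<theta>)\<^sup>2 + (l - ls)\<^sup>2 * S) / real n"
      by (intro divide_right_mono) auto
    also have "\<dots> = (real k + 1) / real n * L + (delta1 n \<theta>)\<^sup>2 / real n * (real n / (real k + 1)) * L + (l - ls)\<^sup>2 / real n * S"
    proof -
      have "(q * L + a / q * L * d + r * S) / a = q / a * L + d / a * (a / q) * L + r / a * S" for q a d r :: real
        by (simp add: add_divide_distrib mult_ac)
      moreover have "real (k + 1) = real k + 1" by simp
      ultimately show ?thesis by (simp only:)
    qed
    also have "\<dots> \<le> Delta1 n \<theta> + (l - ls)\<^sup>2 / real n * S"
      unfolding D using d0 by simp
    finally have "(40000 * \<sigma>\<^sup>2) * ((real (k + 1) * L + real n / real (k + 1) * L * S + (l - ls)\<^sup>2 * S) / real n)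
      \<le> (40000 * \<sigma>\<^sup>2) * (Delta1 n \<theta> + (l - ls)\<^sup>2 / real n * S)"
      by (rule mult_left_mono) simp
    then show "40000 * \<sigma>\<^sup>2 / real n * (real (k + 1) * L + real n / real (k + 1) * L * S + (l - ls)\<^sup>2 * S)
      \<le> 40000 * \<sigma>\<^sup>2 * (Delta1 n \<theta> + (l - ls)\<^sup>2 / real n * S)" by simp
  qed
  have B: "risk n \<sigma> (tv_estimator n \<sigma> l) \<theta>
      \<le> ennreal (80000 / c * \<sigma>\<^sup>2 * ((real k + 1) / real n * L + (l - ls)\<^sup>2 * ((real k + 1) / (real n)\<^sup>2) * H))"
    if c: "0 < c" "c \<le> 1" and min: "\<forall>i\<in>{0..k}. s i \<noteq> s (i + 1) \<longrightarrow> real (m i) \<ge> c * real n / (real k + 1)" and l: "l \<ge> ls"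
    for c l
  proof (rule order_trans[OF main[OF l]], rule ennreal_leI)
    have H: "0 \<le> H" "H \<le> real k + 1"
    proof -
      show "0 \<le> H" by (simp add: H_def sum_nonneg)
      have "H \<le> (\<Sum>i = 0..k. 1)" unfolding H_def by (intro sum_mono) auto
      then show "H \<le> real k + 1" by simp
    qed
    have q0: "c * real n / (real k + 1) > 0" using c n0 by (intro divide_pos_pos mult_pos_pos) auto
    have SH: "S \<le> (real k + 1) / (c * real n) * H"
      unfolding S_def H_def sum_distrib_left
    proof (rule sum_mono)
      fix i assume i: "i \<in> {0..k}"
      show "of_bool (s i \<noteq> s (i + 1)) / real (m i) \<le> (real k + 1) / (c * real n) * of_bool (s i \<noteq> s (i + 1))"
      proof (cases "s i = s (i + 1)")
        case False
        have le: "c * real n / (real k + 1) \<le> real (m i)" using min i False by blast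
        have m0: "0 < real (m i)" using q0 le by linarith
        have "1 / real (m i) \<le> 1 / (c * real n / (real k + 1))"
          by (rule divide_left_mono[OF le _ mult_pos_pos[OF m0 q0]]) simp
        then show ?thesis using False by simp
      qed simp
    qed
    have e1: "real n / real (k + 1) * L * S \<le> (real k + 1) * L / c"
    proof -
      have "real n / real (k + 1) * L * S \<le> real n / real (k + 1) * L * ((real k + 1) / (c * real n) * H)"
        using L1 n0 by (intro mult_left_mono SH mult_nonneg_nonneg) auto
      also have "\<dots> = L / c * H"
      proof -
        have "a / q * L * (q / (c * a) * H) = L / c * H" if "a > 0" "q > 0" for a q :: real
          using that c by simp
        moreover have "real (k + 1) = real k + 1" by simp
        ultimately show ?thesis using n0 by (simp only:)
      qed
      also have "\<dots> \<le> L / c * (real k + 1)" using L1 c H by (intro mult_left_mono) auto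
      finally show ?thesis by (simp add: mult.commute)
    qed
    have e2: "(l - ls)\<^sup>2 * S \<le> (l - ls)\<^sup>2 * ((real k + 1) / real n) * H / c"
    proof -
      have "(l - ls)\<^sup>2 * S \<le> (l - ls)\<^sup>2 * ((real k + 1) / (c * real n) * H)"
        by (intro mult_left_mono SH) auto
      then show ?thesis by (simp add: mult_ac)
    qed
    have e3: "real (k + 1) * L \<le> (real k + 1) * L / c"
    proof -
      have "0 \<le> (real k + 1) * L" using L1 by simp
      then show ?thesis using c by (simp add: pos_le_divide_eq mult_left_le add.commute)
    qed
    have nn: "0 \<le> (l - ls)\<^sup>2 * ((real k + 1) / real n) * H / c" using H c by simp
    have "real (k + 1) * L + real n / real (k + 1) * L * S + (l - ls)\<^sup>2 * S
      \<le> 2 * ((real k + 1) * L / c) + 2 * ((l - ls)\<^sup>2 * ((real k + 1) / real n) * H / c)"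
    proof (rule order_trans[OF add_mono[OF add_mono[OF e3 e1] e2]])
      have "x + x + y \<le> 2 * x + 2 * y" if "0 \<le> y" for x y :: real using that by simp
      from this[OF nn] show "(real k + 1) * L / c + (real k + 1) * L / c + (l - ls)\<^sup>2 * ((real k + 1) / real n) * H / c
        \<le> 2 * ((real k + 1) * L / c) + 2 * ((l - ls)\<^sup>2 * ((real k + 1) / real n) * H / c)" .
    qed
    then have "40000 * \<sigma>\<^sup>2 / real n * (real (k + 1) * L + real n / real (k + 1) * L * S + (l - ls)\<^sup>2 * S)
      \<le> 40000 * \<sigma>\<^sup>2 / real n * (2 * ((real k + 1) * L / c) + 2 * ((l - ls)\<^sup>2 * ((real k + 1) / real n) * H / c))"
      by (rule mult_left_mono) simp
    also have "\<dots> = 80000 / c * \<sigma>\<^sup>2 * ((real k + 1) / real n * L + (l - ls)\<^sup>2 * ((real k + 1) / (real n)\<^sup>2) * H)"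
    proof -
      have "40000 * w / a * (2 * (q * L / c) + 2 * (r * (q / a) * H / c))
        = 80000 / c * w * (q / a * L + r * (q / a\<^sup>2) * H)" for w a q r :: real
        by (simp add: power2_eq_square distrib_left add_divide_distrib mult_ac)
      then show ?thesis .
    qed
    finally show "40000 * \<sigma>\<^sup>2 / real n * (real (k + 1) * L + real n / real (k + 1) * L * S + (l - ls)\<^sup>2 * S)
      \<le> 80000 / c * \<sigma>\<^sup>2 * ((real k + 1) / real n * L + (l - ls)\<^sup>2 * ((real k + 1) / (real n)\<^sup>2) * H)" .
  qed
  show "let k = num_jumps n \<theta>; s = jump_sign n \<theta>; m = piece_length n \<theta>; ls = lambda_star n \<theta> in
       (\<forall>l \<ge> ls. risk n \<sigma> (tv_estimator n \<sigma> l) \<theta>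
          \<le> ennreal (40000 * \<sigma>\<^sup>2 * (Delta1 n \<theta> +
               (l - ls)\<^sup>2 / real n * (\<Sum>i = 0..k. of_bool (s i \<noteq> s (i + 1)) / real (m i))))) \<and>
       (\<forall>c. 0 < c \<longrightarrow> c \<le> 1 \<longrightarrow>
          (\<forall>i \<in> {0..k}. s i \<noteq> s (i + 1) \<longrightarrow> real (m i) \<ge> c * real n / (real k + 1)) \<longrightarrow>
          (\<forall>l \<ge> ls. risk n \<sigma> (tv_estimator n \<sigma> l) \<theta>
             \<le> ennreal (80000 / c * \<sigma>\<^sup>2 *
                  ((real k + 1) / real n * ln (exp 1 * real n / (real k + 1)) +
                   (l - ls)\<^sup>2 * ((real k + 1) / (real n)\<^sup>2) *
                     (\<Sum>i = 0..k. of_bool (s i \<noteq> s (i + 1)))))))"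
    unfolding Let_def k_def[symmetric] s_def[symmetric] m_def[symmetric] ls_def[symmetric] L_def[symmetric]
      S_def[symmetric] H_def[symmetric]
    using A B by blast
qed

end
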